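(* Let $A/B$ be a QF ring extension. Then the natural $(A,A)$-bimodules $\mathrm{End}\,{}_BA$, $A\otimes_BA$ and $\mathrm{End}\,A_B$ are similar. Moreover, $A\otimes_BA\sim E$ as natural $(E,A)$-bimodules, where $E=\mathrm{End}\,A_B$.
   Context: Rings are unital. $X^{(n)}$ denotes the direct sum of $n$ copies of $X$. For bimodules $X,Y$ over the same pair of rings, $X\,|\,Y$ means $X\oplus P\cong Y^{(n)}$ for some bimodule $P$ and some $n\in\mathbb{N}$, and $X\sim Y$ (similar) means $X\,|\,Y$ and $Y\,|\,X$. A ring extension $A/B$ is a unital ring homomorphism $B\to A$ (not necessarily injective), via which $A$ is a natural $B$-bimodule. $({}_BA)^*=\mathrm{Hom}({}_BA,{}_BB)$ is an $(A,B)$-bimodule via $(a\cdot f\cdot b)(x)=f(xa)b$, and $(A_B)^*=\mathrm{Hom}(A_B,B_B)$ is a $(B,A)$-bimodule via $(b\cdot g\cdot a)(x)=b\,g(ax)$. QF extension: $A/B$ is left QF if ${}_BA$ is finitely generated projective and $A\,|\,({}_BA)^*$ as $(A,B)$-bimodules; right QF if $A_B$ is finitely generated projective and $A\,|\,(A_B)^*$ as $(B,A)$-bimodules; QF if both left and right QF. Natural bimodule structures: on $\mathrm{End}\,{}_BA$, $x\cdot f\cdot y=\rho_y\circ f\circ\rho_x$ for $x,y\in A$, where $\rho_x(a)=ax$; on $E=\mathrm{End}\,A_B$, $x\cdot f\cdot y=\lambda_x\circ f\circ\lambda_y$, where $\lambda_x(a)=xa$, and $E$ is an $(E,A)$-bimodule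 by left multiplication by $E$ and right multiplication by $\lambda_y$, $y\in A$; $A\otimes_BA$ is an $(E,A)$-bimodule via $f\cdot(a\otimes_Ba')\cdot y=f(a)\otimes_Ba'y$. *)

theory Defs
  imports "HOL-Algebra.Algebra"
begin

text \<open>
  A bimodule extends the record \<^typ>\<open>('r, 'x) module\<close> by a right action. As for that
  record, the inherited fields \<^const>\<open>monoid.mult\<close> and \<^const>\<open>monoid.one\<close> play no role.
  The library's \<^locale>\<open>module\<close> requires a commutative ring of scalars, hence
  \<open>left_module\<close> below.
\<close>

record ('r, 's, 'x) bimodule = "('r, 'x) module" +
  rsmult :: "'x \<Rightarrow> 's \<Rightarrow> 'x"

locale left_module = R: ring R + M: abelian_group M
  for R :: "('r, 'k) ring_scheme" (structure) and M :: "('r, 'x, 'm) module_scheme" (structure) +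
  assumes smult_closed: "\<lbrakk>a \<in> carrier R; x \<in> carrier M\<rbrakk> \<Longrightarrow> a \<odot>\<^bsub>M\<^esub> x \<in> carrier M"
    and smult_l_distr: "\<lbrakk>a \<in> carrier R; b \<in> carrier R; x \<in> carrier M\<rbrakk> \<Longrightarrow>
          (a \<oplus>\<^bsub>R\<^esub> b) \<odot>\<^bsub>M\<^esub> x = a \<odot>\<^bsub>M\<^esub> x \<oplus>\<^bsub>M\<^esub> b \<odot>\<^bsub>M\<^esub> x"
    and smult_r_distr: "\<lbrakk>a \<in> carrier R; x \<in> carrier M; y \<in> carrier M\<rbrakk> \<Longrightarrow>
          a \<odot>\<^bsub>M\<^esub> (x \<oplus>\<^bsub>M\<^esub> y) = a \<odot>\<^bsub>M\<^esub> x \<oplus>\<^bsub>M\<^esub> a \<odot>\<^bsub>M\<^esub> y"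
    and smult_assoc: "\<lbrakk>a \<in> carrier R; b \<in> carrier R; x \<in> carrier M\<rbrakk> \<Longrightarrow>
          (a \<otimes>\<^bsub>R\<^esub> b) \<odot>\<^bsub>M\<^esub> x = a \<odot>\<^bsub>M\<^esub> (b \<odot>\<^bsub>M\<^esub> x)"
    and smult_one: "x \<in> carrier M \<Longrightarrow> \<one>\<^bsub>R\<^esub> \<odot>\<^bsub>M\<^esub> x = x"

text \<open>Right \<open>S\<close>-modules are treated as left modules over the opposite ring of \<open>S\<close>.\<close>

definition op_ring :: "('r, 'm) ring_scheme \<Rightarrow> ('r, 'm) ring_scheme" where
  "op_ring R = R\<lparr>monoid.mult := \<lambda>x y. y \<otimes>\<^bsub>R\<^esub> x\<rparr>"

definition right_part :: "('r, 's, 'x, 'm) bimodule_scheme \<Rightarrow> ('s, 'x) module" where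
  "right_part M = \<lparr>carrier = carrier M, monoid.mult = monoid.mult M, monoid.one = monoid.one M,
     ring.zero = ring.zero M, ring.add = ring.add M, smult = (\<lambda>s x. rsmult M x s)\<rparr>"

locale bimodule = left: left_module R M + right: left_module "op_ring S" "right_part M"
  for R :: "('r, 'k) ring_scheme" (structure) and S :: "('s, 'l) ring_scheme" (structure)
    and M :: "('r, 's, 'x, 'm) bimodule_scheme" (structure) +
  assumes smult_rsmult: "\<lbrakk>r \<in> carrier R; s \<in> carrier S; x \<in> carrier M\<rbrakk> \<Longrightarrow>
    rsmult M (r \<odot>\<^bsub>M\<^esub> x) s = r \<odot>\<^bsub>M\<^esub> rsmult M x s"

text \<open>Linear maps are extensional outside the carrier, so that equality of maps is equality
  on the carrier.\<close>

definition lin_hom :: "('r, 'k) ring_scheme \<Rightarrow> ('r, 'x, 'm) module_scheme \<Rightarrow>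
    ('r, 'y, 'n) module_scheme \<Rightarrow> ('x \<Rightarrow> 'y) set" where
  "lin_hom R M N = {f \<in> carrier M \<rightarrow>\<^sub>E carrier N. f \<in> hom (add_monoid M) (add_monoid N) \<and>
     (\<forall>r\<in>carrier R. \<forall>x\<in>carrier M. f (r \<odot>\<^bsub>M\<^esub> x) = r \<odot>\<^bsub>N\<^esub> f x)}"

definition bimod_hom :: "('r, 'k) ring_scheme \<Rightarrow> ('s, 'l) ring_scheme \<Rightarrow>
    ('r, 's, 'x, 'm) bimodule_scheme \<Rightarrow> ('r, 's, 'y, 'n) bimodule_scheme \<Rightarrow> ('x \<Rightarrow> 'y) set" where
  "bimod_hom R S M N = lin_hom R M N \<inter> lin_hom S (right_part M) (right_part N)"

definition bimod_iso :: "('r, 'k) ring_scheme \<Rightarrow> ('s, 'l) ring_scheme \<Rightarrow>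
    ('r, 's, 'x, 'm) bimodule_scheme \<Rightarrow> ('r, 's, 'y, 'n) bimodule_scheme \<Rightarrow> bool" where
  "bimod_iso R S M N \<longleftrightarrow> (\<exists>f\<in>bimod_hom R S M N. bij_betw f (carrier M) (carrier N))"

definition bimod_sum :: "('r, 's, 'x, 'm) bimodule_scheme \<Rightarrow> ('r, 's, 'y, 'n) bimodule_scheme \<Rightarrow>
    ('r, 's, 'x \<times> 'y) bimodule" where
  "bimod_sum M N = \<lparr>carrier = carrier M \<times> carrier N, monoid.mult = undefined, monoid.one = undefined,
     ring.zero = (\<zero>\<^bsub>M\<^esub>, \<zero>\<^bsub>N\<^esub>),
     ring.add = (\<lambda>(x, y) (x', y'). (x \<oplus>\<^bsub>M\<^esub> x', y \<oplus>\<^bsub>N\<^esub> y')),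
     smult = (\<lambda>r (x, y). (r \<odot>\<^bsub>M\<^esub> x, r \<odot>\<^bsub>N\<^esub> y)),
     rsmult = (\<lambda>(x, y) s. (rsmult M x s, rsmult N y s))\<rparr>"

definition bimod_power :: "('r, 's, 'x, 'm) bimodule_scheme \<Rightarrow> nat \<Rightarrow>
    ('r, 's, nat \<Rightarrow> 'x) bimodule" where
  "bimod_power M n = \<lparr>carrier = {..<n} \<rightarrow>\<^sub>E carrier M, monoid.mult = undefined, monoid.one = undefined,
     ring.zero = (\<lambda>i\<in>{..<n}. \<zero>\<^bsub>M\<^esub>),
     ring.add = (\<lambda>x y. \<lambda>i\<in>{..<n}. x i \<oplus>\<^bsub>M\<^esub> y i),
     smult = (\<lambda>r x. \<lambda>i\<in>{..<n}. r \<odot>\<^bsub>M\<^esub> x i),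
     rsmult = (\<lambda>x s. \<lambda>i\<in>{..<n}. rsmult M (x i) s)\<rparr>"

text \<open>
  The relation \<open>M | N\<close>. The complement \<open>P\<close> is isomorphic to a subbimodule of \<open>N\<^sup>(\<^sup>n\<^sup>)\<close>, so fixing
  the element type to that of the elements of \<open>N\<^sup>(\<^sup>n\<^sup>)\<close> is no loss of generality.
\<close>

definition bimod_divides :: "('r, 'k) ring_scheme \<Rightarrow> ('s, 'l) ring_scheme \<Rightarrow>
    ('r, 's, 'x, 'm) bimodule_scheme \<Rightarrow> ('r, 's, 'y, 'n) bimodule_scheme \<Rightarrow> bool" where
  "bimod_divides R S M N \<longleftrightarrow> bimodule R S M \<and> bimodule R S N \<and>
     (\<exists>(P :: ('r, 's, nat \<Rightarrow> 'y) bimodule) n.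
        bimodule R S P \<and> bimod_iso R S (bimod_sum M P) (bimod_power N n))"

definition bimod_similar :: "('r, 'k) ring_scheme \<Rightarrow> ('s, 'l) ring_scheme \<Rightarrow>
    ('r, 's, 'x, 'm) bimodule_scheme \<Rightarrow> ('r, 's, 'y, 'n) bimodule_scheme \<Rightarrow> bool" where
  "bimod_similar R S M N \<longleftrightarrow> bimod_divides R S M N \<and> bimod_divides R S N M"

definition fin_gen :: "('r, 'k) ring_scheme \<Rightarrow> ('r, 'x, 'm) module_scheme \<Rightarrow> bool" where
  "fin_gen R M \<longleftrightarrow> (\<exists>G. finite G \<and> G \<subseteq> carrier M \<and>
     (\<forall>x\<in>carrier M. \<exists>c\<in>G \<rightarrow> carrier R. x = (\<Oplus>\<^bsub>M\<^esub>g\<in>G. c g \<odot>\<^bsub>M\<^esub> g)))"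

text \<open>
  Projectivity is the lifting property along surjections \<open>N \<rightarrow> M\<close>. A definition cannot quantify
  over types, so \<open>N\<close> has elements in \<^typ>\<open>'x \<Rightarrow> 'r\<close> and \<open>M\<close> in \<^typ>\<open>'x\<close>. This is no
  restriction: lifting the identity of \<open>P\<close> along the free module on the set \<open>carrier P\<close>
  (finitely supported functions \<^typ>\<open>'x \<Rightarrow> 'r\<close>) makes \<open>P\<close> a direct summand of a free module,
  which gives the lifting property for modules of arbitrary types.
\<close>

definition projective :: "('r, 'k) ring_scheme \<Rightarrow> ('r, 'x, 'm) module_scheme \<Rightarrow> bool" where
  "projective R P \<longleftrightarrow>
     (\<forall>(N :: ('r, 'x \<Rightarrow> 'r) module) (M :: ('r, 'x) module) g f.
        left_module R N \<and> left_module R M \<and> g \<in> lin_hom R N M \<and> g ` carrier N = carrier M \<and>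
        f \<in> lin_hom R P M \<longrightarrow>
        (\<exists>f'\<in>lin_hom R P N. \<forall>x\<in>carrier P. g (f' x) = f x))"

definition fg_projective :: "('r, 'k) ring_scheme \<Rightarrow> ('r, 'x, 'm) module_scheme \<Rightarrow> bool" where
  "fg_projective R M \<longleftrightarrow> left_module R M \<and> fin_gen R M \<and> projective R M"

text \<open>The additive group of linear maps with prescribed actions.\<close>

definition hom_bimod :: "('k, 'm) ring_scheme \<Rightarrow> ('k, 'x, 'p) module_scheme \<Rightarrow>
    ('k, 'y, 'q) module_scheme \<Rightarrow> ('r \<Rightarrow> ('x \<Rightarrow> 'y) \<Rightarrow> 'x \<Rightarrow> 'y) \<Rightarrow>
    (('x \<Rightarrow> 'y) \<Rightarrow> 's \<Rightarrow> 'x \<Rightarrow> 'y) \<Rightarrow> ('r, 's, 'x \<Rightarrow> 'y) bimodule" where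
  "hom_bimod K M N l r = \<lparr>carrier = lin_hom K M N, monoid.mult = undefined, monoid.one = undefined,
     ring.zero = (\<lambda>x\<in>carrier M. \<zero>\<^bsub>N\<^esub>),
     ring.add = (\<lambda>f g. \<lambda>x\<in>carrier M. f x \<oplus>\<^bsub>N\<^esub> g x),
     smult = l, rsmult = r\<rparr>"

text \<open>
  \<open>M \<otimes>\<^sub>S N\<close> for an \<open>(R,S)\<close>-bimodule \<open>M\<close> and an \<open>(S,T)\<close>-bimodule \<open>N\<close>: the free abelian group on
  \<open>M \<times> N\<close> modulo the usual relations. The map \<open>tensor_map S M N \<phi>\<close> is
  induced on the quotient by \<open>\<phi>\<close> acting on pure tensors; its value on a coset is given as
  the union of the cosets of the images of all representatives, all of which
  coincide when \<open>\<phi>\<close> respects the relations.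
\<close>

definition tensor_free :: "('r, 's, 'x, 'm) bimodule_scheme \<Rightarrow> ('s, 't, 'y, 'n) bimodule_scheme \<Rightarrow>
    ('x \<times> 'y \<Rightarrow>\<^sub>0 int) monoid" where
  "tensor_free M N = free_Abelian_group (carrier M \<times> carrier N)"

definition tensor_rels :: "('s, 'k) ring_scheme \<Rightarrow> ('r, 's, 'x, 'm) bimodule_scheme \<Rightarrow>
    ('s, 't, 'y, 'n) bimodule_scheme \<Rightarrow> ('x \<times> 'y \<Rightarrow>\<^sub>0 int) set" where
  "tensor_rels S M N = generate (tensor_free M N)
    ({frag_of (x \<oplus>\<^bsub>M\<^esub> x', y) - frag_of (x, y) - frag_of (x', y) | x x' y.
        x \<in> carrier M \<and> x' \<in> carrier M \<and> y \<in> carrier N} \<union>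
     {frag_of (x, y \<oplus>\<^bsub>N\<^esub> y') - frag_of (x, y) - frag_of (x, y') | x y y'.
        x \<in> carrier M \<and> y \<in> carrier N \<and> y' \<in> carrier N} \<union>
     {frag_of (rsmult M x s, y) - frag_of (x, s \<odot>\<^bsub>N\<^esub> y) | x s y.
        x \<in> carrier M \<and> s \<in> carrier S \<and> y \<in> carrier N})"

definition tensor_map :: "('s, 'k) ring_scheme \<Rightarrow> ('r, 's, 'x, 'm) bimodule_scheme \<Rightarrow>
    ('s, 't, 'y, 'n) bimodule_scheme \<Rightarrow> ('x \<times> 'y \<Rightarrow> 'x \<times> 'y) \<Rightarrow>
    ('x \<times> 'y \<Rightarrow>\<^sub>0 int) set \<Rightarrow> ('x \<times> 'y \<Rightarrow>\<^sub>0 int) set" where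
  "tensor_map S M N \<phi> C =
     (\<Union>w\<in>C. tensor_rels S M N #>\<^bsub>tensor_free M N\<^esub> frag_extend (\<lambda>p. frag_of (\<phi> p)) w)"

definition tensor_bimod :: "('s, 'k) ring_scheme \<Rightarrow> ('r, 's, 'x, 'm) bimodule_scheme \<Rightarrow>
    ('s, 't, 'y, 'n) bimodule_scheme \<Rightarrow> ('r, 't, ('x \<times> 'y \<Rightarrow>\<^sub>0 int) set) bimodule" where
  "tensor_bimod S M N = (let Q = tensor_free M N Mod tensor_rels S M N in
    \<lparr>carrier = carrier Q, monoid.mult = undefined, monoid.one = undefined,
     ring.zero = monoid.one Q, ring.add = monoid.mult Q,
     smult = (\<lambda>r. tensor_map S M N (\<lambda>(x, y). (r \<odot>\<^bsub>M\<^esub> x, y))),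
     rsmult = (\<lambda>C t. tensor_map S M N (\<lambda>(x, y). (x, rsmult N y t)) C)\<rparr>)"

text \<open>
  From here on \<open>h\<close> is the structure homomorphism \<open>B \<rightarrow> A\<close> of a ring extension \<open>A/B\<close>.
  \<open>ring_bimod A l r\<close> is the additive group of \<open>A\<close> with prescribed actions; the suffixes of
  the names name the rings acting on the left and on the right. One-sided structures
  are obtained by forgetting an action.
\<close>

definition ring_bimod :: "('a, 'm) ring_scheme \<Rightarrow> ('r \<Rightarrow> 'a \<Rightarrow> 'a) \<Rightarrow> ('a \<Rightarrow> 's \<Rightarrow> 'a) \<Rightarrow>
    ('r, 's, 'a) bimodule" where
  "ring_bimod A l r = \<lparr>carrier = carrier A, monoid.mult = monoid.mult A, monoid.one = monoid.one A,
     ring.zero = ring.zero A, ring.add = ring.add A, smult = l, rsmult = r\<rparr>"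

definition reg_bimod :: "('a, 'm) ring_scheme \<Rightarrow> ('a, 'a, 'a) bimodule" where
  "reg_bimod A = ring_bimod A (\<lambda>x a. x \<otimes>\<^bsub>A\<^esub> a) (\<lambda>a y. a \<otimes>\<^bsub>A\<^esub> y)"

definition A_AB :: "('a, 'm) ring_scheme \<Rightarrow> ('b \<Rightarrow> 'a) \<Rightarrow> ('a, 'b, 'a) bimodule" where
  "A_AB A h = ring_bimod A (\<lambda>x a. x \<otimes>\<^bsub>A\<^esub> a) (\<lambda>a b. a \<otimes>\<^bsub>A\<^esub> h b)"

definition A_BA :: "('a, 'm) ring_scheme \<Rightarrow> ('b \<Rightarrow> 'a) \<Rightarrow> ('b, 'a, 'a) bimodule" where
  "A_BA A h = ring_bimod A (\<lambda>b a. h b \<otimes>\<^bsub>A\<^esub> a) (\<lambda>a y. a \<otimes>\<^bsub>A\<^esub> y)"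

definition A_EB :: "('a, 'm) ring_scheme \<Rightarrow> ('b \<Rightarrow> 'a) \<Rightarrow> ('a \<Rightarrow> 'a, 'b, 'a) bimodule" where
  "A_EB A h = ring_bimod A (\<lambda>f a. f a) (\<lambda>a b. a \<otimes>\<^bsub>A\<^esub> h b)"

definition left_dual_AB :: "('a, 'm) ring_scheme \<Rightarrow> ('b, 'n) ring_scheme \<Rightarrow> ('b \<Rightarrow> 'a) \<Rightarrow>
    ('a, 'b, 'a \<Rightarrow> 'b) bimodule" where
  "left_dual_AB A B h = hom_bimod B (A_BA A h) (reg_bimod B)
     (\<lambda>a f. \<lambda>x\<in>carrier A. f (x \<otimes>\<^bsub>A\<^esub> a)) (\<lambda>f b. \<lambda>x\<in>carrier A. f x \<otimes>\<^bsub>B\<^esub> b)"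

definition right_dual_BA :: "('a, 'm) ring_scheme \<Rightarrow> ('b, 'n) ring_scheme \<Rightarrow> ('b \<Rightarrow> 'a) \<Rightarrow>
    ('b, 'a, 'a \<Rightarrow> 'b) bimodule" where
  "right_dual_BA A B h = hom_bimod B (right_part (A_AB A h)) (right_part (reg_bimod B))
     (\<lambda>b g. \<lambda>x\<in>carrier A. b \<otimes>\<^bsub>B\<^esub> g x) (\<lambda>g a. \<lambda>x\<in>carrier A. g (a \<otimes>\<^bsub>A\<^esub> x))"

definition left_QF :: "('a, 'm) ring_scheme \<Rightarrow> ('b, 'n) ring_scheme \<Rightarrow> ('b \<Rightarrow> 'a) \<Rightarrow> bool" where
  "left_QF A B h \<longleftrightarrow>
     fg_projective B (A_BA A h) \<and> bimod_divides A B (A_AB A h) (left_dual_AB A B h)"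

definition right_QF :: "('a, 'm) ring_scheme \<Rightarrow> ('b, 'n) ring_scheme \<Rightarrow> ('b \<Rightarrow> 'a) \<Rightarrow> bool" where
  "right_QF A B h \<longleftrightarrow>
     fg_projective (op_ring B) (right_part (A_AB A h)) \<and>
     bimod_divides B A (A_BA A h) (right_dual_BA A B h)"

definition QF_extension :: "('a, 'm) ring_scheme \<Rightarrow> ('b, 'n) ring_scheme \<Rightarrow> ('b \<Rightarrow> 'a) \<Rightarrow> bool" where
  "QF_extension A B h \<longleftrightarrow> left_QF A B h \<and> right_QF A B h"

definition left_End_AA :: "('a, 'm) ring_scheme \<Rightarrow> ('b, 'n) ring_scheme \<Rightarrow> ('b \<Rightarrow> 'a) \<Rightarrow>
    ('a, 'a, 'a \<Rightarrow> 'a) bimodule" where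
  "left_End_AA A B h = hom_bimod B (A_BA A h) (A_BA A h)
     (\<lambda>x f. \<lambda>a\<in>carrier A. f (a \<otimes>\<^bsub>A\<^esub> x)) (\<lambda>f y. \<lambda>a\<in>carrier A. f a \<otimes>\<^bsub>A\<^esub> y)"

definition right_End_AA :: "('a, 'm) ring_scheme \<Rightarrow> ('b, 'n) ring_scheme \<Rightarrow> ('b \<Rightarrow> 'a) \<Rightarrow>
    ('a, 'a, 'a \<Rightarrow> 'a) bimodule" where
  "right_End_AA A B h = hom_bimod B (right_part (A_AB A h)) (right_part (A_AB A h))
     (\<lambda>x f. \<lambda>a\<in>carrier A. x \<otimes>\<^bsub>A\<^esub> f a) (\<lambda>f y. \<lambda>a\<in>carrier A. f (y \<otimes>\<^bsub>A\<^esub> a))"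

definition right_End_ring :: "('a, 'm) ring_scheme \<Rightarrow> ('b, 'n) ring_scheme \<Rightarrow> ('b \<Rightarrow> 'a) \<Rightarrow>
    ('a \<Rightarrow> 'a) ring" where
  "right_End_ring A B h =
    \<lparr>carrier = lin_hom B (right_part (A_AB A h)) (right_part (A_AB A h)),
     monoid.mult = compose (carrier A), monoid.one = (\<lambda>a\<in>carrier A. a),
     ring.zero = (\<lambda>a\<in>carrier A. \<zero>\<^bsub>A\<^esub>),
     ring.add = (\<lambda>f g. \<lambda>a\<in>carrier A. f a \<oplus>\<^bsub>A\<^esub> g a)\<rparr>"

definition right_End_EA :: "('a, 'm) ring_scheme \<Rightarrow> ('b, 'n) ring_scheme \<Rightarrow> ('b \<Rightarrow> 'a) \<Rightarrow>
    ('a \<Rightarrow> 'a, 'a, 'a \<Rightarrow> 'a) bimodule" where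
  "right_End_EA A B h = hom_bimod B (right_part (A_AB A h)) (right_part (A_AB A h))
     (\<lambda>g f. compose (carrier A) g f) (\<lambda>f y. \<lambda>a\<in>carrier A. f (y \<otimes>\<^bsub>A\<^esub> a))"

definition tensor_AA :: "('a, 'm) ring_scheme \<Rightarrow> ('b, 'n) ring_scheme \<Rightarrow> ('b \<Rightarrow> 'a) \<Rightarrow>
    ('a, 'a, ('a \<times> 'a \<Rightarrow>\<^sub>0 int) set) bimodule" where
  "tensor_AA A B h = tensor_bimod B (A_AB A h) (A_BA A h)"

definition tensor_EA :: "('a, 'm) ring_scheme \<Rightarrow> ('b, 'n) ring_scheme \<Rightarrow> ('b \<Rightarrow> 'a) \<Rightarrow>
    ('a \<Rightarrow> 'a, 'a, ('a \<times> 'a \<Rightarrow>\<^sub>0 int) set) bimodule" where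
  "tensor_EA A B h = tensor_bimod B (A_EB A h) (A_BA A h)"

end

theory Submission
  imports Defs
begin

text \<open>
  For bimodules, \<open>M | N\<close> holds iff there are finitely many bimodule maps \<open>f\<^sub>i : M \<rightarrow> N\<close> and
  \<open>g\<^sub>i : N \<rightarrow> M\<close> with \<open>\<Sum> g\<^sub>i f\<^sub>i = id\<close>. Combined with a dual basis of \<open>A\<^sub>B\<close>, such a family for
  \<open>A | (A\<^sub>B)\<^sup>*\<close> amounts to \<open>(B,B)\<close>-bimodule maps \<open>\<phi>\<^sub>i : A \<rightarrow> B\<close> and elements
  \<open>\<Sum>\<^sub>k u\<^sub>i\<^sub>k \<otimes> v\<^sub>i\<^sub>k\<close> of \<open>A \<otimes>\<^sub>B A\<close> commuting with \<open>A\<close> (Casimir elements) such that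
  \<open>\<Sum> \<phi>\<^sub>i(a u\<^sub>i\<^sub>k) v\<^sub>i\<^sub>k = a\<close>; the left QF condition likewise gives data with
  \<open>\<Sum> u\<^sub>i\<^sub>k \<phi>\<^sub>i(v\<^sub>i\<^sub>k a) = a\<close>. Then \<open>F \<mapsto> \<Sum>\<^sub>k u\<^sub>i\<^sub>k \<otimes> F(v\<^sub>i\<^sub>k)\<close> and
  \<open>x \<otimes> w \<mapsto> (a \<mapsto> \<phi>\<^sub>i(a x) w)\<close> are bimodule maps between \<open>End \<^sub>BA\<close> and \<open>A \<otimes>\<^sub>B A\<close>. The sum of
  their composites is the identity of \<open>End \<^sub>BA\<close> for right QF data, and that of \<open>A \<otimes>\<^sub>B A\<close>, composing
  in the other order, for left QF data. For \<open>End A\<^sub>B\<close> one uses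
  \<open>F \<mapsto> \<Sum>\<^sub>k F(u\<^sub>i\<^sub>k) \<otimes> v\<^sub>i\<^sub>k\<close> and \<open>x \<otimes> w \<mapsto> (a \<mapsto> x \<phi>\<^sub>i(w a))\<close>, with the roles of the two
  kinds of data exchanged.
\<close>

section \<open>Bimodules and their direct summands\<close>

text \<open>The data are read off from Hom spaces. A \<open>(B,A)\<close>-map f from A to the right
  dual is determined by \<phi> = f(1), since f(a) = f(1) a; computing f(h b) from either side makes
  \<phi> linear over B on both sides. If y and \<psi>_y form a dual basis of A as a right B-module,
  a left B-linear map g from the dual to A is encoded by \<Sum> y \<otimes> g(\<psi>_y), and right
  A-linearity of g becomes the Casimir property.

  A map from endomorphisms to tensors must respect two actions. One acts on the values of F and is
  respected formally; the other acts on its argument, and only there is the Casimir property spent.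
  For right endomorphisms the formal side is the left one, so any ring K acting on A compatibly with
  B may stand there: K = A and K = E are treated at once.

  Each similarity draws one direction from each half of the QF condition: the coefficients
  \<phi>(...) have to be absorbed by F or moved across the tensor sign, and the side on which they
  stand decides which reproducing formula can collect them.\<close>

lemma op_ring_simps [simp]:
  "carrier (op_ring R) = carrier R" "\<one>\<^bsub>op_ring R\<^esub> = \<one>\<^bsub>R\<^esub>" "\<zero>\<^bsub>op_ring R\<^esub> = \<zero>\<^bsub>R\<^esub>"
  "x \<oplus>\<^bsub>op_ring R\<^esub> y = x \<oplus>\<^bsub>R\<^esub> y" "x \<otimes>\<^bsub>op_ring R\<^esub> y = y \<otimes>\<^bsub>R\<^esub> x"
  by (simp_all add: op_ring_def)

lemma right_part_simps [simp]:
  "carrier (right_part M) = carrier M" "\<zero>\<^bsub>right_part M\<^esub> = \<zero>\<^bsub>M\<^esub>"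
  "x \<oplus>\<^bsub>right_part M\<^esub> y = x \<oplus>\<^bsub>M\<^esub> y" "s \<odot>\<^bsub>right_part M\<^esub> x = rsmult M x s"
  by (simp_all add: right_part_def)

lemma abelian_group_cong:
  assumes "abelian_group M" "carrier N = carrier M" "ring.add N = ring.add M" "\<zero>\<^bsub>N\<^esub> = \<zero>\<^bsub>M\<^esub>"
  shows "abelian_group N"
  using assms(2-) abelian_groupE[OF assms(1)] by (intro abelian_groupI) auto

text \<open>\<open>finsum\<close> takes the whole record as argument, so modules with one additive
  group but different actions or record types have formally different sums. This bridges
  \<open>A\<close>, \<open>A_BA\<close>, \<open>A_KB\<close>, \<open>right_part\<close> and the
  tensor records for different left actions.\<close>

lemma finsum_cong_add_monoid:
  fixes M :: "('x, 'm) ring_scheme" and N :: "('x, 'n) ring_scheme"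
  assumes "abelian_group M" "abelian_group N"
    and "carrier N = carrier M" "ring.add N = ring.add M" "\<zero>\<^bsub>N\<^esub> = \<zero>\<^bsub>M\<^esub>"
    and f: "f \<in> I \<rightarrow> carrier M"
  shows "finsum N f I = finsum M f I"
proof -
  interpret M: abelian_group M by fact
  interpret N: abelian_group N by fact
  show ?thesis using f
  proof (induction I rule: infinite_finite_induct)
    case (insert i I)
    then show ?case using assms(3-5)
      by (subst M.finsum_insert; (subst N.finsum_insert)?) auto
  qed (use assms in auto)
qed

lemma ring_op_ring [simp]: "ring (op_ring R) \<longleftrightarrow> ring R"
proof -
  have *: "ring (op_ring R)" if "ring R" for R :: "('r, 'm) ring_scheme"
  proof -
    interpret ring R by fact
    show ?thesis
      by (intro ringI abelian_group_cong[OF is_abelian_group] monoidI)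
        (auto simp: m_assoc l_distr r_distr op_ring_def)
  qed
  moreover have "op_ring (op_ring R) = R"
    by (simp add: op_ring_def)
  ultimately show ?thesis by metis
qed

lemma bimoduleI:
  assumes "ring R" "ring S" "abelian_group M"
    and "\<And>r x. r \<in> carrier R \<Longrightarrow> x \<in> carrier M \<Longrightarrow> r \<odot>\<^bsub>M\<^esub> x \<in> carrier M"
    and "\<And>r s x. r \<in> carrier R \<Longrightarrow> s \<in> carrier R \<Longrightarrow> x \<in> carrier M \<Longrightarrow>
      (r \<oplus>\<^bsub>R\<^esub> s) \<odot>\<^bsub>M\<^esub> x = r \<odot>\<^bsub>M\<^esub> x \<oplus>\<^bsub>M\<^esub> s \<odot>\<^bsub>M\<^esub> x"
    and "\<And>r x y. r \<in> carrier R \<Longrightarrow> x \<in> carrier M \<Longrightarrow> y \<in> carrier M \<Longrightarrow>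
      r \<odot>\<^bsub>M\<^esub> (x \<oplus>\<^bsub>M\<^esub> y) = r \<odot>\<^bsub>M\<^esub> x \<oplus>\<^bsub>M\<^esub> r \<odot>\<^bsub>M\<^esub> y"
    and "\<And>r s x. r \<in> carrier R \<Longrightarrow> s \<in> carrier R \<Longrightarrow> x \<in> carrier M \<Longrightarrow>
      (r \<otimes>\<^bsub>R\<^esub> s) \<odot>\<^bsub>M\<^esub> x = r \<odot>\<^bsub>M\<^esub> (s \<odot>\<^bsub>M\<^esub> x)"
    and "\<And>x. x \<in> carrier M \<Longrightarrow> \<one>\<^bsub>R\<^esub> \<odot>\<^bsub>M\<^esub> x = x"
    and "\<And>s x. s \<in> carrier S \<Longrightarrow> x \<in> carrier M \<Longrightarrow> rsmult M x s \<in> carrier M"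
    and "\<And>s t x. s \<in> carrier S \<Longrightarrow> t \<in> carrier S \<Longrightarrow> x \<in> carrier M \<Longrightarrow>
      rsmult M x (s \<oplus>\<^bsub>S\<^esub> t) = rsmult M x s \<oplus>\<^bsub>M\<^esub> rsmult M x t"
    and "\<And>s x y. s \<in> carrier S \<Longrightarrow> x \<in> carrier M \<Longrightarrow> y \<in> carrier M \<Longrightarrow>
      rsmult M (x \<oplus>\<^bsub>M\<^esub> y) s = rsmult M x s \<oplus>\<^bsub>M\<^esub> rsmult M y s"
    and "\<And>s t x. s \<in> carrier S \<Longrightarrow> t \<in> carrier S \<Longrightarrow> x \<in> carrier M \<Longrightarrow>
      rsmult M x (s \<otimes>\<^bsub>S\<^esub> t) = rsmult M (rsmult M x s) t"
    and "\<And>x. x \<in> carrier M \<Longrightarrow> rsmult M x \<one>\<^bsub>S\<^esub> = x"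
    and "\<And>r s x. r \<in> carrier R \<Longrightarrow> s \<in> carrier S \<Longrightarrow> x \<in> carrier M \<Longrightarrow>
      rsmult M (r \<odot>\<^bsub>M\<^esub> x) s = r \<odot>\<^bsub>M\<^esub> rsmult M x s"
  shows "bimodule R S M"
proof (intro bimodule.intro left_module.intro)
  show "abelian_group (right_part M)"
    by (rule abelian_group_cong[OF assms(3)]) (simp_all add: right_part_def)
qed (use assms in \<open>auto simp: left_module_axioms_def bimodule_axioms_def\<close>)

context bimodule
begin

lemma ring_right: "ring S"
  using right.R.ring_axioms by simp

lemma rsmult_closed [simp, intro]: "\<lbrakk>x \<in> carrier M; s \<in> carrier S\<rbrakk> \<Longrightarrow> rsmult M x s \<in> carrier M"
  using right.smult_closed by simp

lemma rsmult_r_distr: "\<lbrakk>s \<in> carrier S; t \<in> carrier S; x \<in> carrier M\<rbrakk> \<Longrightarrow>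
    rsmult M x (s \<oplus>\<^bsub>S\<^esub> t) = rsmult M x s \<oplus>\<^bsub>M\<^esub> rsmult M x t"
  using right.smult_l_distr by simp

lemma rsmult_l_distr: "\<lbrakk>s \<in> carrier S; x \<in> carrier M; y \<in> carrier M\<rbrakk> \<Longrightarrow>
    rsmult M (x \<oplus>\<^bsub>M\<^esub> y) s = rsmult M x s \<oplus>\<^bsub>M\<^esub> rsmult M y s"
  using right.smult_r_distr by simp

lemma rsmult_assoc: "\<lbrakk>s \<in> carrier S; t \<in> carrier S; x \<in> carrier M\<rbrakk> \<Longrightarrow>
    rsmult M x (s \<otimes>\<^bsub>S\<^esub> t) = rsmult M (rsmult M x s) t"
  using right.smult_assoc[of t s x] by simp

lemma rsmult_one: "x \<in> carrier M \<Longrightarrow> rsmult M x \<one>\<^bsub>S\<^esub> = x"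
  using right.smult_one[of x] by simp

lemmas smult_closed' [simp, intro] = left.smult_closed

lemmas smult_simps = left.smult_l_distr left.smult_r_distr left.smult_assoc left.smult_one
  rsmult_l_distr rsmult_r_distr rsmult_assoc rsmult_one smult_rsmult

lemma abelian_group_axioms: "abelian_group M" ..

end

section \<open>Bimodule maps and additive maps\<close>

lemma bimod_hom_iff:
  "f \<in> bimod_hom R S M N \<longleftrightarrow> f \<in> carrier M \<rightarrow>\<^sub>E carrier N
    \<and> (\<forall>x\<in>carrier M. \<forall>y\<in>carrier M. f (x \<oplus>\<^bsub>M\<^esub> y) = f x \<oplus>\<^bsub>N\<^esub> f y)
    \<and> (\<forall>r\<in>carrier R. \<forall>x\<in>carrier M. f (r \<odot>\<^bsub>M\<^esub> x) = r \<odot>\<^bsub>N\<^esub> f x)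
    \<and> (\<forall>s\<in>carrier S. \<forall>x\<in>carrier M. f (rsmult M x s) = rsmult N (f x) s)"
  by (auto simp: bimod_hom_def lin_hom_def hom_def)

lemma bimod_homI:
  assumes "\<And>x. x \<in> carrier M \<Longrightarrow> f x \<in> carrier N"
    and "\<And>x y. x \<in> carrier M \<Longrightarrow> y \<in> carrier M \<Longrightarrow> f (x \<oplus>\<^bsub>M\<^esub> y) = f x \<oplus>\<^bsub>N\<^esub> f y"
    and "\<And>r x. r \<in> carrier R \<Longrightarrow> x \<in> carrier M \<Longrightarrow> f (r \<odot>\<^bsub>M\<^esub> x) = r \<odot>\<^bsub>N\<^esub> f x"
    and "\<And>s x. s \<in> carrier S \<Longrightarrow> x \<in> carrier M \<Longrightarrow> f (rsmult M x s) = rsmult N (f x) s"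
    and "bimodule R S M"
  shows "restrict f (carrier M) \<in> bimod_hom R S M N"
proof -
  interpret bimodule R S M by fact
  show ?thesis using assms by (auto simp: bimod_hom_iff)
qed

lemma lin_hom_iff:
  "f \<in> lin_hom R M N \<longleftrightarrow> f \<in> carrier M \<rightarrow>\<^sub>E carrier N
    \<and> (\<forall>x\<in>carrier M. \<forall>y\<in>carrier M. f (x \<oplus>\<^bsub>M\<^esub> y) = f x \<oplus>\<^bsub>N\<^esub> f y)
    \<and> (\<forall>r\<in>carrier R. \<forall>x\<in>carrier M. f (r \<odot>\<^bsub>M\<^esub> x) = r \<odot>\<^bsub>N\<^esub> f x)"
  by (auto simp: lin_hom_def hom_def)

text \<open>Membership in \<open>hom\<close> of the additive monoids in a form that does not depend on the
  extension slots of the records.\<close>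

definition additive_map :: "('x, 'm) ring_scheme \<Rightarrow> ('y, 'n) ring_scheme \<Rightarrow> ('x \<Rightarrow> 'y) \<Rightarrow> bool" where
  "additive_map M N f \<longleftrightarrow> (\<forall>x\<in>carrier M. f x \<in> carrier N) \<and>
     (\<forall>x\<in>carrier M. \<forall>y\<in>carrier M. f (x \<oplus>\<^bsub>M\<^esub> y) = f x \<oplus>\<^bsub>N\<^esub> f y)"

lemma additive_compose:
  "additive_map A B f \<Longrightarrow> additive_map B C g \<Longrightarrow> additive_map A C (\<lambda>x. g (f x))"
  by (auto simp: additive_map_def)

lemma additive_add:
  "abelian_group B \<Longrightarrow> additive_map A B f \<Longrightarrow> additive_map A B g \<Longrightarrow> additive_map A B (\<lambda>x. f x \<oplus>\<^bsub>B\<^esub> g x)"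
  by (auto simp: additive_map_def abelian_group_def abelian_monoid.a_ac abelian_monoid.a_closed)

lemma additive_id: "additive_map A A (\<lambda>x. x)"
  by (auto simp: additive_map_def)

lemma additive_zero:
  assumes "abelian_group M" "abelian_group N" "additive_map M N f"
  shows "f \<zero>\<^bsub>M\<^esub> = \<zero>\<^bsub>N\<^esub>"
proof -
  interpret M: abelian_group M by fact
  interpret N: abelian_group N by fact
  have "f (\<zero>\<^bsub>M\<^esub> \<oplus>\<^bsub>M\<^esub> \<zero>\<^bsub>M\<^esub>) = f \<zero>\<^bsub>M\<^esub> \<oplus>\<^bsub>N\<^esub> f \<zero>\<^bsub>M\<^esub>"
    using assms(3) M.zero_closed unfolding additive_map_def by blast
  moreover have f0: "f \<zero>\<^bsub>M\<^esub> \<in> carrier N"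
    using assms(3) by (simp add: additive_map_def)
  ultimately have "f \<zero>\<^bsub>M\<^esub> \<oplus>\<^bsub>N\<^esub> f \<zero>\<^bsub>M\<^esub> = f \<zero>\<^bsub>M\<^esub>"
    by (metis M.l_zero M.zero_closed)
  then show ?thesis
    using N.add.l_cancel_one[OF f0 f0] by simp
qed

lemma additive_neg:
  assumes "abelian_group M" "abelian_group N" "additive_map M N f" "x \<in> carrier M"
  shows "f (\<ominus>\<^bsub>M\<^esub> x) = \<ominus>\<^bsub>N\<^esub> f x"
proof -
  interpret M: abelian_group M by fact
  interpret N: abelian_group N by fact
  have "f (\<ominus>\<^bsub>M\<^esub> x) \<oplus>\<^bsub>N\<^esub> f x = f (\<ominus>\<^bsub>M\<^esub> x \<oplus>\<^bsub>M\<^esub> x)"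
    using assms by (simp add: additive_map_def)
  then have "f (\<ominus>\<^bsub>M\<^esub> x) \<oplus>\<^bsub>N\<^esub> f x = \<zero>\<^bsub>N\<^esub>"
    using assms additive_zero[OF assms(1-3)] by (simp add: M.l_neg)
  then show ?thesis
    using assms(3,4) by (intro N.minus_equality[symmetric]) (auto simp: additive_map_def)
qed

lemma additive_map_finsum:
  assumes "abelian_group M" "abelian_group N" "additive_map M N f" "g \<in> I \<rightarrow> carrier M"
  shows "f (\<Oplus>\<^bsub>M\<^esub>i\<in>I. g i) = (\<Oplus>\<^bsub>N\<^esub>i\<in>I. f (g i))"
proof -
  interpret M: abelian_group M by fact
  interpret N: abelian_group N by fact
  show ?thesis using assms(4)
  proof (induction I rule: infinite_finite_induct)
    case (insert i I)
    then show ?case using assms(3)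
      by (subst M.finsum_insert; (subst N.finsum_insert)?) (auto simp: additive_map_def)
  qed (use additive_zero[OF assms(1-3)] in auto)
qed

lemma additive_pointwise_finsum:
  assumes "abelian_group M" "abelian_group N" "finite I" "\<And>i. i \<in> I \<Longrightarrow> additive_map M N (f i)"
  shows "additive_map M N (\<lambda>x. \<Oplus>\<^bsub>N\<^esub>i\<in>I. f i x)"
proof -
  interpret N: abelian_group N by fact
  show ?thesis unfolding additive_map_def
  proof (intro conjI ballI)
    fix x y assume x: "x \<in> carrier M" and y: "y \<in> carrier M"
    show "(\<Oplus>\<^bsub>N\<^esub>i\<in>I. f i x) \<in> carrier N"
      using assms x by (intro N.finsum_closed) (auto simp: additive_map_def)
    have "(\<Oplus>\<^bsub>N\<^esub>i\<in>I. f i (x \<oplus>\<^bsub>M\<^esub> y)) = (\<Oplus>\<^bsub>N\<^esub>i\<in>I. f i x \<oplus>\<^bsub>N\<^esub> f i y)"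
      using assms(4) x y by (intro N.finsum_cong') (auto simp: additive_map_def)
    also have "\<dots> = (\<Oplus>\<^bsub>N\<^esub>i\<in>I. f i x) \<oplus>\<^bsub>N\<^esub> (\<Oplus>\<^bsub>N\<^esub>i\<in>I. f i y)"
      using assms(4) x y by (intro N.finsum_addf) (auto simp: additive_map_def)
    finally show "(\<Oplus>\<^bsub>N\<^esub>i\<in>I. f i (x \<oplus>\<^bsub>M\<^esub> y)) = (\<Oplus>\<^bsub>N\<^esub>i\<in>I. f i x) \<oplus>\<^bsub>N\<^esub> (\<Oplus>\<^bsub>N\<^esub>i\<in>I. f i y)" .
  qed
qed

lemma bimod_homD:
  assumes "f \<in> bimod_hom R S M N"
  shows "x \<in> carrier M \<Longrightarrow> f x \<in> carrier N"
    and "\<lbrakk>x \<in> carrier M; y \<in> carrier M\<rbrakk> \<Longrightarrow> f (x \<oplus>\<^bsub>M\<^esub> y) = f x \<oplus>\<^bsub>N\<^esub> f y"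
    and "\<lbrakk>r \<in> carrier R; x \<in> carrier M\<rbrakk> \<Longrightarrow> f (r \<odot>\<^bsub>M\<^esub> x) = r \<odot>\<^bsub>N\<^esub> f x"
    and "\<lbrakk>s \<in> carrier S; x \<in> carrier M\<rbrakk> \<Longrightarrow> f (rsmult M x s) = rsmult N (f x) s"
  using assms by (auto simp: bimod_hom_iff)

lemma bimod_hom_additive: "f \<in> bimod_hom R S M N \<Longrightarrow> additive_map M N f"
  by (auto simp: bimod_hom_iff additive_map_def)

section \<open>Powers, direct sums and sub-bimodules\<close>

lemma bimod_power_simps [simp]:
  "carrier (bimod_power M n) = {..<n} \<rightarrow>\<^sub>E carrier M"
  "\<zero>\<^bsub>bimod_power M n\<^esub> = (\<lambda>i\<in>{..<n}. \<zero>\<^bsub>M\<^esub>)"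
  "x \<oplus>\<^bsub>bimod_power M n\<^esub> y = (\<lambda>i\<in>{..<n}. x i \<oplus>\<^bsub>M\<^esub> y i)"
  "r \<odot>\<^bsub>bimod_power M n\<^esub> x = (\<lambda>i\<in>{..<n}. r \<odot>\<^bsub>M\<^esub> x i)"
  "rsmult (bimod_power M n) x s = (\<lambda>i\<in>{..<n}. rsmult M (x i) s)"
  by (simp_all add: bimod_power_def)

lemma bimod_sum_simps [simp]:
  "carrier (bimod_sum M N) = carrier M \<times> carrier N"
  "\<zero>\<^bsub>bimod_sum M N\<^esub> = (\<zero>\<^bsub>M\<^esub>, \<zero>\<^bsub>N\<^esub>)"
  "(x, y) \<oplus>\<^bsub>bimod_sum M N\<^esub> (x', y') = (x \<oplus>\<^bsub>M\<^esub> x', y \<oplus>\<^bsub>N\<^esub> y')"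
  "r \<odot>\<^bsub>bimod_sum M N\<^esub> (x, y) = (r \<odot>\<^bsub>M\<^esub> x, r \<odot>\<^bsub>N\<^esub> y)"
  "rsmult (bimod_sum M N) (x, y) s = (rsmult M x s, rsmult N y s)"
  by (simp_all add: bimod_sum_def)

lemma bimodule_bimod_power:
  assumes "bimodule R S M"
  shows "bimodule R S (bimod_power M n)"
proof -
  interpret bimodule R S M by fact
  have "abelian_group (bimod_power M n)"
  proof (rule abelian_groupI)
    fix x assume "x \<in> carrier (bimod_power M n)"
    then show "\<exists>y\<in>carrier (bimod_power M n). y \<oplus>\<^bsub>bimod_power M n\<^esub> x = \<zero>\<^bsub>bimod_power M n\<^esub>"
      by (intro bexI[of _ "\<lambda>i\<in>{..<n}. \<ominus>\<^bsub>M\<^esub> x i"])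
        (auto simp: PiE_iff left.M.l_neg intro!: restrict_ext)
  qed (auto simp: PiE_iff left.M.a_assoc intro!: restrict_ext left.M.a_comm
      intro: extensionalityI[of _ "{..<n}"])
  then show ?thesis
    by (intro bimoduleI left.R.ring_axioms ring_right)
      (auto simp: PiE_iff smult_simps intro!: restrict_ext intro: extensionalityI[of _ "{..<n}"])
qed

definition sub_bimodule :: "('r, 's, 'x, 'm) bimodule_scheme \<Rightarrow> 'x set \<Rightarrow> ('r, 's, 'x) bimodule" where
  "sub_bimodule M U = \<lparr>carrier = U, monoid.mult = undefined, monoid.one = undefined,
     ring.zero = \<zero>\<^bsub>M\<^esub>, ring.add = ring.add M, smult = smult M, rsmult = rsmult M\<rparr>"

lemma sub_bimodule_simps [simp]:
  "carrier (sub_bimodule M U) = U" "\<zero>\<^bsub>sub_bimodule M U\<^esub> = \<zero>\<^bsub>M\<^esub>"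
  "x \<oplus>\<^bsub>sub_bimodule M U\<^esub> y = x \<oplus>\<^bsub>M\<^esub> y" "r \<odot>\<^bsub>sub_bimodule M U\<^esub> x = r \<odot>\<^bsub>M\<^esub> x"
  "rsmult (sub_bimodule M U) x s = rsmult M x s"
  by (simp_all add: sub_bimodule_def)

lemma (in bimodule) bimodule_sub_bimodule:
  assumes "U \<subseteq> carrier M" "\<zero>\<^bsub>M\<^esub> \<in> U"
    and "\<And>x y. x \<in> U \<Longrightarrow> y \<in> U \<Longrightarrow> x \<oplus>\<^bsub>M\<^esub> y \<in> U" "\<And>x. x \<in> U \<Longrightarrow> \<ominus>\<^bsub>M\<^esub> x \<in> U"
    and "\<And>r x. r \<in> carrier R \<Longrightarrow> x \<in> U \<Longrightarrow> r \<odot>\<^bsub>M\<^esub> x \<in> U"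
    and "\<And>s x. s \<in> carrier S \<Longrightarrow> x \<in> U \<Longrightarrow> rsmult M x s \<in> U"
  shows "bimodule R S (sub_bimodule M U)"
proof -
  have [simp]: "x \<in> carrier M" if "x \<in> U" for x using that assms(1) by blast
  have "abelian_group (sub_bimodule M U)"
  proof (rule abelian_groupI)
    fix x assume "x \<in> carrier (sub_bimodule M U)"
    then show "\<exists>y\<in>carrier (sub_bimodule M U). y \<oplus>\<^bsub>sub_bimodule M U\<^esub> x = \<zero>\<^bsub>sub_bimodule M U\<^esub>"
      using assms(4) by (auto intro!: bexI[of _ "\<ominus>\<^bsub>M\<^esub> x"] simp: left.M.l_neg)
  qed (use assms in \<open>auto simp: left.M.a_assoc intro: left.M.a_comm\<close>)
  then show ?thesis
    using assms by (intro bimoduleI left.R.ring_axioms ring_right) (auto simp: smult_simps)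
qed

lemma (in bimodule) smult_zero: "r \<in> carrier R \<Longrightarrow> r \<odot>\<^bsub>M\<^esub> \<zero>\<^bsub>M\<^esub> = \<zero>\<^bsub>M\<^esub>"
  by (rule additive_zero[where f = "\<lambda>x. r \<odot>\<^bsub>M\<^esub> x" and M = M])
    (auto simp: additive_map_def smult_simps abelian_group_axioms)

lemma (in bimodule) rsmult_zero: "s \<in> carrier S \<Longrightarrow> rsmult M \<zero>\<^bsub>M\<^esub> s = \<zero>\<^bsub>M\<^esub>"
  by (rule additive_zero[where f = "\<lambda>x. rsmult M x s" and M = M])
    (auto simp: additive_map_def smult_simps abelian_group_axioms)

text \<open>Provides the complement when a power of one bimodule retracts onto another.\<close>

lemma bimod_hom_kernel:
  assumes "bimodule R S M" "bimodule R S N" "f \<in> bimod_hom R S M N"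
  shows "bimodule R S (sub_bimodule M {x \<in> carrier M. f x = \<zero>\<^bsub>N\<^esub>})"
proof -
  interpret M: bimodule R S M by fact
  interpret N: bimodule R S N by fact
  note f = bimod_hom_additive[OF assms(3)]
  note zero = additive_zero[OF M.abelian_group_axioms N.abelian_group_axioms f]
  show ?thesis
    using assms(3) zero N.smult_zero N.rsmult_zero additive_neg[OF M.abelian_group_axioms N.abelian_group_axioms f]
    by (intro M.bimodule_sub_bimodule) (auto simp: bimod_hom_iff)
qed

text \<open>The families assemble into F : M -> N^n and G : N^n -> M with G F = id, so N^n is the
  direct sum of F(M) and the kernel of G. Any finite index set is allowed because composing two
  families produces one indexed by pairs.\<close>

lemma bimod_dividesI:
  fixes M :: "('r, 's, 'x, 'm) bimodule_scheme" and N :: "('r, 's, 'y, 'n) bimodule_scheme"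
  assumes M: "bimodule R S M" and N: "bimodule R S N" and I: "finite I"
    and f: "\<And>i. i \<in> I \<Longrightarrow> f i \<in> bimod_hom R S M N"
    and g: "\<And>i. i \<in> I \<Longrightarrow> g i \<in> bimod_hom R S N M"
    and id: "\<And>x. x \<in> carrier M \<Longrightarrow> (\<Oplus>\<^bsub>M\<^esub>i\<in>I. g i (f i x)) = x"
  shows "bimod_divides R S M N"
proof -
  interpret M: bimodule R S M by fact
  interpret N: bimodule R S N by fact
  obtain n and \<sigma> :: "nat \<Rightarrow> _" where \<sigma>: "bij_betw \<sigma> {..<n} I"
    using ex_bij_betw_nat_finite[OF I] by (auto simp: atLeast0LessThan)
  define N' where "N' = bimod_power N n"
  interpret N': bimodule R S N'
    unfolding N'_def by (rule bimodule_bimod_power[OF N])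
  have \<sigma>I: "\<sigma> i \<in> I" if "i < n" for i using \<sigma> that by (auto simp: bij_betw_def)
  note f' = bimod_homD[OF f[OF \<sigma>I]] and g' = bimod_homD[OF g[OF \<sigma>I]]
  have f_closed: "f (\<sigma> i) x \<in> carrier N" if "i < n" "x \<in> carrier M" for i x
    using f' that by auto
  have g_closed: "g (\<sigma> i) y \<in> carrier M" if "i < n" "y \<in> carrier N" for i y
    using g' that by auto
  define F where "F x = (\<lambda>i\<in>{..<n}. f (\<sigma> i) x)" for x
  define G where "G = restrict (\<lambda>y. \<Oplus>\<^bsub>M\<^esub>i\<in>{..<n}. g (\<sigma> i) (y i)) (carrier N')"
  have F: "F x \<in> carrier N'" if "x \<in> carrier M" for x
    using that f' by (auto simp: F_def N'_def)
  have g_add: "additive_map N M (g (\<sigma> i))" if "i < n" for i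
    using g[OF \<sigma>I[OF that]] by (rule bimod_hom_additive)
  have G: "G \<in> bimod_hom R S N' M"
    unfolding G_def
  proof (rule bimod_homI)
    show "(\<Oplus>\<^bsub>M\<^esub>i\<in>{..<n}. g (\<sigma> i) (x i)) \<in> carrier M" if "x \<in> carrier N'" for x
      using that g_closed by (intro M.left.M.finsum_closed) (auto simp: N'_def)
    show "(\<Oplus>\<^bsub>M\<^esub>i\<in>{..<n}. g (\<sigma> i) ((x \<oplus>\<^bsub>N'\<^esub> y) i)) =
        (\<Oplus>\<^bsub>M\<^esub>i\<in>{..<n}. g (\<sigma> i) (x i)) \<oplus>\<^bsub>M\<^esub> (\<Oplus>\<^bsub>M\<^esub>i\<in>{..<n}. g (\<sigma> i) (y i))"
      if "x \<in> carrier N'" "y \<in> carrier N'" for x y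
      using that g' g_closed
      by (subst M.left.M.finsum_addf[symmetric])
        (auto simp: N'_def PiE_iff simp del: M.left.M.finsum_addf intro!: M.left.M.finsum_cong')
    show "(\<Oplus>\<^bsub>M\<^esub>i\<in>{..<n}. g (\<sigma> i) ((r \<odot>\<^bsub>N'\<^esub> x) i)) = r \<odot>\<^bsub>M\<^esub> (\<Oplus>\<^bsub>M\<^esub>i\<in>{..<n}. g (\<sigma> i) (x i))"
      if "r \<in> carrier R" "x \<in> carrier N'" for r x
      using that g' g_closed
      by (subst additive_map_finsum[OF M.abelian_group_axioms M.abelian_group_axioms, where f = "\<lambda>x. r \<odot>\<^bsub>M\<^esub> x"])
        (auto simp: N'_def additive_map_def PiE_iff M.smult_simps intro!: M.left.M.finsum_cong')
    show "(\<Oplus>\<^bsub>M\<^esub>i\<in>{..<n}. g (\<sigma> i) ((rsmult N' x s) i)) = rsmult M (\<Oplus>\<^bsub>M\<^esub>i\<in>{..<n}. g (\<sigma> i) (x i)) s"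
      if "s \<in> carrier S" "x \<in> carrier N'" for s x
      using that g' g_closed
      by (subst additive_map_finsum[OF M.abelian_group_axioms M.abelian_group_axioms, where f = "\<lambda>x. rsmult M x s"])
        (auto simp: N'_def additive_map_def PiE_iff M.smult_simps intro!: M.left.M.finsum_cong')
  qed (rule N'.bimodule_axioms)
  have G_add: "additive_map N' M G" using G by (rule bimod_hom_additive)
  have GF: "G (F x) = x" if x: "x \<in> carrier M" for x
  proof -
    have "(\<Oplus>\<^bsub>M\<^esub>i\<in>{..<n}. g (\<sigma> i) (f (\<sigma> i) x)) = (\<Oplus>\<^bsub>M\<^esub>i\<in>\<sigma> ` {..<n}. g i (f i x))"
      using \<sigma> x g_closed f_closed
      by (subst M.left.M.finsum_reindex) (auto simp: bij_betw_def)
    then have "(\<Oplus>\<^bsub>M\<^esub>i\<in>{..<n}. g (\<sigma> i) (f (\<sigma> i) x)) = x"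
      using \<sigma> id[OF x] by (simp add: bij_betw_def)
    moreover have "G (F x) = (\<Oplus>\<^bsub>M\<^esub>i\<in>{..<n}. g (\<sigma> i) (f (\<sigma> i) x))"
      using F[OF x] g_closed f_closed x by (auto simp: G_def F_def intro!: M.left.M.finsum_cong')
    ultimately show ?thesis by simp
  qed
  \<comment> \<open>The kernel of \<open>G\<close> consists of elements of
    \<open>bimod_power N n\<close>, so it has exactly the element type that
    \<open>bimod_divides\<close> prescribes for the complement.\<close>
  define P where "P = sub_bimodule N' {y \<in> carrier N'. G y = \<zero>\<^bsub>M\<^esub>}"
  have P: "bimodule R S P"
    unfolding P_def by (rule bimod_hom_kernel[OF N'.bimodule_axioms M G])
  have P_sub: "p \<in> carrier N'" "G p = \<zero>\<^bsub>M\<^esub>" if "p \<in> carrier P" for p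
    using that by (auto simp: P_def)
  have F_add: "F (x \<oplus>\<^bsub>M\<^esub> y) = F x \<oplus>\<^bsub>N'\<^esub> F y" if "x \<in> carrier M" "y \<in> carrier M" for x y
    using that f' by (auto simp: F_def N'_def intro!: restrict_ext)
  have F_smult: "F (r \<odot>\<^bsub>M\<^esub> x) = r \<odot>\<^bsub>N'\<^esub> F x" if "r \<in> carrier R" "x \<in> carrier M" for r x
    using that f' by (auto simp: F_def N'_def intro!: restrict_ext)
  have F_rsmult: "F (rsmult M x s) = rsmult N' (F x) s" if "s \<in> carrier S" "x \<in> carrier M" for s x
    using that f' by (auto simp: F_def N'_def intro!: restrict_ext)
  define H where "H = (\<lambda>(x, p)\<in>carrier M \<times> carrier P. F x \<oplus>\<^bsub>N'\<^esub> p)"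
  have P_ops: "p \<oplus>\<^bsub>P\<^esub> q = p \<oplus>\<^bsub>N'\<^esub> q" "r \<odot>\<^bsub>P\<^esub> p = r \<odot>\<^bsub>N'\<^esub> p" "rsmult P p s = rsmult N' p s" for p q r s
    by (simp_all add: P_def)
  have "H \<in> bimod_hom R S (bimod_sum M P) N'"
  proof -
    interpret P: bimodule R S P by fact
    have ac: "a \<oplus>\<^bsub>N'\<^esub> b \<oplus>\<^bsub>N'\<^esub> (c \<oplus>\<^bsub>N'\<^esub> d) = a \<oplus>\<^bsub>N'\<^esub> c \<oplus>\<^bsub>N'\<^esub> (b \<oplus>\<^bsub>N'\<^esub> d)"
      if "a \<in> carrier N'" "b \<in> carrier N'" "c \<in> carrier N'" "d \<in> carrier N'" for a b c d
      using that by (simp add: N'.left.M.a_ac)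
    show ?thesis
      using P.left.M.a_closed P.smult_closed' P.rsmult_closed
      by (auto simp: bimod_hom_iff H_def F P_sub F_add F_smult F_rsmult P_ops N'.smult_simps ac)
  qed
  moreover have "bij_betw H (carrier (bimod_sum M P)) (carrier N')"
  \<comment> \<open>The inverse splits y into \<open>G y\<close> and the remainder y - F (G y),
    which \<open>G\<close> kills because G F = id.\<close>
  proof (rule bij_betw_byWitness[where f' = "\<lambda>y. (G y, y \<ominus>\<^bsub>N'\<^esub> F (G y))"])
    have GH: "G (F x \<oplus>\<^bsub>N'\<^esub> p) = x" if "x \<in> carrier M" "p \<in> carrier P" for x p
    proof -
      have "G (F x \<oplus>\<^bsub>N'\<^esub> p) = G (F x) \<oplus>\<^bsub>M\<^esub> G p"
        using that G_add F P_sub by (auto simp: additive_map_def)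
      then show ?thesis using that by (simp add: P_sub GF)
    qed
    have G_closed: "G y \<in> carrier M" if "y \<in> carrier N'" for y
      using that G_add by (auto simp: additive_map_def)
    have G_P: "y \<ominus>\<^bsub>N'\<^esub> F (G y) \<in> carrier P" if "y \<in> carrier N'" for y
    proof -
      have "G (y \<ominus>\<^bsub>N'\<^esub> F (G y)) = G y \<oplus>\<^bsub>M\<^esub> G (\<ominus>\<^bsub>N'\<^esub> F (G y))"
        using that G_add F G_closed by (auto simp: additive_map_def a_minus_def)
      also have "\<dots> = \<zero>\<^bsub>M\<^esub>"
        using that F G_closed GF
        by (simp add: additive_neg[OF N'.abelian_group_axioms M.abelian_group_axioms G_add] M.left.M.r_neg)
      finally show ?thesis using that F G_closed by (simp add: P_def)
    qed
    have H_eq: "H (x, p) = F x \<oplus>\<^bsub>N'\<^esub> p" if "x \<in> carrier M" "p \<in> carrier P" for x p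
      using that by (simp add: H_def)
    show "\<forall>a\<in>carrier (bimod_sum M P). (G (H a), H a \<ominus>\<^bsub>N'\<^esub> F (G (H a))) = a"
    proof clarsimp
      fix x p assume x: "x \<in> carrier M" and p: "p \<in> carrier P"
      have "F x \<oplus>\<^bsub>N'\<^esub> p \<ominus>\<^bsub>N'\<^esub> F x = p"
        using F[OF x] P_sub[OF p]
        by (simp add: a_minus_def N'.left.M.a_ac N'.left.M.r_neg)
      then show "G (H (x, p)) = x \<and> H (x, p) \<ominus>\<^bsub>N'\<^esub> F (G (H (x, p))) = p"
        using x p by (simp add: H_eq GH)
    qed
    show "\<forall>y\<in>carrier N'. H (G y, y \<ominus>\<^bsub>N'\<^esub> F (G y)) = y"
    proof
      fix y assume y: "y \<in> carrier N'"
      have "F (G y) \<oplus>\<^bsub>N'\<^esub> (y \<ominus>\<^bsub>N'\<^esub> F (G y)) = y"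
        using F[OF G_closed[OF y]] y
        by (simp add: a_minus_def N'.left.M.a_ac N'.left.M.r_neg)
      then show "H (G y, y \<ominus>\<^bsub>N'\<^esub> F (G y)) = y"
        using y by (simp add: H_eq G_closed G_P)
    qed
    show "H ` carrier (bimod_sum M P) \<subseteq> carrier N'"
      using F P_sub by (auto simp: H_eq)
    show "(\<lambda>y. (G y, y \<ominus>\<^bsub>N'\<^esub> F (G y))) ` carrier N' \<subseteq> carrier (bimod_sum M P)"
      using G_closed G_P by auto
  qed
  ultimately show ?thesis
    using M N P unfolding bimod_divides_def bimod_iso_def N'_def by blast
qed

lemma bimod_sum_simps':
  "p \<oplus>\<^bsub>bimod_sum M N\<^esub> q = (fst p \<oplus>\<^bsub>M\<^esub> fst q, snd p \<oplus>\<^bsub>N\<^esub> snd q)"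
  "r \<odot>\<^bsub>bimod_sum M N\<^esub> p = (r \<odot>\<^bsub>M\<^esub> fst p, r \<odot>\<^bsub>N\<^esub> snd p)"
  "rsmult (bimod_sum M N) p s = (rsmult M (fst p) s, rsmult N (snd p) s)"
  by (simp_all add: bimod_sum_def split: prod.splits)

text \<open>With H the isomorphism of the sum of M and P onto N^n, \<open>f i\<close> is the i-th
  coordinate of H on M, and \<open>g i\<close> embeds N as the i-th coordinate, applies the inverse
  of H and projects to M. The identity of N^n is the sum of its coordinate projections followed by
  the coordinate embeddings, whence the last claim.\<close>

lemma bimod_dividesE:
  fixes M :: "('r, 's, 'x, 'm) bimodule_scheme" and N :: "('r, 's, 'y, 'n) bimodule_scheme"
  assumes "bimod_divides R S M N"
  obtains n :: nat and f g where
    "\<And>i. i < n \<Longrightarrow> f i \<in> bimod_hom R S M N" "\<And>i. i < n \<Longrightarrow> g i \<in> bimod_hom R S N M"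
    "\<And>x. x \<in> carrier M \<Longrightarrow> (\<Oplus>\<^bsub>M\<^esub>i\<in>{..<n}. g i (f i x)) = x"
proof -
  obtain P :: "('r, 's, nat \<Rightarrow> 'y) bimodule" and n H where M: "bimodule R S M" and N: "bimodule R S N" and P: "bimodule R S P"
    and H: "H \<in> bimod_hom R S (bimod_sum M P) (bimod_power N n)"
    and bij: "bij_betw H (carrier (bimod_sum M P)) (carrier (bimod_power N n))"
    using assms unfolding bimod_divides_def bimod_iso_def by blast
  interpret M: bimodule R S M by fact
  interpret N: bimodule R S N by fact
  interpret P: bimodule R S P by fact
  define N' where "N' = bimod_power N n"
  interpret N': bimodule R S N'
    unfolding N'_def by (rule bimodule_bimod_power[OF N])
  note Hs = bimod_homD[OF H, folded N'_def]
  \<comment> \<open>The M-component of the inverse of \<open>H\<close>. Its linearity is verified on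
    elements written as \<open>H p\<close>, where it reduces to that of \<open>fst\<close>.\<close>
  define G where "G = (\<lambda>y\<in>carrier N'. fst (inv_into (carrier M \<times> carrier P) H y))"
  have inj: "inj_on H (carrier M \<times> carrier P)" and surj: "H ` (carrier M \<times> carrier P) = carrier N'"
    using bij by (auto simp: bij_betw_def N'_def)
  have H_closed: "H p \<in> carrier N'" if "p \<in> carrier M \<times> carrier P" for p
    using surj that by blast
  have GH: "G (H p) = fst p" if "p \<in> carrier M \<times> carrier P" for p
    using that inj H_closed by (simp add: G_def)
  have ex: "\<exists>p \<in> carrier M \<times> carrier P. y = H p" if "y \<in> carrier N'" for y
    using surj that by blast
  have G: "G \<in> bimod_hom R S N' M"
    unfolding bimod_hom_iff
  proof (intro conjI ballI)
    show "G \<in> carrier N' \<rightarrow>\<^sub>E carrier M"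
    proof
      show "G y \<in> carrier M" if "y \<in> carrier N'" for y using ex[OF that] GH by auto
    qed (simp add: G_def)
  next
    fix y z assume y: "y \<in> carrier N'" and z: "z \<in> carrier N'"
    obtain p where p: "p \<in> carrier M \<times> carrier P" "y = H p"
      using ex[OF y] by blast
    obtain q where q: "q \<in> carrier M \<times> carrier P" "z = H q"
      using ex[OF z] by blast
    from p q have pq: "p \<oplus>\<^bsub>bimod_sum M P\<^esub> q \<in> carrier M \<times> carrier P"
      by (auto simp: bimod_sum_simps')
    have "G (y \<oplus>\<^bsub>N'\<^esub> z) = G (H (p \<oplus>\<^bsub>bimod_sum M P\<^esub> q))"
      using p q Hs(2)[of p q] by simp
    then show "G (y \<oplus>\<^bsub>N'\<^esub> z) = G y \<oplus>\<^bsub>M\<^esub> G z"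
      using p q pq by (simp only: GH) (simp add: bimod_sum_simps')
  next
    fix r y assume r: "r \<in> carrier R" and y: "y \<in> carrier N'"
    obtain p where p: "p \<in> carrier M \<times> carrier P" "y = H p"
      using ex[OF y] by blast
    then have pq: "r \<odot>\<^bsub>bimod_sum M P\<^esub> p \<in> carrier M \<times> carrier P"
      using r by (auto simp: bimod_sum_simps')
    have "G (r \<odot>\<^bsub>N'\<^esub> y) = G (H (r \<odot>\<^bsub>bimod_sum M P\<^esub> p))"
      using p r Hs(3)[of r p] by simp
    then show "G (r \<odot>\<^bsub>N'\<^esub> y) = r \<odot>\<^bsub>M\<^esub> G y"
      using p pq by (simp only: GH) (simp add: bimod_sum_simps')
  next
    fix s y assume s: "s \<in> carrier S" and y: "y \<in> carrier N'"
    obtain p where p: "p \<in> carrier M \<times> carrier P" "y = H p"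
      using ex[OF y] by blast
    then have pq: "rsmult (bimod_sum M P) p s \<in> carrier M \<times> carrier P"
      using s by (auto simp: bimod_sum_simps')
    have "G (rsmult N' y s) = G (H (rsmult (bimod_sum M P) p s))"
      using p s Hs(4)[of s p] by simp
    then show "G (rsmult N' y s) = rsmult M (G y) s"
      using p pq by (simp only: GH) (simp add: bimod_sum_simps')
  qed
  note Gs = bimod_homD[OF G] and G_add = bimod_hom_additive[OF G]
  \<comment> \<open>The i-th coordinate embedding; it respects both actions because they fix
    zero.\<close>
  define \<iota> where "\<iota> i y = (\<lambda>j\<in>{..<n}. if j = i then y else \<zero>\<^bsub>N\<^esub>)" for i y
  have \<iota>: "\<iota> i y \<in> carrier N'" if "y \<in> carrier N" for i y
    using that by (auto simp: \<iota>_def N'_def)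
  have \<iota>_ops: "\<iota> i (x \<oplus>\<^bsub>N\<^esub> y) = \<iota> i x \<oplus>\<^bsub>N'\<^esub> \<iota> i y" "r \<in> carrier R \<Longrightarrow> \<iota> i (r \<odot>\<^bsub>N\<^esub> x) = r \<odot>\<^bsub>N'\<^esub> \<iota> i x"
      "s \<in> carrier S \<Longrightarrow> \<iota> i (rsmult N x s) = rsmult N' (\<iota> i x) s"
    if "x \<in> carrier N" "y \<in> carrier N" for i x y r s
    using that N.smult_zero N.rsmult_zero by (auto simp: \<iota>_def N'_def intro!: restrict_ext)
  have decomp: "(\<Oplus>\<^bsub>N'\<^esub>i\<in>{..<n}. \<iota> i (y i)) = y" if y: "y \<in> carrier N'" for y
  proof (rule extensionalityI[of _ "{..<n}"])
    have y_closed: "y i \<in> carrier N" if "i < n" for i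
      using y that by (auto simp: N'_def)
    have "(\<Oplus>\<^bsub>N'\<^esub>i\<in>{..<n}. \<iota> i (y i)) \<in> carrier N'"
      using y_closed \<iota> by (intro N'.left.M.finsum_closed) auto
    then show "(\<Oplus>\<^bsub>N'\<^esub>i\<in>{..<n}. \<iota> i (y i)) \<in> extensional {..<n}"
      by (auto simp: N'_def PiE_iff)
    show "y \<in> extensional {..<n}"
      using y by (auto simp: N'_def PiE_iff)
    fix j assume j: "j \<in> {..<n}"
    \<comment> \<open>Taking the coordinate \<open>j\<close> is additive and so passes inside the
      sum, where only the term i = j survives.\<close>
    have "(\<Oplus>\<^bsub>N'\<^esub>i\<in>{..<n}. \<iota> i (y i)) j = (\<Oplus>\<^bsub>N\<^esub>i\<in>{..<n}. \<iota> i (y i) j)"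
      using j y_closed \<iota>
      by (intro additive_map_finsum[where f = "\<lambda>z. z j"] N'.abelian_group_axioms N.abelian_group_axioms)
        (auto simp: additive_map_def N'_def)
    also have "\<dots> = (\<Oplus>\<^bsub>N\<^esub>i\<in>{..<n}. if j = i then y i else \<zero>\<^bsub>N\<^esub>)"
      using j y_closed by (intro N.left.M.finsum_cong') (auto simp: \<iota>_def)
    also have "\<dots> = y j"
      using j y_closed by (intro N.left.M.finsum_singleton) auto
    finally show "(\<Oplus>\<^bsub>N'\<^esub>i\<in>{..<n}. \<iota> i (y i)) j = y j" .
  qed
  define f where "f i = (\<lambda>x\<in>carrier M. H (x, \<zero>\<^bsub>P\<^esub>) i)" for i
  define g where "g i = (\<lambda>y\<in>carrier N. G (\<iota> i y))" for i
  have f: "f i \<in> bimod_hom R S M N" if i: "i < n" for i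
    unfolding f_def
  proof (rule bimod_homI)
    show "H (x, \<zero>\<^bsub>P\<^esub>) i \<in> carrier N" if "x \<in> carrier M" for x
      using that H_closed[of "(x, \<zero>\<^bsub>P\<^esub>)"] i by (auto simp: N'_def)
    show "H (x \<oplus>\<^bsub>M\<^esub> y, \<zero>\<^bsub>P\<^esub>) i = H (x, \<zero>\<^bsub>P\<^esub>) i \<oplus>\<^bsub>N\<^esub> H (y, \<zero>\<^bsub>P\<^esub>) i"
      if "x \<in> carrier M" "y \<in> carrier M" for x y
      using that i Hs(2)[of "(x, \<zero>\<^bsub>P\<^esub>)" "(y, \<zero>\<^bsub>P\<^esub>)"] by (simp add: N'_def)
    show "H (r \<odot>\<^bsub>M\<^esub> x, \<zero>\<^bsub>P\<^esub>) i = r \<odot>\<^bsub>N\<^esub> H (x, \<zero>\<^bsub>P\<^esub>) i"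
      if "r \<in> carrier R" "x \<in> carrier M" for r x
      using that i Hs(3)[of r "(x, \<zero>\<^bsub>P\<^esub>)"] P.smult_zero by (simp add: N'_def)
    show "H (rsmult M x s, \<zero>\<^bsub>P\<^esub>) i = rsmult N (H (x, \<zero>\<^bsub>P\<^esub>) i) s"
      if "s \<in> carrier S" "x \<in> carrier M" for s x
      using that i Hs(4)[of s "(x, \<zero>\<^bsub>P\<^esub>)"] P.rsmult_zero by (simp add: N'_def)
  qed (rule M)
  have g: "g i \<in> bimod_hom R S N M" if i: "i < n" for i
    unfolding g_def by (rule bimod_homI) (use N \<iota> Gs \<iota>_ops in auto)
  have "(\<Oplus>\<^bsub>M\<^esub>i\<in>{..<n}. g i (f i x)) = x" if x: "x \<in> carrier M" for x
  proof -
    have Hx: "H (x, \<zero>\<^bsub>P\<^esub>) \<in> carrier N'" using H_closed x by simp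
    then have Hxi: "H (x, \<zero>\<^bsub>P\<^esub>) i \<in> carrier N" if "i < n" for i
      using that by (auto simp: N'_def)
    have "(\<Oplus>\<^bsub>M\<^esub>i\<in>{..<n}. g i (f i x)) = (\<Oplus>\<^bsub>M\<^esub>i\<in>{..<n}. G (\<iota> i (H (x, \<zero>\<^bsub>P\<^esub>) i)))"
      using x Hxi Gs \<iota> by (intro M.left.M.finsum_cong') (auto simp: f_def g_def)
    also have "\<dots> = G (\<Oplus>\<^bsub>N'\<^esub>i\<in>{..<n}. \<iota> i (H (x, \<zero>\<^bsub>P\<^esub>) i))"
      using Hxi \<iota> by (subst additive_map_finsum[OF N'.abelian_group_axioms M.abelian_group_axioms G_add]) auto
    also have "\<dots> = x"
      using x by (simp add: decomp[OF Hx] GH)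
    finally show ?thesis .
  qed
  with f g that show thesis by blast
qed

section \<open>Double sums and transitivity of divisibility\<close>

lemma (in abelian_monoid) finsum_Times:
  assumes "finite J" "finite I" "\<And>i j. i \<in> I \<Longrightarrow> j \<in> J \<Longrightarrow> f i j \<in> carrier G"
  shows "(\<Oplus>p\<in>I \<times> J. f (fst p) (snd p)) = (\<Oplus>i\<in>I. \<Oplus>j\<in>J. f i j)"
  using assms(2,3)
proof (induction I rule: finite_induct)
  case (insert i I)
  have "insert i I \<times> J = (Pair i ` J) \<union> I \<times> J" by auto
  then have "(\<Oplus>p\<in>insert i I \<times> J. f (fst p) (snd p)) =
      (\<Oplus>p\<in>Pair i ` J. f (fst p) (snd p)) \<oplus> (\<Oplus>p\<in>I \<times> J. f (fst p) (snd p))"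
    using insert assms(1) by (simp only:) (subst finsum_Un_disjoint; auto)
  also have "(\<Oplus>p\<in>Pair i ` J. f (fst p) (snd p)) = (\<Oplus>j\<in>J. f i j)"
    using insert by (subst finsum_reindex) (auto simp: inj_on_def)
  finally show ?case
    using insert by (subst finsum_insert) auto
qed simp

lemma (in abelian_monoid) finsum_swap:
  assumes "finite I" "finite J" "\<And>i j. i \<in> I \<Longrightarrow> j \<in> J \<Longrightarrow> f i j \<in> carrier G"
  shows "(\<Oplus>i\<in>I. \<Oplus>j\<in>J. f i j) = (\<Oplus>j\<in>J. \<Oplus>i\<in>I. f i j)"
  using assms(1,3)
proof (induction I rule: finite_induct)
  case (insert i I)
  have "(\<Oplus>i'\<in>insert i I. \<Oplus>j\<in>J. f i' j) = (\<Oplus>j\<in>J. f i j) \<oplus> (\<Oplus>j\<in>J. \<Oplus>i\<in>I. f i j)"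
    using insert by (subst finsum_insert) auto
  also have "\<dots> = (\<Oplus>j\<in>J. f i j \<oplus> (\<Oplus>i\<in>I. f i j))"
    using insert by (subst finsum_addf) auto
  also have "\<dots> = (\<Oplus>j\<in>J. \<Oplus>i\<in>insert i I. f i j)"
    using insert by (intro finsum_cong') auto
  finally show ?case .
qed simp

lemma bimod_hom_compose:
  assumes "f \<in> bimod_hom R S M N" "g \<in> bimod_hom R S N P" "bimodule R S M"
  shows "compose (carrier M) g f \<in> bimod_hom R S M P"
  unfolding compose_def
  using bimod_homD[OF assms(1)] bimod_homD[OF assms(2)] assms(3) by (intro bimod_homI) auto

text \<open>Composition gives \<Sum> g_i g'_j f'_j f_i over pairs. Additivity of \<open>g i\<close>
  lets the sum over j be taken inside, where it collapses to the identity of \<open>N\<close>; the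
  sum over i is then the identity of \<open>M\<close>.\<close>

lemma bimod_divides_trans:
  assumes "bimod_divides R S M N" "bimod_divides R S N P"
  shows "bimod_divides R S M P"
proof -
  have M: "bimodule R S M" and N: "bimodule R S N" and P: "bimodule R S P"
    using assms by (auto simp: bimod_divides_def)
  interpret M: bimodule R S M by fact
  interpret N: bimodule R S N by fact
  obtain m :: nat and f g where fg: "\<And>i. i < m \<Longrightarrow> f i \<in> bimod_hom R S M N"
      "\<And>i. i < m \<Longrightarrow> g i \<in> bimod_hom R S N M"
      "\<And>x. x \<in> carrier M \<Longrightarrow> (\<Oplus>\<^bsub>M\<^esub>i\<in>{..<m}. g i (f i x)) = x"
    by (rule bimod_dividesE[OF assms(1)]) blast
  obtain n :: nat and f' g' where fg': "\<And>i. i < n \<Longrightarrow> f' i \<in> bimod_hom R S N P"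
      "\<And>i. i < n \<Longrightarrow> g' i \<in> bimod_hom R S P N"
      "\<And>x. x \<in> carrier N \<Longrightarrow> (\<Oplus>\<^bsub>N\<^esub>i\<in>{..<n}. g' i (f' i x)) = x"
    by (rule bimod_dividesE[OF assms(2)]) blast
  note D = bimod_homD(1)[OF fg(1)] bimod_homD(1)[OF fg(2)] bimod_homD(1)[OF fg'(1)] bimod_homD(1)[OF fg'(2)]
  show ?thesis
  proof (rule bimod_dividesI[OF M P, of "{..<m} \<times> {..<n}"])
    fix x assume x: "x \<in> carrier M"
    have "(\<Oplus>\<^bsub>M\<^esub>p\<in>{..<m} \<times> {..<n}. compose (carrier P) (g (fst p)) (g' (snd p))
        (compose (carrier M) (f' (snd p)) (f (fst p)) x)) =
      (\<Oplus>\<^bsub>M\<^esub>p\<in>{..<m} \<times> {..<n}. g (fst p) (g' (snd p) (f' (snd p) (f (fst p) x))))"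
      using x D by (intro M.left.M.finsum_cong') (auto simp: compose_eq)
    also have "\<dots> = (\<Oplus>\<^bsub>M\<^esub>i\<in>{..<m}. \<Oplus>\<^bsub>M\<^esub>j\<in>{..<n}. g i (g' j (f' j (f i x))))"
      using x D by (intro M.left.M.finsum_Times[where f = "\<lambda>i j. g i (g' j (f' j (f i x)))"]) auto
    also have "\<dots> = (\<Oplus>\<^bsub>M\<^esub>i\<in>{..<m}. g i (f i x))"
    proof (intro M.left.M.finsum_cong')
      fix i assume i: "i \<in> {..<m}"
      have "(\<Oplus>\<^bsub>M\<^esub>j\<in>{..<n}. g i (g' j (f' j (f i x)))) = g i (\<Oplus>\<^bsub>N\<^esub>j\<in>{..<n}. g' j (f' j (f i x)))"
        using i x D
        by (subst additive_map_finsum[OF N.abelian_group_axioms M.abelian_group_axioms bimod_hom_additive[OF fg(2)]]) auto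
      then show "(\<Oplus>\<^bsub>M\<^esub>j\<in>{..<n}. g i (g' j (f' j (f i x)))) = g i (f i x)"
        using i x D fg'(3) by simp
    qed (use x D in auto)
    finally show "(\<Oplus>\<^bsub>M\<^esub>p\<in>{..<m} \<times> {..<n}. compose (carrier P) (g (fst p)) (g' (snd p))
        (compose (carrier M) (f' (snd p)) (f (fst p)) x)) = x"
      using fg(3)[OF x] by simp
  qed (use fg fg' M N P in \<open>auto intro!: bimod_hom_compose[of _ _ _ _ N]\<close>)
qed

text \<open>The identity of \<open>P\<close> lifts along the surjection from the free module on a
  finite generating set \<open>G\<close>, and the coordinates of the lift are the functionals. This
  free module consists of functions from \<open>G\<close> to the ring, so its element type is the
  one over which \<open>projective\<close> lets the covering module range.\<close>

lemma fg_projective_dual_basis: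
  fixes R :: "('r, 'k) ring_scheme" and P :: "('r, 'x, 'm) module_scheme"
  assumes "fg_projective R P"
  obtains G \<phi> where "finite G" "G \<subseteq> carrier P" "\<And>g. g \<in> G \<Longrightarrow> \<phi> g \<in> lin_hom R P (reg_bimod R)"
    "\<And>x. x \<in> carrier P \<Longrightarrow> (\<Oplus>\<^bsub>P\<^esub>g\<in>G. \<phi> g x \<odot>\<^bsub>P\<^esub> g) = x"
proof -
  have P: "left_module R P" and "fin_gen R P" and proj: "projective R P"
    using assms by (auto simp: fg_projective_def)
  then obtain G where G: "finite G" "G \<subseteq> carrier P"
    and gen: "\<And>x. x \<in> carrier P \<Longrightarrow> \<exists>c\<in>G \<rightarrow> carrier R. x = (\<Oplus>\<^bsub>P\<^esub>g\<in>G. c g \<odot>\<^bsub>P\<^esub> g)"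
    unfolding fin_gen_def by blast
  interpret P: left_module R P by fact
  have G': "g \<in> carrier P" if "g \<in> G" for g using that G by blast
  note smult = P.smult_closed P.smult_l_distr P.smult_r_distr P.smult_assoc P.smult_one
  \<comment> \<open>\<open>projective\<close> speaks of plain module records, while \<open>P\<close>
    may carry further fields such as a right action; \<open>M\<close> is \<open>P\<close> with these
    forgotten.\<close>
  define M :: "('r, 'x) module" where "M = \<lparr>carrier = carrier P, monoid.mult = undefined, monoid.one = undefined,
     ring.zero = \<zero>\<^bsub>P\<^esub>, ring.add = ring.add P, smult = smult P\<rparr>"
  define N :: "('r, 'x \<Rightarrow> 'r) module" where "N = \<lparr>carrier = G \<rightarrow>\<^sub>E carrier R, monoid.mult = undefined,
     monoid.one = undefined, ring.zero = (\<lambda>g\<in>G. \<zero>\<^bsub>R\<^esub>), ring.add = (\<lambda>c d. \<lambda>g\<in>G. c g \<oplus>\<^bsub>R\<^esub> d g),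
     smult = (\<lambda>r c. \<lambda>g\<in>G. r \<otimes>\<^bsub>R\<^esub> c g)\<rparr>"
  have M: "left_module R M"
    by (intro left_module.intro left_module_axioms.intro P.R.ring_axioms
        abelian_group_cong[OF P.M.abelian_group_axioms]) (auto simp: M_def smult)
  have "abelian_group N"
  proof (rule abelian_groupI)
    fix c assume "c \<in> carrier N"
    then show "\<exists>d\<in>carrier N. d \<oplus>\<^bsub>N\<^esub> c = \<zero>\<^bsub>N\<^esub>"
      by (intro bexI[of _ "\<lambda>g\<in>G. \<ominus>\<^bsub>R\<^esub> c g"]) (auto simp: N_def PiE_iff P.R.l_neg intro!: restrict_ext)
  qed (auto simp: N_def PiE_iff P.R.a_assoc intro!: restrict_ext P.R.a_comm intro: extensionalityI[of _ G])
  then have N: "left_module R N"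
    by (intro left_module.intro left_module_axioms.intro P.R.ring_axioms)
      (auto simp: N_def PiE_iff P.R.l_distr P.R.r_distr P.R.m_assoc intro!: restrict_ext intro: extensionalityI[of _ G])
  define \<pi> where "\<pi> = (\<lambda>c\<in>carrier N. \<Oplus>\<^bsub>P\<^esub>g\<in>G. c g \<odot>\<^bsub>P\<^esub> g)"
  have N_closed: "c g \<in> carrier R" if "c \<in> carrier N" "g \<in> G" for c g
    using that by (auto simp: N_def)
  have N_ops: "(c \<oplus>\<^bsub>N\<^esub> d) g = c g \<oplus>\<^bsub>R\<^esub> d g" "(r \<odot>\<^bsub>N\<^esub> c) g = r \<otimes>\<^bsub>R\<^esub> c g" if "g \<in> G" for c d r g
    using that by (auto simp: N_def)
  have \<pi>: "\<pi> \<in> lin_hom R N M"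
    unfolding lin_hom_iff
  proof (intro conjI ballI)
    show "\<pi> \<in> carrier N \<rightarrow>\<^sub>E carrier M"
      using G' N_closed smult by (auto simp: \<pi>_def M_def intro!: P.M.finsum_closed)
  next
    fix c d assume c: "c \<in> carrier N" and d: "d \<in> carrier N"
    then have "c \<oplus>\<^bsub>N\<^esub> d \<in> carrier N" by (auto simp: N_def)
    moreover have "(\<Oplus>\<^bsub>P\<^esub>g\<in>G. (c \<oplus>\<^bsub>N\<^esub> d) g \<odot>\<^bsub>P\<^esub> g) = (\<Oplus>\<^bsub>P\<^esub>g\<in>G. c g \<odot>\<^bsub>P\<^esub> g \<oplus>\<^bsub>P\<^esub> d g \<odot>\<^bsub>P\<^esub> g)"
      using c d G' N_closed smult by (intro P.M.finsum_cong') (auto simp: N_ops)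
    moreover have "\<dots> = (\<Oplus>\<^bsub>P\<^esub>g\<in>G. c g \<odot>\<^bsub>P\<^esub> g) \<oplus>\<^bsub>P\<^esub> (\<Oplus>\<^bsub>P\<^esub>g\<in>G. d g \<odot>\<^bsub>P\<^esub> g)"
      using c d G' N_closed smult by (intro P.M.finsum_addf) auto
    ultimately show "\<pi> (c \<oplus>\<^bsub>N\<^esub> d) = \<pi> c \<oplus>\<^bsub>M\<^esub> \<pi> d"
      using c d by (simp add: \<pi>_def M_def)
  next
    fix r c assume r: "r \<in> carrier R" and c: "c \<in> carrier N"
    then have "r \<odot>\<^bsub>N\<^esub> c \<in> carrier N" by (auto simp: N_def)
    moreover have "(\<Oplus>\<^bsub>P\<^esub>g\<in>G. (r \<odot>\<^bsub>N\<^esub> c) g \<odot>\<^bsub>P\<^esub> g) = (\<Oplus>\<^bsub>P\<^esub>g\<in>G. r \<odot>\<^bsub>P\<^esub> (c g \<odot>\<^bsub>P\<^esub> g))"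
      using r c G' N_closed smult by (intro P.M.finsum_cong') (auto simp: N_ops)
    moreover have "\<dots> = r \<odot>\<^bsub>P\<^esub> (\<Oplus>\<^bsub>P\<^esub>g\<in>G. c g \<odot>\<^bsub>P\<^esub> g)"
      using r c G' N_closed smult
      by (subst additive_map_finsum[OF P.M.abelian_group_axioms P.M.abelian_group_axioms,
            where f = "\<lambda>x. r \<odot>\<^bsub>P\<^esub> x"]) (auto simp: additive_map_def)
    ultimately show "\<pi> (r \<odot>\<^bsub>N\<^esub> c) = r \<odot>\<^bsub>M\<^esub> \<pi> c"
      using c by (simp add: \<pi>_def M_def)
  qed
  have \<pi>_surj: "\<pi> ` carrier N = carrier M"
  proof
    show "\<pi> ` carrier N \<subseteq> carrier M"
      using G' N_closed smult by (auto simp: \<pi>_def M_def intro!: P.M.finsum_closed)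
    show "carrier M \<subseteq> \<pi> ` carrier N"
    proof
      fix x assume "x \<in> carrier M"
      then obtain c where c: "c \<in> G \<rightarrow> carrier R" "x = (\<Oplus>\<^bsub>P\<^esub>g\<in>G. c g \<odot>\<^bsub>P\<^esub> g)"
        using gen by (auto simp: M_def)
      have "restrict c G \<in> carrier N" using c by (auto simp: N_def)
      moreover have "(\<Oplus>\<^bsub>P\<^esub>g\<in>G. restrict c G g \<odot>\<^bsub>P\<^esub> g) = (\<Oplus>\<^bsub>P\<^esub>g\<in>G. c g \<odot>\<^bsub>P\<^esub> g)"
        using c G' smult by (intro P.M.finsum_cong') auto
      ultimately have "\<pi> (restrict c G) = x" using c by (simp add: \<pi>_def)
      with \<open>restrict c G \<in> carrier N\<close> show "x \<in> \<pi> ` carrier N" by blast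
    qed
  qed
  have id: "restrict (\<lambda>x. x) (carrier P) \<in> lin_hom R P M"
    by (auto simp: lin_hom_iff M_def smult)
  obtain s where s: "s \<in> lin_hom R P N" "\<And>x. x \<in> carrier P \<Longrightarrow> \<pi> (s x) = restrict (\<lambda>x. x) (carrier P) x"
    using proj[unfolded projective_def, rule_format, OF conjI, OF N conjI, OF M conjI, OF \<pi> conjI, OF \<pi>_surj id]
    by blast
  have s': "s x \<in> carrier N" if "x \<in> carrier P" for x
    using s(1) that by (auto simp: lin_hom_iff)
  define \<phi> where "\<phi> g = (\<lambda>x\<in>carrier P. s x g)" for g
  show thesis
  proof (rule that[OF G, of \<phi>])
    show "\<phi> g \<in> lin_hom R P (reg_bimod R)" if g: "g \<in> G" for g
      using s(1) s' N_closed g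
      by (auto simp: lin_hom_iff \<phi>_def smult reg_bimod_def ring_bimod_def N_ops)
    show "(\<Oplus>\<^bsub>P\<^esub>g\<in>G. \<phi> g x \<odot>\<^bsub>P\<^esub> g) = x" if x: "x \<in> carrier P" for x
      using s(2)[OF x] s'[OF x] x by (simp add: \<pi>_def \<phi>_def)
  qed
qed

section \<open>Tensor products\<close>

definition tens :: "('s, 'k) ring_scheme \<Rightarrow> ('r, 's, 'x, 'm) bimodule_scheme \<Rightarrow>
    ('s, 't, 'y, 'n) bimodule_scheme \<Rightarrow> 'x \<Rightarrow> 'y \<Rightarrow> ('x \<times> 'y \<Rightarrow>\<^sub>0 int) set" where
  "tens S M N x y = tensor_rels S M N #>\<^bsub>tensor_free M N\<^esub> frag_of (x, y)"

definition balanced :: "('s, 'k) ring_scheme \<Rightarrow> ('r, 's, 'x, 'm) bimodule_scheme \<Rightarrow>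
    ('s, 't, 'y, 'n) bimodule_scheme \<Rightarrow> ('g, 'l) ring_scheme \<Rightarrow> ('x \<Rightarrow> 'y \<Rightarrow> 'g) \<Rightarrow> bool" where
  "balanced S M N G b \<longleftrightarrow>
     (\<forall>x\<in>carrier M. additive_map N G (b x)) \<and> (\<forall>y\<in>carrier N. additive_map M G (\<lambda>x. b x y)) \<and>
     (\<forall>x\<in>carrier M. \<forall>s\<in>carrier S. \<forall>y\<in>carrier N. b (rsmult M x s) y = b x (s \<odot>\<^bsub>N\<^esub> y))"

locale tensor_product = M: bimodule R S M + N: bimodule S T N
  for R :: "('r, 'k) ring_scheme" and S :: "('s, 'l) ring_scheme" and T :: "('t, 'j) ring_scheme"
    and M :: "('r, 's, 'x, 'm) bimodule_scheme" and N :: "('s, 't, 'y, 'n) bimodule_scheme"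
begin

abbreviation TP where "TP \<equiv> tensor_bimod S M N"
abbreviation Z where "Z \<equiv> tensor_rels S M N"
abbreviation Fr where "Fr \<equiv> tensor_free M N"
abbreviation tns (infixl \<open>\<odot>\<odot>\<close> 75) where "x \<odot>\<odot> y \<equiv> tens S M N x y"

definition coset where "coset w = Z #>\<^bsub>Fr\<^esub> w"

definition rel_gens where "rel_gens =
    {frag_of (x \<oplus>\<^bsub>M\<^esub> x', y) - frag_of (x, y) - frag_of (x', y) | x x' y.
        x \<in> carrier M \<and> x' \<in> carrier M \<and> y \<in> carrier N} \<union>
     {frag_of (x, y \<oplus>\<^bsub>N\<^esub> y') - frag_of (x, y) - frag_of (x, y') | x y y'.
        x \<in> carrier M \<and> y \<in> carrier N \<and> y' \<in> carrier N} \<union>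
     {frag_of (rsmult M x s, y) - frag_of (x, s \<odot>\<^bsub>N\<^esub> y) | x s y.
        x \<in> carrier M \<and> s \<in> carrier S \<and> y \<in> carrier N}"

lemma Z_eq: "Z = generate Fr rel_gens"
  by (simp add: tensor_rels_def rel_gens_def)

lemma Fr_comm_group: "comm_group Fr"
  by (simp add: tensor_free_def abelian_free_Abelian_group)

sublocale Fr: comm_group Fr by (rule Fr_comm_group)

lemma Fr_simps [simp]:
  "w \<in> carrier Fr \<longleftrightarrow> Poly_Mapping.keys w \<subseteq> carrier M \<times> carrier N"
  "v \<otimes>\<^bsub>Fr\<^esub> w = v + w" "\<one>\<^bsub>Fr\<^esub> = 0"
  by (simp_all add: tensor_free_def)

lemma frag_of_in_Fr: "x \<in> carrier M \<Longrightarrow> y \<in> carrier N \<Longrightarrow> frag_of (x, y) \<in> carrier Fr"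
  by (simp add: tensor_free_def)

lemma diff_in_Fr: "v \<in> carrier Fr \<Longrightarrow> w \<in> carrier Fr \<Longrightarrow> v - w \<in> carrier Fr"
  using keys_diff[of v w] by auto

lemma rel_gens_subset: "rel_gens \<subseteq> carrier Fr"
  unfolding rel_gens_def by (auto simp del: Fr_simps intro!: diff_in_Fr frag_of_in_Fr)

lemma subgroup_Z: "subgroup Z Fr"
  unfolding Z_eq by (rule Fr.generate_is_subgroup[OF rel_gens_subset])

sublocale Z: normal Z Fr
  using subgroup_Z by (simp add: Fr.normal_iff_subgroup)

lemma TP_simps:
  "carrier TP = coset ` carrier Fr" "\<zero>\<^bsub>TP\<^esub> = Z" "C \<oplus>\<^bsub>TP\<^esub> D = C <#>\<^bsub>Fr\<^esub> D"
  "r \<odot>\<^bsub>TP\<^esub> C = tensor_map S M N (\<lambda>(x, y). (r \<odot>\<^bsub>M\<^esub> x, y)) C"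
  "rsmult TP C t = tensor_map S M N (\<lambda>(x, y). (x, rsmult N y t)) C"
  by (auto simp: tensor_bimod_def carrier_FactGroup coset_def)

lemma TP_abelian_group: "abelian_group TP"
proof -
  have "comm_group (Fr Mod Z)"
    by (rule Fr.abelian_FactGroup[OF subgroup_Z])
  then interpret Q: comm_group "Fr Mod Z" .
  have car: "carrier TP = carrier (Fr Mod Z)" by (simp add: tensor_bimod_def)
  have add: "C \<oplus>\<^bsub>TP\<^esub> D = C \<otimes>\<^bsub>Fr Mod Z\<^esub> D" for C D by (simp add: tensor_bimod_def)
  have zero: "\<zero>\<^bsub>TP\<^esub> = \<one>\<^bsub>Fr Mod Z\<^esub>" by (simp add: tensor_bimod_def)
  show ?thesis
    by (rule abelian_groupI; unfold car add zero;
        (rule Q.m_assoc Q.m_comm Q.l_inv_ex Q.l_one Q.m_closed Q.one_closed; assumption))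
qed

sublocale TP: abelian_group TP by (rule TP_abelian_group)

section \<open>Cosets and pure tensors\<close>

lemma tens_eq_coset: "x \<odot>\<odot> y = coset (frag_of (x, y))"
  by (simp add: tens_def coset_def)

lemma coset_closed: "w \<in> carrier Fr \<Longrightarrow> coset w \<in> carrier TP"
  by (simp only: TP_simps(1)) blast

lemma coset_add: "v \<in> carrier Fr \<Longrightarrow> w \<in> carrier Fr \<Longrightarrow> coset (v + w) = coset v \<oplus>\<^bsub>TP\<^esub> coset w"
  using Z.rcos_sum[of v w] by (simp add: TP_simps coset_def)

lemma coset_Z: "w \<in> Z \<Longrightarrow> coset w = \<zero>\<^bsub>TP\<^esub>"
  using Fr.coset_join2[of w Z] subgroup_Z subgroup.mem_carrier[OF subgroup_Z, of w]
  by (simp add: coset_def TP_simps)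

lemma coset_0: "coset 0 = \<zero>\<^bsub>TP\<^esub>"
  using coset_Z[of 0] subgroup.one_closed[OF subgroup_Z] by simp

lemma coset_diff:
  assumes "v \<in> carrier Fr" "w \<in> carrier Fr"
  shows "coset (v - w) = coset v \<ominus>\<^bsub>TP\<^esub> coset w"
proof -
  have "coset v = coset (v - w) \<oplus>\<^bsub>TP\<^esub> coset w"
    using coset_add[of "v - w" w] assms diff_in_Fr by (simp del: Fr_simps)
  moreover have "coset v \<in> carrier TP" "coset w \<in> carrier TP" "coset (v - w) \<in> carrier TP"
    using assms coset_closed diff_in_Fr by blast+
  ultimately show ?thesis
    by (simp add: a_minus_def TP.a_assoc TP.r_neg)
qed

lemma coset_rel: "w \<in> rel_gens \<Longrightarrow> coset w = \<zero>\<^bsub>TP\<^esub>"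
  by (rule coset_Z) (simp add: Z_eq generate.incl)

lemma tens_closed [simp, intro]: "x \<in> carrier M \<Longrightarrow> y \<in> carrier N \<Longrightarrow> x \<odot>\<odot> y \<in> carrier TP"
  by (simp only: tens_eq_coset coset_closed frag_of_in_Fr)

lemma coset_eqI:
  assumes "v \<in> carrier Fr" "w \<in> carrier Fr" "coset (v - w) = \<zero>\<^bsub>TP\<^esub>"
  shows "coset v = coset w"
proof -
  have "coset v = coset (v - w) \<oplus>\<^bsub>TP\<^esub> coset w"
    using coset_add[of "v - w" w] assms diff_in_Fr by (simp del: Fr_simps)
  then show ?thesis
    using assms coset_closed by (simp del: Fr_simps)
qed

lemma tens_add_left:
  assumes "x \<in> carrier M" "x' \<in> carrier M" "y \<in> carrier N"
  shows "(x \<oplus>\<^bsub>M\<^esub> x') \<odot>\<odot> y = x \<odot>\<odot> y \<oplus>\<^bsub>TP\<^esub> x' \<odot>\<odot> y"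
proof -
  have "frag_of (x \<oplus>\<^bsub>M\<^esub> x', y) - (frag_of (x, y) + frag_of (x', y)) \<in> rel_gens"
    using assms unfolding rel_gens_def diff_diff_eq[symmetric] by blast
  then have "coset (frag_of (x \<oplus>\<^bsub>M\<^esub> x', y)) = coset (frag_of (x, y) + frag_of (x', y))"
    using assms Fr.m_closed[OF frag_of_in_Fr frag_of_in_Fr]
    by (intro coset_eqI coset_rel) (auto simp del: Fr_simps(1) intro: frag_of_in_Fr)
  then show ?thesis
    using assms by (simp add: tens_eq_coset coset_add frag_of_in_Fr del: Fr_simps)
qed

lemma tens_add_right:
  assumes "x \<in> carrier M" "y \<in> carrier N" "y' \<in> carrier N"
  shows "x \<odot>\<odot> (y \<oplus>\<^bsub>N\<^esub> y') = x \<odot>\<odot> y \<oplus>\<^bsub>TP\<^esub> x \<odot>\<odot> y'"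
proof -
  have "frag_of (x, y \<oplus>\<^bsub>N\<^esub> y') - (frag_of (x, y) + frag_of (x, y')) \<in> rel_gens"
    using assms unfolding rel_gens_def diff_diff_eq[symmetric] by blast
  then have "coset (frag_of (x, y \<oplus>\<^bsub>N\<^esub> y')) = coset (frag_of (x, y) + frag_of (x, y'))"
    using assms Fr.m_closed[OF frag_of_in_Fr frag_of_in_Fr]
    by (intro coset_eqI coset_rel) (auto simp del: Fr_simps(1) intro: frag_of_in_Fr)
  then show ?thesis
    using assms by (simp add: tens_eq_coset coset_add frag_of_in_Fr del: Fr_simps)
qed

lemma tens_balanced:
  assumes "x \<in> carrier M" "s \<in> carrier S" "y \<in> carrier N"
  shows "rsmult M x s \<odot>\<odot> y = x \<odot>\<odot> (s \<odot>\<^bsub>N\<^esub> y)"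
  unfolding tens_eq_coset
  using assms unfolding rel_gens_def
  by (intro coset_eqI coset_rel) (auto simp: rel_gens_def simp del: Fr_simps intro: frag_of_in_Fr)

lemma additive_tens_left: "y \<in> carrier N \<Longrightarrow> additive_map M TP (\<lambda>x. x \<odot>\<odot> y)"
  by (auto simp: additive_map_def tens_add_left)

lemma additive_tens_right: "x \<in> carrier M \<Longrightarrow> additive_map N TP (\<lambda>y. x \<odot>\<odot> y)"
  by (auto simp: additive_map_def tens_add_right)

lemma tens_finsum_left: "\<lbrakk>y \<in> carrier N; f \<in> I \<rightarrow> carrier M\<rbrakk> \<Longrightarrow>
    (\<Oplus>\<^bsub>M\<^esub>i\<in>I. f i) \<odot>\<odot> y = (\<Oplus>\<^bsub>TP\<^esub>i\<in>I. f i \<odot>\<odot> y)"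
  by (rule additive_map_finsum[OF M.abelian_group_axioms TP_abelian_group additive_tens_left])

lemma tens_finsum_right: "\<lbrakk>x \<in> carrier M; f \<in> I \<rightarrow> carrier N\<rbrakk> \<Longrightarrow>
    x \<odot>\<odot> (\<Oplus>\<^bsub>N\<^esub>i\<in>I. f i) = (\<Oplus>\<^bsub>TP\<^esub>i\<in>I. x \<odot>\<odot> f i)"
  by (rule additive_map_finsum[OF N.abelian_group_axioms TP_abelian_group additive_tens_right])

text \<open>Integer coefficients need no case of their own, since -(x \<otimes> y) = (-x) \<otimes>
  y is again a pure tensor.\<close>

lemma tens_induct [consumes 1, case_names zero tens add]:
  assumes "C \<in> carrier TP" "P \<zero>\<^bsub>TP\<^esub>"
    and tens: "\<And>x y. x \<in> carrier M \<Longrightarrow> y \<in> carrier N \<Longrightarrow> P (x \<odot>\<odot> y)"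
    and add: "\<And>C D. C \<in> carrier TP \<Longrightarrow> D \<in> carrier TP \<Longrightarrow> P C \<Longrightarrow> P D \<Longrightarrow> P (C \<oplus>\<^bsub>TP\<^esub> D)"
  shows "P C"
proof -
  obtain w where w: "Poly_Mapping.keys w \<subseteq> carrier M \<times> carrier N" "C = coset w"
    using assms(1) unfolding TP_simps by auto
  \<comment> \<open>Induction on the free abelian group proceeds through differences v - w, so the
    claim is strengthened to include the negative of each coset.\<close>
  from w(1) have "P (coset w) \<and> P (\<ominus>\<^bsub>TP\<^esub> coset w)"
  proof (induction w rule: free_Abelian_group_induct[consumes 1])
    case 1
    have "\<ominus>\<^bsub>TP\<^esub> \<zero>\<^bsub>TP\<^esub> = \<zero>\<^bsub>TP\<^esub>"
      by (rule TP.minus_equality) auto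
    then show ?case using assms(2) unfolding coset_0 by metis
  next
    case (2 v w)
    then have closed: "coset v \<in> carrier TP" "coset w \<in> carrier TP"
      by (auto intro!: coset_closed)
    have eq: "coset (v - w) = coset v \<oplus>\<^bsub>TP\<^esub> \<ominus>\<^bsub>TP\<^esub> coset w"
      using 2 coset_diff[of v w] by (simp add: a_minus_def)
    then have "\<ominus>\<^bsub>TP\<^esub> coset (v - w) = \<ominus>\<^bsub>TP\<^esub> coset v \<oplus>\<^bsub>TP\<^esub> coset w"
      using closed by (simp add: TP.minus_add)
    with eq show ?case using 2 closed add by simp
  next
    case (3 p)
    then obtain x y where p: "p = (x, y)" and x: "x \<in> carrier M" and y: "y \<in> carrier N" by auto
    have "\<ominus>\<^bsub>TP\<^esub> (x \<odot>\<odot> y) = (\<ominus>\<^bsub>M\<^esub> x) \<odot>\<odot> y"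
      using additive_neg[OF M.abelian_group_axioms TP_abelian_group additive_tens_left[OF y] x] by simp
    then show ?case
      using p x y tens by (simp flip: tens_eq_coset)
  qed
  then show ?thesis using w by simp
qed

text \<open>The reduction to pure tensors on which the bimodule laws, the linearity of induced maps
  and the evaluation of composites below all rest.\<close>

lemma additive_eq_on_tens:
  assumes "abelian_group G" "additive_map TP G f" "additive_map TP G g" "C \<in> carrier TP"
    and "\<And>x y. x \<in> carrier M \<Longrightarrow> y \<in> carrier N \<Longrightarrow> f (x \<odot>\<odot> y) = g (x \<odot>\<odot> y)"
  shows "f C = g C"
  using assms(4)
proof (induction C rule: tens_induct)
  case zero
  then show ?case
    using additive_zero[OF TP_abelian_group assms(1)] assms(2,3) by metis
qed (use assms in \<open>auto simp: additive_map_def\<close>)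

text \<open>The universal property of the free abelian group extends \<open>b\<close> to a
  homomorphism \<open>k\<close>. Balancedness says that \<open>k\<close> kills the generators in
  \<open>rel_gens\<close>, hence the subgroup \<open>Z\<close> that they generate, so
  \<open>k\<close> factors through the cosets.\<close>

lemma tens_universal:
  assumes G: "abelian_group G" and b: "balanced S M N G b"
  obtains f where "additive_map TP G f"
    "\<And>x y. x \<in> carrier M \<Longrightarrow> y \<in> carrier N \<Longrightarrow> f (x \<odot>\<odot> y) = b x y"
proof -
  interpret G: abelian_group G by fact
  let ?G = "add_monoid G"
  have bs: "b x y \<in> carrier G" if "x \<in> carrier M" "y \<in> carrier N" for x y
    using b that by (auto simp: balanced_def additive_map_def)
  have "(\<lambda>p. b (fst p) (snd p)) ` (carrier M \<times> carrier N) \<subseteq> carrier ?G"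
    using bs by auto
  then obtain k where k: "k \<in> hom Fr ?G" and
    kf: "\<And>p. p \<in> carrier M \<times> carrier N \<Longrightarrow> k (frag_of p) = b (fst p) (snd p)"
    using comm_group.free_Abelian_group_universal[OF G.a_comm_group] unfolding tensor_free_def by blast
  interpret k: group_hom Fr ?G k
    using k by (intro group_hom.intro Fr.is_group G.a_group) (simp add: group_hom_axioms_def)
  have kd: "k (v - w) = k v \<ominus>\<^bsub>G\<^esub> k w" if "v \<in> carrier Fr" "w \<in> carrier Fr" for v w
  proof -
    have "k v = k (v - w) \<oplus>\<^bsub>G\<^esub> k w"
      using that k.hom_mult[of "v - w" w] diff_in_Fr by (simp del: Fr_simps(1))
    moreover have "k v \<in> carrier G" "k w \<in> carrier G" "k (v - w) \<in> carrier G"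
      using that diff_in_Fr k.hom_closed by auto
    ultimately show ?thesis
      by (simp add: a_minus_def G.a_assoc G.r_neg)
  qed
  have kz: "k w = \<zero>\<^bsub>G\<^esub>" if "w \<in> rel_gens" for w
  proof -
    have fd: "\<And>p. p \<in> carrier M \<times> carrier N \<Longrightarrow> frag_of p \<in> carrier Fr" by auto
    \<comment> \<open>a + c - a - c = 0 settles the two additivity relations, and a - a = 0 the
      balancing relation.\<close>
    have ee: "a \<oplus>\<^bsub>G\<^esub> c \<ominus>\<^bsub>G\<^esub> a \<ominus>\<^bsub>G\<^esub> c = \<zero>\<^bsub>G\<^esub>" if "a \<in> carrier G" "c \<in> carrier G" for a c
    proof -
      have "\<ominus>\<^bsub>G\<^esub> a \<oplus>\<^bsub>G\<^esub> \<ominus>\<^bsub>G\<^esub> c = \<ominus>\<^bsub>G\<^esub> (a \<oplus>\<^bsub>G\<^esub> c)"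
        using that by (simp add: G.minus_add)
      then show ?thesis
        using that by (simp add: a_minus_def G.a_assoc[of "a \<oplus>\<^bsub>G\<^esub> c"] G.r_neg)
    qed
    have ee': "a \<ominus>\<^bsub>G\<^esub> a = \<zero>\<^bsub>G\<^esub>" if "a \<in> carrier G" for a
      using that by (simp add: a_minus_def G.r_neg)
    show ?thesis
      using that b bs unfolding rel_gens_def balanced_def additive_map_def
      by (elim UnE CollectE exE conjE) (simp_all add: kd diff_in_Fr fd kf ee ee' del: Fr_simps(1))
  qed
  have kZ: "k w = \<zero>\<^bsub>G\<^esub>" if "w \<in> Z" for w
  proof -
    have "rel_gens \<subseteq> kernel Fr ?G k"
      using kz rel_gens_subset by (auto simp: kernel_def simp del: Fr_simps)
    then have "Z \<subseteq> kernel Fr ?G k"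
      unfolding Z_eq by (rule Fr.generate_subgroup_incl[OF _ k.subgroup_kernel])
    then show ?thesis using that by (auto simp: kernel_def)
  qed
  have "k v = k w" if "v \<in> carrier Fr" "w \<in> carrier Fr" "Z #>\<^bsub>Fr\<^esub> v = Z #>\<^bsub>Fr\<^esub> w" for v w
  proof -
    have "v \<in> Z #>\<^bsub>Fr\<^esub> w"
      using that Fr.rcos_self[OF that(1) subgroup_Z] by simp
    then obtain z where z: "z \<in> Z" "v = z + w"
      by (auto simp: r_coset_def)
    then have "k v = k z \<oplus>\<^bsub>G\<^esub> k w"
      using that k.hom_mult[of z w] subgroup.mem_carrier[OF subgroup_Z, of z] by simp
    then show ?thesis using kZ[OF z(1)] k.hom_closed[OF that(2)] by simp
  qed
  then obtain f where f: "f \<in> hom (Fr Mod Z) ?G" "\<And>w. w \<in> carrier Fr \<Longrightarrow> f (Z #>\<^bsub>Fr\<^esub> w) = k w"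
    using FactGroup_universal[OF k Z.normal_axioms] by blast
  show thesis
  proof (rule that[of f])
    show "additive_map TP G f"
      using f(1) by (auto simp: additive_map_def hom_def tensor_bimod_def)
    show "f (x \<odot>\<odot> y) = b x y" if "x \<in> carrier M" "y \<in> carrier N" for x y
      using that f(2)[of "frag_of (x, y)"] kf[of "(x, y)"] by (simp add: tens_def)
  qed
qed

text \<open>\<open>tensor_map\<close> takes a union over all representatives of \<open>C\<close>. An
  additive \<open>f\<close> that agrees with \<phi> on pure tensors forces every representative to
  yield the coset \<open>f C\<close>, so the union is \<open>f C\<close> itself. Thus
  \<open>f\<close> has to be available first, from the universal property.\<close>

lemma tensor_map_eq:
  assumes \<phi>: "\<And>x y. x \<in> carrier M \<Longrightarrow> y \<in> carrier N \<Longrightarrow> \<phi> (x, y) \<in> carrier M \<times> carrier N"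
    and f: "additive_map TP TP f"
    and f\<phi>: "\<And>x y. x \<in> carrier M \<Longrightarrow> y \<in> carrier N \<Longrightarrow> f (x \<odot>\<odot> y) = fst (\<phi> (x, y)) \<odot>\<odot> snd (\<phi> (x, y))"
    and C: "C \<in> carrier TP"
  shows "tensor_map S M N \<phi> C = f C"
proof -
  let ?e = "frag_extend (\<lambda>p. frag_of (\<phi> p))"
  have *: "?e w \<in> carrier Fr \<and> coset (?e w) = f (coset w)" if "w \<in> carrier Fr" for w
    using that[unfolded Fr_simps(1)]
  proof (induction w rule: free_Abelian_group_induct[consumes 1])
    case 1
    then show ?case
      using additive_zero[OF TP_abelian_group TP_abelian_group f] by (simp add: coset_0)
  next
    case (2 v w)
    then have "?e v - ?e w \<in> carrier Fr" using diff_in_Fr by blast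
    moreover have "f (coset v \<ominus>\<^bsub>TP\<^esub> coset w) = f (coset v) \<ominus>\<^bsub>TP\<^esub> f (coset w)"
      using 2 f coset_closed additive_neg[OF TP_abelian_group TP_abelian_group f, of "coset w"]
      by (simp add: additive_map_def a_minus_def)
    ultimately show ?case
      using 2 coset_diff[of v w] coset_diff[of "?e v" "?e w"] by (simp add: frag_extend_diff)
  next
    case (3 p)
    then show ?case
      using f\<phi>[of "fst p" "snd p"] \<phi>[of "fst p" "snd p"] by (auto simp: tens_eq_coset)
  qed
  obtain w where w: "w \<in> carrier Fr" "C = coset w"
    using C unfolding TP_simps by auto
  have "coset (?e v) = f C" if "v \<in> C" for v
  proof -
    have "v \<in> Z #>\<^bsub>Fr\<^esub> w" using that w by (simp add: coset_def)
    moreover from this have "v \<in> carrier Fr"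
      using Fr.r_coset_subset_G[OF subgroup.subset[OF subgroup_Z] w(1)] by blast
    ultimately have "coset v = C"
      using Fr.repr_independence[OF _ w(1) subgroup_Z, of v] w by (simp add: coset_def)
    then show ?thesis using *[OF \<open>v \<in> carrier Fr\<close>] by simp
  qed
  \<comment> \<open>The union equals \<open>f C\<close> only if at least one representative
    contributes to it.\<close>
  moreover have "C \<noteq> {}"
    using Fr.rcos_self[OF w(1) subgroup_Z] w by (auto simp: coset_def)
  ultimately show ?thesis
    unfolding tensor_map_def coset_def[symmetric] by auto
qed

text \<open>The map sending (x, y) to (r x) \<otimes> y is balanced because the two actions on
  \<open>M\<close> commute. The additive map that it induces replaces the union in the definition of
  the action, which makes additivity of the action available.\<close>

lemma smult_tens_ex:
  assumes r: "r \<in> carrier R"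
  obtains f where "additive_map TP TP f" "\<And>C. C \<in> carrier TP \<Longrightarrow> r \<odot>\<^bsub>TP\<^esub> C = f C"
    "\<And>x y. x \<in> carrier M \<Longrightarrow> y \<in> carrier N \<Longrightarrow> f (x \<odot>\<odot> y) = (r \<odot>\<^bsub>M\<^esub> x) \<odot>\<odot> y"
proof -
  have "balanced S M N TP (\<lambda>x y. (r \<odot>\<^bsub>M\<^esub> x) \<odot>\<odot> y)"
    using r by (auto simp: balanced_def additive_map_def tens_add_left tens_add_right M.smult_simps
        tens_balanced simp flip: M.smult_rsmult)
  then obtain f where f: "additive_map TP TP f"
    "\<And>x y. x \<in> carrier M \<Longrightarrow> y \<in> carrier N \<Longrightarrow> f (x \<odot>\<odot> y) = (r \<odot>\<^bsub>M\<^esub> x) \<odot>\<odot> y"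
    using tens_universal[OF TP_abelian_group] by blast
  moreover have "r \<odot>\<^bsub>TP\<^esub> C = f C" if "C \<in> carrier TP" for C
    unfolding TP_simps using r f that by (intro tensor_map_eq) auto
  ultimately show thesis using that by blast
qed

lemma rsmult_tens_ex:
  assumes t: "t \<in> carrier T"
  obtains f where "additive_map TP TP f" "\<And>C. C \<in> carrier TP \<Longrightarrow> rsmult TP C t = f C"
    "\<And>x y. x \<in> carrier M \<Longrightarrow> y \<in> carrier N \<Longrightarrow> f (x \<odot>\<odot> y) = x \<odot>\<odot> rsmult N y t"
proof -
  have "balanced S M N TP (\<lambda>x y. x \<odot>\<odot> rsmult N y t)"
    using t by (auto simp: balanced_def additive_map_def tens_add_left tens_add_right N.smult_simps
        tens_balanced)
  then obtain f where f: "additive_map TP TP f"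
    "\<And>x y. x \<in> carrier M \<Longrightarrow> y \<in> carrier N \<Longrightarrow> f (x \<odot>\<odot> y) = x \<odot>\<odot> rsmult N y t"
    using tens_universal[OF TP_abelian_group] by blast
  moreover have "rsmult TP C t = f C" if "C \<in> carrier TP" for C
    unfolding TP_simps using t f that by (intro tensor_map_eq) auto
  ultimately show thesis using that by blast
qed

lemma smult_tens: "r \<in> carrier R \<Longrightarrow> x \<in> carrier M \<Longrightarrow> y \<in> carrier N \<Longrightarrow> r \<odot>\<^bsub>TP\<^esub> (x \<odot>\<odot> y) = (r \<odot>\<^bsub>M\<^esub> x) \<odot>\<odot> y"
  by (rule smult_tens_ex[of r]) auto

lemma additive_smult_TP: "r \<in> carrier R \<Longrightarrow> additive_map TP TP (\<lambda>C. r \<odot>\<^bsub>TP\<^esub> C)"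
  by (rule smult_tens_ex[of r]) (auto simp: additive_map_def)

lemma rsmult_tens: "t \<in> carrier T \<Longrightarrow> x \<in> carrier M \<Longrightarrow> y \<in> carrier N \<Longrightarrow> rsmult TP (x \<odot>\<odot> y) t = x \<odot>\<odot> rsmult N y t"
  by (rule rsmult_tens_ex[of t]) auto

lemma additive_rsmult_TP: "t \<in> carrier T \<Longrightarrow> additive_map TP TP (\<lambda>C. rsmult TP C t)"
  by (rule rsmult_tens_ex[of t]) (auto simp: additive_map_def)

text \<open>Once both actions are known to be additive, each remaining law equates two additive maps
  of \<open>C\<close> and need only be tested on pure tensors, where it is a law of \<open>M\<close>
  or of \<open>N\<close>.\<close>

lemma bimodule_TP: "bimodule R T TP"
proof (rule bimoduleI)
  interpret T: ring T by (rule N.ring_right)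
  note add = additive_smult_TP additive_rsmult_TP
  note [simp] = smult_tens rsmult_tens M.smult_simps N.smult_simps tens_add_left tens_add_right
  show "r \<odot>\<^bsub>TP\<^esub> C \<in> carrier TP" if "r \<in> carrier R" "C \<in> carrier TP" for r C
    using additive_smult_TP that by (auto simp: additive_map_def)
  show "rsmult TP C t \<in> carrier TP" if "t \<in> carrier T" "C \<in> carrier TP" for t C
    using additive_rsmult_TP that by (auto simp: additive_map_def)
  show "r \<odot>\<^bsub>TP\<^esub> (C \<oplus>\<^bsub>TP\<^esub> D) = r \<odot>\<^bsub>TP\<^esub> C \<oplus>\<^bsub>TP\<^esub> r \<odot>\<^bsub>TP\<^esub> D"
    if "r \<in> carrier R" "C \<in> carrier TP" "D \<in> carrier TP" for r C D
    using additive_smult_TP that by (auto simp: additive_map_def)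
  show "rsmult TP (C \<oplus>\<^bsub>TP\<^esub> D) t = rsmult TP C t \<oplus>\<^bsub>TP\<^esub> rsmult TP D t"
    if "t \<in> carrier T" "C \<in> carrier TP" "D \<in> carrier TP" for t C D
    using additive_rsmult_TP that by (auto simp: additive_map_def)
  show "(r \<oplus>\<^bsub>R\<^esub> s) \<odot>\<^bsub>TP\<^esub> C = r \<odot>\<^bsub>TP\<^esub> C \<oplus>\<^bsub>TP\<^esub> s \<odot>\<^bsub>TP\<^esub> C"
    if "r \<in> carrier R" "s \<in> carrier R" "C \<in> carrier TP" for r s C
    by (rule additive_eq_on_tens[OF TP_abelian_group _ _ that(3)]) (use that in \<open>auto intro!: add additive_add[OF TP_abelian_group add(1) add(1)]\<close>)
  show "rsmult TP C (s \<oplus>\<^bsub>T\<^esub> t) = rsmult TP C s \<oplus>\<^bsub>TP\<^esub> rsmult TP C t"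
    if "s \<in> carrier T" "t \<in> carrier T" "C \<in> carrier TP" for s t C
    by (rule additive_eq_on_tens[OF TP_abelian_group _ _ that(3)])
      (use that in \<open>auto intro!: add additive_add[OF TP_abelian_group add(2) add(2)]\<close>)
  show "(r \<otimes>\<^bsub>R\<^esub> s) \<odot>\<^bsub>TP\<^esub> C = r \<odot>\<^bsub>TP\<^esub> (s \<odot>\<^bsub>TP\<^esub> C)"
    if "r \<in> carrier R" "s \<in> carrier R" "C \<in> carrier TP" for r s C
    by (rule additive_eq_on_tens[OF TP_abelian_group _ _ that(3)])
      (use that in \<open>auto intro!: add additive_compose[OF add(1) add(1)]\<close>)
  show "rsmult TP C (s \<otimes>\<^bsub>T\<^esub> t) = rsmult TP (rsmult TP C s) t"
    if "s \<in> carrier T" "t \<in> carrier T" "C \<in> carrier TP" for s t C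
    by (rule additive_eq_on_tens[OF TP_abelian_group _ _ that(3)])
      (use that in \<open>auto intro!: additive_compose[OF add(2) add(2)] add\<close>)
  show "\<one>\<^bsub>R\<^esub> \<odot>\<^bsub>TP\<^esub> C = C" if "C \<in> carrier TP" for C
    by (rule additive_eq_on_tens[OF TP_abelian_group _ _ that]) (auto intro!: additive_id add)
  show "rsmult TP C \<one>\<^bsub>T\<^esub> = C" if "C \<in> carrier TP" for C
    by (rule additive_eq_on_tens[OF TP_abelian_group _ _ that])
      (use T.one_closed in \<open>auto intro!: additive_id add\<close>)
  show "rsmult TP (r \<odot>\<^bsub>TP\<^esub> C) t = r \<odot>\<^bsub>TP\<^esub> rsmult TP C t"
    if "r \<in> carrier R" "t \<in> carrier T" "C \<in> carrier TP" for r t C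
    by (rule additive_eq_on_tens[OF TP_abelian_group _ _ that(3)])
      (use that in \<open>auto intro!: additive_compose[OF add(1) add(2)] additive_compose[OF add(2) add(1)]\<close>)
qed (rule M.left.R.ring_axioms N.ring_right TP_abelian_group)+

text \<open>Compatibility of the induced map with a scalar is an equality of additive maps, so the
  hypotheses on \<open>b\<close>, which concern pure tensors alone, suffice.\<close>

lemma tens_bimod_hom:
  assumes G: "bimodule R T G" and b: "balanced S M N G b"
    and "\<And>r x y. r \<in> carrier R \<Longrightarrow> x \<in> carrier M \<Longrightarrow> y \<in> carrier N \<Longrightarrow> b (r \<odot>\<^bsub>M\<^esub> x) y = r \<odot>\<^bsub>G\<^esub> b x y"
    and "\<And>t x y. t \<in> carrier T \<Longrightarrow> x \<in> carrier M \<Longrightarrow> y \<in> carrier N \<Longrightarrow> b x (rsmult N y t) = rsmult G (b x y) t"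
  obtains f where "f \<in> bimod_hom R T TP G"
    "\<And>x y. x \<in> carrier M \<Longrightarrow> y \<in> carrier N \<Longrightarrow> f (x \<odot>\<odot> y) = b x y"
proof -
  interpret G: bimodule R T G by fact
  obtain f where f: "additive_map TP G f"
    "\<And>x y. x \<in> carrier M \<Longrightarrow> y \<in> carrier N \<Longrightarrow> f (x \<odot>\<odot> y) = b x y"
    using tens_universal[OF G.abelian_group_axioms b] by blast
  have b_closed: "b x y \<in> carrier G" if "x \<in> carrier M" "y \<in> carrier N" for x y
    using b that by (auto simp: balanced_def additive_map_def)
  have l: "additive_map G G (\<lambda>x. r \<odot>\<^bsub>G\<^esub> x)" if "r \<in> carrier R" for r
    using that by (auto simp: additive_map_def G.smult_simps)
  have r: "additive_map G G (\<lambda>x. rsmult G x t)" if "t \<in> carrier T" for t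
    using that by (auto simp: additive_map_def G.smult_simps)
  have "restrict f (carrier TP) \<in> bimod_hom R T TP G"
  proof (rule bimod_homI)
    show "f (r \<odot>\<^bsub>TP\<^esub> C) = r \<odot>\<^bsub>G\<^esub> f C" if "r \<in> carrier R" "C \<in> carrier TP" for r C
      by (rule additive_eq_on_tens[OF G.abelian_group_axioms _ _ that(2)])
        (use that f assms in \<open>auto intro: additive_compose[OF additive_smult_TP f(1)]
           additive_compose[OF f(1) l] simp: smult_tens\<close>)
    show "f (rsmult TP C t) = rsmult G (f C) t" if "t \<in> carrier T" "C \<in> carrier TP" for t C
      by (rule additive_eq_on_tens[OF G.abelian_group_axioms _ _ that(2)])
        (use that f assms in \<open>auto intro: additive_compose[OF additive_rsmult_TP f(1)]
           additive_compose[OF f(1) r] simp: rsmult_tens\<close>)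
  qed (use f bimodule_TP in \<open>auto simp: additive_map_def\<close>)
  then show thesis using f by (intro that) auto
qed

end

section \<open>Endomorphism bimodules of a ring extension\<close>

lemma ring_bimod_simps [simp]:
  "carrier (ring_bimod A l r) = carrier A" "\<zero>\<^bsub>ring_bimod A l r\<^esub> = \<zero>\<^bsub>A\<^esub>"
  "x \<oplus>\<^bsub>ring_bimod A l r\<^esub> y = x \<oplus>\<^bsub>A\<^esub> y" "k \<odot>\<^bsub>ring_bimod A l r\<^esub> x = l k x"
  "rsmult (ring_bimod A l r) x s = r x s"
  by (simp_all add: ring_bimod_def)

lemma abelian_group_ring_bimod: "abelian_group A \<Longrightarrow> abelian_group (ring_bimod A l r)"
  by (rule abelian_group_cong) (simp_all add: ring_bimod_def)

lemma finsum_ring_bimod: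
  assumes "abelian_group A" "f \<in> I \<rightarrow> carrier A"
  shows "finsum (ring_bimod A l r) f I = finsum A f I"
  using assms by (intro finsum_cong_add_monoid abelian_group_ring_bimod) (simp_all add: ring_bimod_def)

lemma hom_bimod_simps [simp]:
  "carrier (hom_bimod K M N l r) = lin_hom K M N"
  "\<zero>\<^bsub>hom_bimod K M N l r\<^esub> = (\<lambda>x\<in>carrier M. \<zero>\<^bsub>N\<^esub>)"
  "f \<oplus>\<^bsub>hom_bimod K M N l r\<^esub> g = (\<lambda>x\<in>carrier M. f x \<oplus>\<^bsub>N\<^esub> g x)"
  "k \<odot>\<^bsub>hom_bimod K M N l r\<^esub> f = l k f"
  "rsmult (hom_bimod K M N l r) f s = r f s"
  by (simp_all add: hom_bimod_def)

lemma abelian_group_hom_bimod: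
  assumes M: "abelian_group M" and N: "abelian_group N"
    and "\<And>k x. k \<in> carrier K \<Longrightarrow> x \<in> carrier M \<Longrightarrow> k \<odot>\<^bsub>M\<^esub> x \<in> carrier M"
    and sm: "\<And>k. k \<in> carrier K \<Longrightarrow> additive_map N N (\<lambda>x. k \<odot>\<^bsub>N\<^esub> x)"
  shows "abelian_group (hom_bimod K M N l r)"
proof -
  interpret M: abelian_group M by fact
  interpret N: abelian_group N by fact
  have ac: "a \<oplus>\<^bsub>N\<^esub> b \<oplus>\<^bsub>N\<^esub> (c \<oplus>\<^bsub>N\<^esub> d) = a \<oplus>\<^bsub>N\<^esub> c \<oplus>\<^bsub>N\<^esub> (b \<oplus>\<^bsub>N\<^esub> d)"
    if "a \<in> carrier N" "b \<in> carrier N" "c \<in> carrier N" "d \<in> carrier N" for a b c d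
    using that by (simp add: N.a_ac)
  have sm_closed: "k \<odot>\<^bsub>N\<^esub> x \<in> carrier N" if "k \<in> carrier K" "x \<in> carrier N" for k x
    using sm[OF that(1)] that by (simp add: additive_map_def)
  have sm_add: "k \<odot>\<^bsub>N\<^esub> (x \<oplus>\<^bsub>N\<^esub> y) = k \<odot>\<^bsub>N\<^esub> x \<oplus>\<^bsub>N\<^esub> k \<odot>\<^bsub>N\<^esub> y"
    if "k \<in> carrier K" "x \<in> carrier N" "y \<in> carrier N" for k x y
    using sm[OF that(1)] that by (simp add: additive_map_def)
  note sm' = sm_closed sm_add additive_zero[OF N N sm] additive_neg[OF N N sm]
  show ?thesis
  proof (rule abelian_groupI)
    fix f assume f: "f \<in> carrier (hom_bimod K M N l r)"
    then have "(\<lambda>x\<in>carrier M. \<ominus>\<^bsub>N\<^esub> f x) \<in> carrier (hom_bimod K M N l r)"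
      using assms(3) by (auto simp: lin_hom_iff PiE_iff N.minus_add sm')
    then show "\<exists>g\<in>carrier (hom_bimod K M N l r). g \<oplus>\<^bsub>hom_bimod K M N l r\<^esub> f = \<zero>\<^bsub>hom_bimod K M N l r\<^esub>"
      using f by (intro bexI[of _ "\<lambda>x\<in>carrier M. \<ominus>\<^bsub>N\<^esub> f x"])
        (auto simp: lin_hom_iff PiE_iff N.l_neg intro!: restrict_ext)
  next
    show "f \<oplus>\<^bsub>hom_bimod K M N l r\<^esub> g \<in> carrier (hom_bimod K M N l r)"
      if "f \<in> carrier (hom_bimod K M N l r)" "g \<in> carrier (hom_bimod K M N l r)" for f g
      using that assms(3) by (auto simp: lin_hom_iff PiE_iff sm' ac)
    show "\<zero>\<^bsub>hom_bimod K M N l r\<^esub> \<in> carrier (hom_bimod K M N l r)"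
      using assms(3) by (auto simp: lin_hom_iff sm')
    show "\<zero>\<^bsub>hom_bimod K M N l r\<^esub> \<oplus>\<^bsub>hom_bimod K M N l r\<^esub> f = f"
      if "f \<in> carrier (hom_bimod K M N l r)" for f
      using that by (intro extensionalityI[of _ "carrier M"]) (auto simp: lin_hom_iff PiE_iff)
  qed (auto simp: lin_hom_iff PiE_iff N.a_assoc intro!: restrict_ext N.a_comm)
qed

locale ring_ext = A: ring A + B: ring B + h: ring_hom_ring B A h
  for A :: "('a, 'm) ring_scheme" and B :: "('b, 'n) ring_scheme" and h :: "'b \<Rightarrow> 'a"
begin

lemma bimodule_A_AB: "bimodule A B (A_AB A h)"
  unfolding A_AB_def
  by (intro bimoduleI A.ring_axioms B.ring_axioms abelian_group_ring_bimod A.is_abelian_group)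
    (auto simp: A.l_distr A.r_distr A.m_assoc)

lemma bimodule_A_BA: "bimodule B A (A_BA A h)"
  unfolding A_BA_def
  by (intro bimoduleI A.ring_axioms B.ring_axioms abelian_group_ring_bimod A.is_abelian_group)
    (auto simp: A.l_distr A.r_distr A.m_assoc)

section \<open>Endomorphisms of the left module\<close>

abbreviation LE where "LE \<equiv> left_End_AA A B h"

lemma carrier_LE: "f \<in> carrier LE \<longleftrightarrow> f \<in> carrier A \<rightarrow>\<^sub>E carrier A \<and> additive_map A A f \<and>
    (\<forall>b\<in>carrier B. \<forall>a\<in>carrier A. f (h b \<otimes>\<^bsub>A\<^esub> a) = h b \<otimes>\<^bsub>A\<^esub> f a)"
  by (auto simp: left_End_AA_def lin_hom_iff A_BA_def additive_map_def)

lemma carrier_LED: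
  assumes "f \<in> carrier LE"
  shows "a \<in> carrier A \<Longrightarrow> f a \<in> carrier A" "additive_map A A f"
    "a \<in> carrier A \<Longrightarrow> b \<in> carrier B \<Longrightarrow> f (h b \<otimes>\<^bsub>A\<^esub> a) = h b \<otimes>\<^bsub>A\<^esub> f a"
    "a \<in> carrier A \<Longrightarrow> a' \<in> carrier A \<Longrightarrow> f (a \<oplus>\<^bsub>A\<^esub> a') = f a \<oplus>\<^bsub>A\<^esub> f a'"
  using assms by (auto simp: carrier_LE additive_map_def)

lemma LE_simps:
  "f \<oplus>\<^bsub>LE\<^esub> g = (\<lambda>a\<in>carrier A. f a \<oplus>\<^bsub>A\<^esub> g a)"
  "x \<odot>\<^bsub>LE\<^esub> f = (\<lambda>a\<in>carrier A. f (a \<otimes>\<^bsub>A\<^esub> x))"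
  "rsmult LE f y = (\<lambda>a\<in>carrier A. f a \<otimes>\<^bsub>A\<^esub> y)"
  by (simp_all add: left_End_AA_def A_BA_def restrict_def)

lemma bimodule_LE: "bimodule A A LE"
proof (rule bimoduleI)
  show "abelian_group LE"
    unfolding left_End_AA_def A_BA_def
    by (intro abelian_group_hom_bimod abelian_group_ring_bimod A.is_abelian_group)
      (auto simp: additive_map_def A.r_distr)
qed (auto simp: carrier_LE LE_simps additive_map_def PiE_iff A.r_distr A.l_distr A.m_assoc A.ring_axioms
    intro!: restrict_ext intro: extensionalityI[of _ "carrier A"])

lemma finsum_LE_apply:
  assumes "a \<in> carrier A" "F \<in> I \<rightarrow> carrier LE"
  shows "(\<Oplus>\<^bsub>LE\<^esub>i\<in>I. F i) a = (\<Oplus>\<^bsub>A\<^esub>i\<in>I. F i a)"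
  using assms bimodule.abelian_group_axioms[OF bimodule_LE] A.is_abelian_group
  by (intro additive_map_finsum[where f = "\<lambda>f. f a"]) (auto simp: additive_map_def carrier_LE LE_simps)

text \<open>The \<open>E\<close>- and \<open>A\<close>-actions on the left of \<open>End A\<^sub>B\<close> are both instances of the action of a
  ring \<open>K\<close> for which \<open>A\<close> is a \<open>(K,B)\<close>-bimodule.\<close>

definition RE :: "('k \<Rightarrow> 'a \<Rightarrow> 'a) \<Rightarrow> ('k, 'a, 'a \<Rightarrow> 'a) bimodule" where
  "RE l = hom_bimod B (right_part (A_AB A h)) (right_part (A_AB A h))
     (\<lambda>k f. \<lambda>a\<in>carrier A. l k (f a)) (\<lambda>f y. \<lambda>a\<in>carrier A. f (y \<otimes>\<^bsub>A\<^esub> a))"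

definition A_KB :: "('k \<Rightarrow> 'a \<Rightarrow> 'a) \<Rightarrow> ('k, 'b, 'a) bimodule" where
  "A_KB l = ring_bimod A l (\<lambda>a b. a \<otimes>\<^bsub>A\<^esub> h b)"

lemma A_KB_simps [simp]:
  "carrier (A_KB l) = carrier A" "\<zero>\<^bsub>A_KB l\<^esub> = \<zero>\<^bsub>A\<^esub>"
  "x \<oplus>\<^bsub>A_KB l\<^esub> y = x \<oplus>\<^bsub>A\<^esub> y" "k \<odot>\<^bsub>A_KB l\<^esub> x = l k x"
  "rsmult (A_KB l) x s = x \<otimes>\<^bsub>A\<^esub> h s"
  by (simp_all add: A_KB_def)

lemma A_BA_simps [simp]:
  "carrier (A_BA A h) = carrier A" "\<zero>\<^bsub>A_BA A h\<^esub> = \<zero>\<^bsub>A\<^esub>"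
  "x \<oplus>\<^bsub>A_BA A h\<^esub> y = x \<oplus>\<^bsub>A\<^esub> y" "b \<odot>\<^bsub>A_BA A h\<^esub> x = h b \<otimes>\<^bsub>A\<^esub> x"
  "rsmult (A_BA A h) x y = x \<otimes>\<^bsub>A\<^esub> y"
  by (simp_all add: A_BA_def)

lemma A_AB_eq_A_KB: "A_AB A h = A_KB (\<otimes>\<^bsub>A\<^esub>)"
  by (simp add: A_AB_def A_KB_def)

lemma carrier_RE: "f \<in> carrier (RE l) \<longleftrightarrow> f \<in> carrier A \<rightarrow>\<^sub>E carrier A \<and> additive_map A A f \<and>
    (\<forall>b\<in>carrier B. \<forall>a\<in>carrier A. f (a \<otimes>\<^bsub>A\<^esub> h b) = f a \<otimes>\<^bsub>A\<^esub> h b)"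
  by (auto simp: RE_def lin_hom_iff A_AB_def additive_map_def)

lemma carrier_RED:
  assumes "f \<in> carrier (RE l)"
  shows "a \<in> carrier A \<Longrightarrow> f a \<in> carrier A" "additive_map A A f"
    "a \<in> carrier A \<Longrightarrow> b \<in> carrier B \<Longrightarrow> f (a \<otimes>\<^bsub>A\<^esub> h b) = f a \<otimes>\<^bsub>A\<^esub> h b"
    "a \<in> carrier A \<Longrightarrow> a' \<in> carrier A \<Longrightarrow> f (a \<oplus>\<^bsub>A\<^esub> a') = f a \<oplus>\<^bsub>A\<^esub> f a'"
  using assms by (auto simp: carrier_RE additive_map_def)

lemma RE_simps:
  "f \<oplus>\<^bsub>RE l\<^esub> g = (\<lambda>a\<in>carrier A. f a \<oplus>\<^bsub>A\<^esub> g a)"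
  "k \<odot>\<^bsub>RE l\<^esub> f = (\<lambda>a\<in>carrier A. l k (f a))"
  "rsmult (RE l) f y = (\<lambda>a\<in>carrier A. f (y \<otimes>\<^bsub>A\<^esub> a))"
  by (simp_all add: RE_def A_AB_def restrict_def)

lemma abelian_group_RE: "abelian_group (RE l)"
  unfolding RE_def A_AB_def
  by (intro abelian_group_hom_bimod abelian_group_cong[OF A.is_abelian_group])
    (auto simp: additive_map_def A.l_distr ring_bimod_def right_part_def)

lemma finsum_RE_apply:
  assumes "a \<in> carrier A" "F \<in> I \<rightarrow> carrier (RE l)"
  shows "(\<Oplus>\<^bsub>RE l\<^esub>i\<in>I. F i) a = (\<Oplus>\<^bsub>A\<^esub>i\<in>I. F i a)"
  using assms abelian_group_RE A.is_abelian_group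
  by (intro additive_map_finsum[where f = "\<lambda>f. f a"]) (auto simp: additive_map_def carrier_RE RE_simps)

text \<open>A scalar k keeps F right B-linear because the actions of K and B on A commute. The laws
  of the left action are inherited pointwise from \<open>A_KB l\<close>.\<close>

lemma bimodule_RE:
  assumes "bimodule K B (A_KB l)"
  shows "bimodule K A (RE l)"
proof -
  interpret K: bimodule K B "A_KB l" by fact
  have *: "f (y \<otimes>\<^bsub>A\<^esub> (a \<otimes>\<^bsub>A\<^esub> h b)) = f (y \<otimes>\<^bsub>A\<^esub> a) \<otimes>\<^bsub>A\<^esub> h b"
    if "\<forall>b\<in>carrier B. \<forall>a\<in>carrier A. f (a \<otimes>\<^bsub>A\<^esub> h b) = f a \<otimes>\<^bsub>A\<^esub> h b"
      "y \<in> carrier A" "a \<in> carrier A" "b \<in> carrier B" for f y a b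
    using that by (simp add: A.m_assoc[symmetric])
  show ?thesis
    using K.smult_simps[simplified] K.smult_closed'[simplified] K.smult_rsmult[simplified]
    by (intro bimoduleI abelian_group_RE A.ring_axioms K.left.R.ring_axioms)
     (auto simp: carrier_RE RE_simps additive_map_def PiE_iff * A.r_distr A.l_distr A.m_assoc
      intro!: restrict_ext intro: extensionalityI[of _ "carrier A"])
qed

section \<open>The ring of right endomorphisms and its action on A\<close>

lemma carrier_right_End_ring: "f \<in> carrier (right_End_ring A B h) \<longleftrightarrow>
    f \<in> carrier A \<rightarrow>\<^sub>E carrier A \<and> additive_map A A f \<and>
    (\<forall>b\<in>carrier B. \<forall>a\<in>carrier A. f (a \<otimes>\<^bsub>A\<^esub> h b) = f a \<otimes>\<^bsub>A\<^esub> h b)"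
  by (auto simp: right_End_ring_def lin_hom_iff A_AB_def additive_map_def)

lemma right_End_ring_simps:
  "f \<oplus>\<^bsub>right_End_ring A B h\<^esub> g = (\<lambda>a\<in>carrier A. f a \<oplus>\<^bsub>A\<^esub> g a)"
  "f \<otimes>\<^bsub>right_End_ring A B h\<^esub> g = compose (carrier A) f g"
  "\<one>\<^bsub>right_End_ring A B h\<^esub> = (\<lambda>a\<in>carrier A. a)"
  by (simp_all add: right_End_ring_def restrict_def)

lemma ring_right_End_ring: "ring (right_End_ring A B h)"
proof (rule ringI)
  \<comment> \<open>The additive group of \<open>RE l\<close> is the same for every
    \<open>l\<close>, so an arbitrary value may be inserted.\<close>
  show "abelian_group (right_End_ring A B h)"
    by (rule abelian_group_cong[OF abelian_group_RE[where l = undefined]])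
      (simp_all add: right_End_ring_def RE_def A_AB_def hom_bimod_def right_part_def ring_bimod_def)
  show "monoid (right_End_ring A B h)"
    by (rule monoidI)
      (auto simp: right_End_ring_simps carrier_right_End_ring compose_def additive_map_def PiE_iff
        intro!: restrict_ext intro: extensionalityI[of _ "carrier A"])
qed (auto simp: right_End_ring_simps carrier_right_End_ring RE_simps compose_def additive_map_def PiE_iff
        intro!: restrict_ext)

lemma bimodule_A_EB: "bimodule (right_End_ring A B h) B (A_KB (\<lambda>f a. f a))"
proof (rule bimoduleI)
  show "abelian_group (A_KB (\<lambda>f a. f a))"
    unfolding A_KB_def by (intro abelian_group_ring_bimod A.is_abelian_group)
qed (auto simp: ring_right_End_ring B.ring_axioms right_End_ring_simps carrier_right_End_ring RE_simps
    compose_def additive_map_def A.l_distr A.r_distr A.m_assoc)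

lemma right_End_EA_eq: "right_End_EA A B h = RE (\<lambda>f a. f a)"
  by (simp add: right_End_EA_def RE_def compose_def)

lemma right_End_AA_eq: "right_End_AA A B h = RE (\<otimes>\<^bsub>A\<^esub>)"
  by (simp add: right_End_AA_def RE_def)

lemma A_EB_eq: "A_EB A h = A_KB (\<lambda>f a. f a)"
  by (simp add: A_EB_def A_KB_def)

end

section \<open>Casimir elements of a QF extension\<close>

context ring_ext
begin

abbreviation TK where "TK l \<equiv> tensor_bimod B (A_KB l) (A_BA A h)"
abbreviation tK where "tK l x y \<equiv> tens B (A_KB l) (A_BA A h) x y"

text \<open>A family of representatives is recorded instead of the element \<Sum> u_k \<otimes> v_k
  itself, because endomorphisms are later applied to single \<open>u k\<close> or
  \<open>v k\<close>. The equation says that a times this element equals the element times a, with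
  both actions written out on pure tensors.\<close>

definition casimir :: "'i set \<Rightarrow> ('i \<Rightarrow> 'a) \<Rightarrow> ('i \<Rightarrow> 'a) \<Rightarrow> bool" where
  "casimir I u v \<longleftrightarrow> finite I \<and> u \<in> I \<rightarrow> carrier A \<and> v \<in> I \<rightarrow> carrier A \<and>
     (\<forall>a\<in>carrier A. (\<Oplus>\<^bsub>TK (\<otimes>\<^bsub>A\<^esub>)\<^esub>k\<in>I. tK (\<otimes>\<^bsub>A\<^esub>) (a \<otimes>\<^bsub>A\<^esub> u k) (v k)) =
       (\<Oplus>\<^bsub>TK (\<otimes>\<^bsub>A\<^esub>)\<^esub>k\<in>I. tK (\<otimes>\<^bsub>A\<^esub>) (u k) (v k \<otimes>\<^bsub>A\<^esub> a)))"

definition bilin :: "('a \<Rightarrow> 'b) \<Rightarrow> bool" where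
  "bilin \<phi> \<longleftrightarrow> additive_map A B \<phi> \<and> (\<forall>b\<in>carrier B. \<forall>a\<in>carrier A.
     \<phi> (h b \<otimes>\<^bsub>A\<^esub> a) = b \<otimes>\<^bsub>B\<^esub> \<phi> a \<and> \<phi> (a \<otimes>\<^bsub>A\<^esub> h b) = \<phi> a \<otimes>\<^bsub>B\<^esub> b)"

lemma bilinD:
  assumes "bilin \<phi>"
  shows "a \<in> carrier A \<Longrightarrow> \<phi> a \<in> carrier B"
    "\<lbrakk>a \<in> carrier A; a' \<in> carrier A\<rbrakk> \<Longrightarrow> \<phi> (a \<oplus>\<^bsub>A\<^esub> a') = \<phi> a \<oplus>\<^bsub>B\<^esub> \<phi> a'"
    "\<lbrakk>b \<in> carrier B; a \<in> carrier A\<rbrakk> \<Longrightarrow> \<phi> (h b \<otimes>\<^bsub>A\<^esub> a) = b \<otimes>\<^bsub>B\<^esub> \<phi> a"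
    "\<lbrakk>b \<in> carrier B; a \<in> carrier A\<rbrakk> \<Longrightarrow> \<phi> (a \<otimes>\<^bsub>A\<^esub> h b) = \<phi> a \<otimes>\<^bsub>B\<^esub> b"
  using assms by (auto simp: bilin_def additive_map_def)

lemma bimodule_A_KB_mult: "bimodule A B (A_KB (\<otimes>\<^bsub>A\<^esub>))"
  using bimodule_A_AB by (simp add: A_AB_eq_A_KB)

lemma tensor_product_A_KB: "bimodule K B (A_KB l) \<Longrightarrow> tensor_product K B A (A_KB l) (A_BA A h)"
  by (intro tensor_product.intro bimodule_A_BA)

text \<open>The relations of the tensor product involve only the right action on the first factor,
  so a pure tensor is the same coset for every left action \<open>l\<close>, even over another
  ring.\<close>

lemma tK_eq: "tK l x y = tK l' x y"
  by (simp add: tens_def tensor_rels_def tensor_free_def)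

lemma casimirD:
  assumes "casimir I u v"
  shows "finite I" "k \<in> I \<Longrightarrow> u k \<in> carrier A" "k \<in> I \<Longrightarrow> v k \<in> carrier A"
  using assms by (auto simp: casimir_def)

text \<open>The Casimir property is stated for the left action of A. The tensor products for
  different \<open>l\<close> share their additive group and pure tensors, so the equation, which
  mentions neither left action, carries over; this is what makes it usable over E.\<close>

lemma casimir_commute:
  fixes l :: "'k \<Rightarrow> 'a \<Rightarrow> 'a"
  assumes K: "bimodule K B (A_KB l)" and c: "casimir I u v" and a: "a \<in> carrier A"
  shows "(\<Oplus>\<^bsub>TK l\<^esub>k\<in>I. tK l (a \<otimes>\<^bsub>A\<^esub> u k) (v k)) = (\<Oplus>\<^bsub>TK l\<^esub>k\<in>I. tK l (u k) (v k \<otimes>\<^bsub>A\<^esub> a))"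
proof -
  let ?m = "(\<otimes>\<^bsub>A\<^esub>)"
  interpret T: tensor_product K B A "A_KB l" "A_BA A h"
    by (rule tensor_product_A_KB[OF K])
  interpret T': tensor_product A B A "A_KB ?m" "A_BA A h"
    by (rule tensor_product_A_KB[OF bimodule_A_KB_mult])
  have eq: "finsum (TK l) f I = finsum (TK ?m) f I" if "f \<in> I \<rightarrow> carrier (TK ?m)" for f :: "_ \<Rightarrow> _"
    using that
    by (intro finsum_cong_add_monoid T.TP_abelian_group T'.TP_abelian_group)
      (simp_all add: tensor_bimod_def tensor_rels_def tensor_free_def)
  have t: "tK ?m x y \<in> carrier (TK ?m)" if "x \<in> carrier A" "y \<in> carrier A" for x y
    using that T'.tens_closed[of x y] by simp
  note uv = casimirD[OF c]
  have "(\<Oplus>\<^bsub>TK l\<^esub>k\<in>I. tK l (a \<otimes>\<^bsub>A\<^esub> u k) (v k)) = (\<Oplus>\<^bsub>TK ?m\<^esub>k\<in>I. tK ?m (a \<otimes>\<^bsub>A\<^esub> u k) (v k))"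
    unfolding tK_eq[of l _ _ ?m] using uv a t by (intro eq) auto
  also have "\<dots> = (\<Oplus>\<^bsub>TK ?m\<^esub>k\<in>I. tK ?m (u k) (v k \<otimes>\<^bsub>A\<^esub> a))"
    using c a by (simp add: casimir_def)
  also have "\<dots> = (\<Oplus>\<^bsub>TK l\<^esub>k\<in>I. tK l (u k) (v k \<otimes>\<^bsub>A\<^esub> a))"
    unfolding tK_eq[of l _ _ ?m] using uv a t by (intro eq[symmetric]) auto
  finally show ?thesis .
qed

text \<open>With f_i and g_i from divisibility and a dual basis y, \<psi>_y, take \<phi>_i = f_i(1)
  and z_i(y) = g_i(\<psi>_y). The Casimir property is the chain a \<Sum> y \<otimes> z(y) = \<Sum> w
  \<psi>_w(a y) \<otimes> z(y) = \<Sum> w \<otimes> g(\<psi>_w a) = \<Sum> w \<otimes> z(w) a, and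
  the reproducing formula is \<Sum> g_i(f_i(a)) = a.\<close>

lemma right_QF_casimir:
  assumes "right_QF A B h"
  obtains n :: nat and G \<phi> z where "\<And>i. i < n \<Longrightarrow> bilin (\<phi> i)" "\<And>i. i < n \<Longrightarrow> casimir G (\<lambda>y. y) (z i)"
    "\<And>a. a \<in> carrier A \<Longrightarrow> (\<Oplus>\<^bsub>A\<^esub>i\<in>{..<n}. \<Oplus>\<^bsub>A\<^esub>y\<in>G. h (\<phi> i (a \<otimes>\<^bsub>A\<^esub> y)) \<otimes>\<^bsub>A\<^esub> z i y) = a"
proof -
  let ?m = "(\<otimes>\<^bsub>A\<^esub>)"
  interpret T: tensor_product A B A "A_KB ?m" "A_BA A h"
    by (rule tensor_product_A_KB[OF bimodule_A_KB_mult])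
  define D where "D = right_dual_BA A B h"
  have fgp: "fg_projective (op_ring B) (right_part (A_KB ?m))"
    and div: "bimod_divides B A (A_BA A h) D"
    using assms by (auto simp: right_QF_def A_AB_eq_A_KB D_def)
  have D: "bimodule B A D" using div by (simp add: bimod_divides_def)
  interpret D: bimodule B A D by fact
  have carrier_D: "f \<in> carrier D \<longleftrightarrow> f \<in> carrier A \<rightarrow>\<^sub>E carrier B \<and> additive_map A B f \<and>
      (\<forall>b\<in>carrier B. \<forall>a\<in>carrier A. f (a \<otimes>\<^bsub>A\<^esub> h b) = f a \<otimes>\<^bsub>B\<^esub> b)" for f
    by (auto simp: D_def right_dual_BA_def lin_hom_iff A_AB_eq_A_KB additive_map_def reg_bimod_def)
  have D_ops: "f \<oplus>\<^bsub>D\<^esub> g = (\<lambda>x\<in>carrier A. f x \<oplus>\<^bsub>B\<^esub> g x)"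
    "b \<odot>\<^bsub>D\<^esub> f = (\<lambda>x\<in>carrier A. b \<otimes>\<^bsub>B\<^esub> f x)"
    "rsmult D f a = (\<lambda>x\<in>carrier A. f (a \<otimes>\<^bsub>A\<^esub> x))" for f g b a
    by (simp_all add: D_def right_dual_BA_def A_AB_eq_A_KB reg_bimod_def restrict_def)
  obtain G \<psi> where G: "finite G" "G \<subseteq> carrier (right_part (A_KB ?m))"
    and \<psi>0: "\<And>y. y \<in> G \<Longrightarrow> \<psi> y \<in> lin_hom (op_ring B) (right_part (A_KB ?m)) (reg_bimod (op_ring B))"
    and basis0: "\<And>x. x \<in> carrier (right_part (A_KB ?m)) \<Longrightarrow>
      (\<Oplus>\<^bsub>right_part (A_KB ?m)\<^esub>y\<in>G. \<psi> y x \<odot>\<^bsub>right_part (A_KB ?m)\<^esub> y) = x"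
    using fg_projective_dual_basis[OF fgp] by blast
  have Gc: "y \<in> carrier A" if "y \<in> G" for y using G that by auto
  \<comment> \<open>Left multiplication in \<open>op_ring B\<close> is right multiplication in
    \<open>B\<close>, so the coordinate functionals of the right module lie in the right
    dual.\<close>
  have \<psi>: "\<psi> y \<in> carrier D" if "y \<in> G" for y
    using \<psi>0[OF that] unfolding carrier_D
    by (auto simp: lin_hom_iff reg_bimod_def additive_map_def)
  have \<psi>_closed: "\<psi> y x \<in> carrier B" if "y \<in> G" "x \<in> carrier A" for y x
    using \<psi>[OF that(1)] that by (auto simp: carrier_D)
  have basis: "(\<Oplus>\<^bsub>A\<^esub>y\<in>G. y \<otimes>\<^bsub>A\<^esub> h (\<psi> y x)) = x" if x: "x \<in> carrier A" for x
  proof -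
    have "(\<Oplus>\<^bsub>right_part (A_KB ?m)\<^esub>y\<in>G. y \<otimes>\<^bsub>A\<^esub> h (\<psi> y x)) = (\<Oplus>\<^bsub>A\<^esub>y\<in>G. y \<otimes>\<^bsub>A\<^esub> h (\<psi> y x))"
      using Gc \<psi>_closed x
      by (intro finsum_cong_add_monoid A.is_abelian_group abelian_group_cong[OF A.is_abelian_group])
        (auto simp: right_part_def A_KB_def ring_bimod_def)
    then show ?thesis using basis0[of x] x by simp
  qed
  obtain n :: nat and f g where f: "\<And>i. i < n \<Longrightarrow> f i \<in> bimod_hom B A (A_BA A h) D"
    and g: "\<And>i. i < n \<Longrightarrow> g i \<in> bimod_hom B A D (A_BA A h)"
    and fg: "\<And>x. x \<in> carrier (A_BA A h) \<Longrightarrow> (\<Oplus>\<^bsub>A_BA A h\<^esub>i\<in>{..<n}. g i (f i x)) = x"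
    by (rule bimod_dividesE[OF div]) blast
  note fD = bimod_homD[OF f, simplified] and gD = bimod_homD[OF g, simplified]
  \<comment> \<open>The dual basis expands functionals as well: \<chi>(x) = \<chi>(\<Sum> y
    \<psi>_y(x)) gives \<chi> = \<Sum> \<chi>(y) \<psi>_y. By left B-linearity \<open>g i\<close> is
    then known from its values at the \<psi>_y.\<close>
  have g_expand: "g i \<chi> = (\<Oplus>\<^bsub>A\<^esub>y\<in>G. h (\<chi> y) \<otimes>\<^bsub>A\<^esub> g i (\<psi> y))" if i: "i < n" and \<chi>: "\<chi> \<in> carrier D" for i \<chi>
  proof -
    have \<chi>': "additive_map A B \<chi>" "\<And>a b. a \<in> carrier A \<Longrightarrow> b \<in> carrier B \<Longrightarrow> \<chi> (a \<otimes>\<^bsub>A\<^esub> h b) = \<chi> a \<otimes>\<^bsub>B\<^esub> b"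
      "\<And>a. a \<in> carrier A \<Longrightarrow> \<chi> a \<in> carrier B"
      using \<chi> by (auto simp: carrier_D)
    have in_D: "(\<lambda>y. \<chi> y \<odot>\<^bsub>D\<^esub> \<psi> y) \<in> G \<rightarrow> carrier D"
      using \<psi> \<chi>' Gc by auto
    have "(\<Oplus>\<^bsub>D\<^esub>y\<in>G. \<chi> y \<odot>\<^bsub>D\<^esub> \<psi> y) = \<chi>"
    proof (rule extensionalityI[of _ "carrier A"])
      have "(\<Oplus>\<^bsub>D\<^esub>y\<in>G. \<chi> y \<odot>\<^bsub>D\<^esub> \<psi> y) \<in> carrier D"
        using in_D by (rule D.left.M.finsum_closed)
      then show "(\<Oplus>\<^bsub>D\<^esub>y\<in>G. \<chi> y \<odot>\<^bsub>D\<^esub> \<psi> y) \<in> extensional (carrier A)"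
        by (auto simp: carrier_D PiE_iff)
      show "\<chi> \<in> extensional (carrier A)" using \<chi> by (auto simp: carrier_D PiE_iff)
      fix x assume x: "x \<in> carrier A"
      have "(\<Oplus>\<^bsub>D\<^esub>y\<in>G. \<chi> y \<odot>\<^bsub>D\<^esub> \<psi> y) x = (\<Oplus>\<^bsub>B\<^esub>y\<in>G. (\<chi> y \<odot>\<^bsub>D\<^esub> \<psi> y) x)"
        using x in_D by (intro additive_map_finsum[where f = "\<lambda>f. f x"] D.abelian_group_axioms B.is_abelian_group)
          (auto simp: additive_map_def carrier_D D_ops)
      also have "\<dots> = (\<Oplus>\<^bsub>B\<^esub>y\<in>G. \<chi> (y \<otimes>\<^bsub>A\<^esub> h (\<psi> y x)))"
        using x Gc \<psi>_closed \<chi>' by (intro B.finsum_cong') (auto simp: D_ops)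
      also have "\<dots> = \<chi> (\<Oplus>\<^bsub>A\<^esub>y\<in>G. y \<otimes>\<^bsub>A\<^esub> h (\<psi> y x))"
        using x Gc \<psi>_closed
        by (subst additive_map_finsum[OF A.is_abelian_group B.is_abelian_group \<chi>'(1)]) auto
      finally show "(\<Oplus>\<^bsub>D\<^esub>y\<in>G. \<chi> y \<odot>\<^bsub>D\<^esub> \<psi> y) x = \<chi> x"
        by (simp add: basis[OF x])
    qed
    then have "g i \<chi> = g i (\<Oplus>\<^bsub>D\<^esub>y\<in>G. \<chi> y \<odot>\<^bsub>D\<^esub> \<psi> y)" by simp
    also have "\<dots> = (\<Oplus>\<^bsub>A_BA A h\<^esub>y\<in>G. g i (\<chi> y \<odot>\<^bsub>D\<^esub> \<psi> y))"
      using in_D by (rule additive_map_finsum[OF D.abelian_group_axioms T.N.abelian_group_axioms bimod_hom_additive[OF g[OF i]]])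
    also have "\<dots> = (\<Oplus>\<^bsub>A\<^esub>y\<in>G. g i (\<chi> y \<odot>\<^bsub>D\<^esub> \<psi> y))"
      unfolding A_BA_def using in_D gD(1)[OF i] by (intro finsum_ring_bimod A.is_abelian_group) auto
    also have "\<dots> = (\<Oplus>\<^bsub>A\<^esub>y\<in>G. h (\<chi> y) \<otimes>\<^bsub>A\<^esub> g i (\<psi> y))"
      using gD(1,3)[OF i] \<psi> \<chi>' Gc by (intro A.finsum_cong') auto
    finally show ?thesis .
  qed
  define \<phi> where "\<phi> i = f i \<one>\<^bsub>A\<^esub>" for i
  define z where "z i y = g i (\<psi> y)" for i y
  have \<phi>_D: "\<phi> i \<in> carrier D" if "i < n" for i
    using fD(1)[OF that] by (simp add: \<phi>_def)
  \<comment> \<open>Right A-linearity determines \<open>f i\<close> by its value at 1.\<close>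
  have f_eq: "f i a = (\<lambda>x\<in>carrier A. \<phi> i (a \<otimes>\<^bsub>A\<^esub> x))" if "i < n" "a \<in> carrier A" for i a
    using fD(4)[OF that(1), of a "\<one>\<^bsub>A\<^esub>"] that by (simp add: \<phi>_def D_ops)
  have z_closed: "z i y \<in> carrier A" if "i < n" "y \<in> G" for i y
    using gD(1) \<psi> that by (simp add: z_def)
  show thesis
  proof (rule that[of n \<phi> G z])
    fix i assume i: "i < n"
    \<comment> \<open>Right linearity is membership in the right dual. Left linearity comes from
      computing \<open>f i (h b)\<close> twice: as b acting on \<open>f i\<close> of 1, and as
      \<open>f i\<close> of 1 acted on by \<open>h b\<close>.\<close>
    have "\<phi> i (h b \<otimes>\<^bsub>A\<^esub> a) = b \<otimes>\<^bsub>B\<^esub> \<phi> i a" if "b \<in> carrier B" "a \<in> carrier A" for a b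
    proof -
      have "f i (h b) = b \<odot>\<^bsub>D\<^esub> \<phi> i"
        using fD(3)[OF i that(1), of "\<one>\<^bsub>A\<^esub>"] that by (simp add: \<phi>_def)
      then have "(\<lambda>x\<in>carrier A. \<phi> i (h b \<otimes>\<^bsub>A\<^esub> x)) = (\<lambda>x\<in>carrier A. b \<otimes>\<^bsub>B\<^esub> \<phi> i x)"
        using f_eq[OF i, of "h b"] that by (simp add: D_ops)
      from fun_cong[OF this, of a] show ?thesis using that by simp
    qed
    then show "bilin (\<phi> i)"
      using \<phi>_D[OF i] by (auto simp: bilin_def carrier_D)
    show "casimir G (\<lambda>y. y) (z i)"
      unfolding casimir_def
    proof (intro conjI ballI)
      fix a assume a: "a \<in> carrier A"
      let ?t = "tK ?m"
      have t: "?t x y \<in> carrier (TK ?m)" if "x \<in> carrier A" "y \<in> carrier A" for x y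
        using that T.tens_closed[of x y] by simp
      \<comment> \<open>Expand a y in the dual basis as \<Sum> w \<psi>_w(a y) and move the
        coefficients, which lie in B, across the tensor sign.\<close>
      have "?t (a \<otimes>\<^bsub>A\<^esub> y) (z i y) = (\<Oplus>\<^bsub>TK ?m\<^esub>w\<in>G. ?t w (h (\<psi> w (a \<otimes>\<^bsub>A\<^esub> y)) \<otimes>\<^bsub>A\<^esub> z i y))"
        if y: "y \<in> G" for y
      proof -
        have fc: "finsum (A_KB ?m) F G = finsum A F G" if "F \<in> G \<rightarrow> carrier A" for F :: "'a \<Rightarrow> 'a"
          unfolding A_KB_def using that by (intro finsum_ring_bimod A.is_abelian_group) auto
        have "?t (a \<otimes>\<^bsub>A\<^esub> y) (z i y) = ?t (\<Oplus>\<^bsub>A_KB ?m\<^esub>w\<in>G. w \<otimes>\<^bsub>A\<^esub> h (\<psi> w (a \<otimes>\<^bsub>A\<^esub> y))) (z i y)"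
          using y a Gc \<psi>_closed by (subst fc) (auto simp: basis)
        also have "\<dots> = (\<Oplus>\<^bsub>TK ?m\<^esub>w\<in>G. ?t (w \<otimes>\<^bsub>A\<^esub> h (\<psi> w (a \<otimes>\<^bsub>A\<^esub> y))) (z i y))"
          using y a Gc \<psi>_closed z_closed[OF i] by (intro T.tens_finsum_left) auto
        also have "\<dots> = (\<Oplus>\<^bsub>TK ?m\<^esub>w\<in>G. ?t w (h (\<psi> w (a \<otimes>\<^bsub>A\<^esub> y)) \<otimes>\<^bsub>A\<^esub> z i y))"
          using y a Gc \<psi>_closed z_closed[OF i] T.tens_balanced t by (intro T.TP.finsum_cong') auto
        finally show ?thesis .
      qed
      then have "(\<Oplus>\<^bsub>TK ?m\<^esub>y\<in>G. ?t (a \<otimes>\<^bsub>A\<^esub> y) (z i y)) =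
          (\<Oplus>\<^bsub>TK ?m\<^esub>y\<in>G. \<Oplus>\<^bsub>TK ?m\<^esub>w\<in>G. ?t w (h (\<psi> w (a \<otimes>\<^bsub>A\<^esub> y)) \<otimes>\<^bsub>A\<^esub> z i y))"
        using a Gc \<psi>_closed z_closed[OF i] t by (intro T.TP.finsum_cong') auto
      also have "\<dots> = (\<Oplus>\<^bsub>TK ?m\<^esub>w\<in>G. \<Oplus>\<^bsub>TK ?m\<^esub>y\<in>G. ?t w (h (\<psi> w (a \<otimes>\<^bsub>A\<^esub> y)) \<otimes>\<^bsub>A\<^esub> z i y))"
        using a Gc \<psi>_closed z_closed[OF i] t G by (intro T.TP.finsum_swap) auto
      also have "\<dots> = (\<Oplus>\<^bsub>TK ?m\<^esub>w\<in>G. ?t w (z i w \<otimes>\<^bsub>A\<^esub> a))"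
      proof (intro T.TP.finsum_cong')
        fix w assume w: "w \<in> G"
        have fc: "finsum (A_BA A h) F G = finsum A F G" if "F \<in> G \<rightarrow> carrier A" for F :: "'a \<Rightarrow> 'a"
          unfolding A_BA_def using that by (intro finsum_ring_bimod A.is_abelian_group) auto
        have "(\<Oplus>\<^bsub>TK ?m\<^esub>y\<in>G. ?t w (h (\<psi> w (a \<otimes>\<^bsub>A\<^esub> y)) \<otimes>\<^bsub>A\<^esub> z i y)) =
            ?t w (\<Oplus>\<^bsub>A_BA A h\<^esub>y\<in>G. h (\<psi> w (a \<otimes>\<^bsub>A\<^esub> y)) \<otimes>\<^bsub>A\<^esub> z i y)"
          using w a Gc \<psi>_closed z_closed[OF i] by (intro T.tens_finsum_right[symmetric]) auto
        also have "(\<Oplus>\<^bsub>A_BA A h\<^esub>y\<in>G. h (\<psi> w (a \<otimes>\<^bsub>A\<^esub> y)) \<otimes>\<^bsub>A\<^esub> z i y) =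
            (\<Oplus>\<^bsub>A\<^esub>y\<in>G. h (\<psi> w (a \<otimes>\<^bsub>A\<^esub> y)) \<otimes>\<^bsub>A\<^esub> z i y)"
          using w a Gc \<psi>_closed z_closed[OF i] by (intro fc) auto
        \<comment> \<open>The coefficient \<psi>_w(a y) is the value at y of \<psi>_w acted on by a,
          so the sum is an instance of \<open>g_expand\<close>; right A-linearity of
          \<open>g i\<close> then releases a.\<close>
        also have "\<dots> = (\<Oplus>\<^bsub>A\<^esub>y\<in>G. h (rsmult D (\<psi> w) a y) \<otimes>\<^bsub>A\<^esub> g i (\<psi> y))"
          using w a Gc \<psi>_closed z_closed[OF i] by (intro A.finsum_cong') (auto simp: D_ops z_def)
        also have "\<dots> = g i (rsmult D (\<psi> w) a)"
          using w a \<psi> by (intro g_expand[OF i, symmetric]) auto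
        also have "\<dots> = z i w \<otimes>\<^bsub>A\<^esub> a"
          using gD(4)[OF i a] \<psi>[OF w] by (simp add: z_def)
        finally show "(\<Oplus>\<^bsub>TK ?m\<^esub>y\<in>G. ?t w (h (\<psi> w (a \<otimes>\<^bsub>A\<^esub> y)) \<otimes>\<^bsub>A\<^esub> z i y)) = ?t w (z i w \<otimes>\<^bsub>A\<^esub> a)" .
      qed (use a Gc z_closed[OF i] t in auto)
      finally show "(\<Oplus>\<^bsub>TK ?m\<^esub>y\<in>G. ?t (a \<otimes>\<^bsub>A\<^esub> y) (z i y)) = (\<Oplus>\<^bsub>TK ?m\<^esub>y\<in>G. ?t y (z i y \<otimes>\<^bsub>A\<^esub> a))" .
    qed (use G Gc z_closed[OF i] in auto)
  next
    fix a assume a: "a \<in> carrier A"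
    have "(\<Oplus>\<^bsub>A\<^esub>y\<in>G. h (\<phi> i (a \<otimes>\<^bsub>A\<^esub> y)) \<otimes>\<^bsub>A\<^esub> z i y) = g i (f i a)" if i: "i < n" for i
    proof -
      have "(\<Oplus>\<^bsub>A\<^esub>y\<in>G. h (\<phi> i (a \<otimes>\<^bsub>A\<^esub> y)) \<otimes>\<^bsub>A\<^esub> z i y) = (\<Oplus>\<^bsub>A\<^esub>y\<in>G. h (f i a y) \<otimes>\<^bsub>A\<^esub> g i (\<psi> y))"
        using \<phi>_D[OF i] a Gc z_closed[OF i]
        by (intro A.finsum_cong') (auto simp: f_eq[OF i a] z_def carrier_D PiE_iff)
      also have "\<dots> = g i (f i a)"
        using fD(1)[OF i a] by (rule g_expand[OF i, symmetric])
      finally show ?thesis .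
    qed
    then have "(\<Oplus>\<^bsub>A\<^esub>i\<in>{..<n}. \<Oplus>\<^bsub>A\<^esub>y\<in>G. h (\<phi> i (a \<otimes>\<^bsub>A\<^esub> y)) \<otimes>\<^bsub>A\<^esub> z i y) = (\<Oplus>\<^bsub>A\<^esub>i\<in>{..<n}. g i (f i a))"
      using gD(1) fD(1) a by (intro A.finsum_cong') auto
    also have "\<dots> = (\<Oplus>\<^bsub>A_BA A h\<^esub>i\<in>{..<n}. g i (f i a))"
      unfolding A_BA_def using gD(1) fD(1) a by (intro finsum_ring_bimod[symmetric] A.is_abelian_group) auto
    finally show "(\<Oplus>\<^bsub>A\<^esub>i\<in>{..<n}. \<Oplus>\<^bsub>A\<^esub>y\<in>G. h (\<phi> i (a \<otimes>\<^bsub>A\<^esub> y)) \<otimes>\<^bsub>A\<^esub> z i y) = a"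
      using fg[of a] a by simp
  qed
qed

text \<open>The dual basis now belongs to the left module: x = \<Sum> \<psi>_y(x) y, hence \<chi> =
  \<Sum> \<psi>_y \<chi>(y), and right B-linearity gives g(\<chi>) = \<Sum> g(\<psi>_y) \<chi>(y).
  The basis elements therefore occupy the second tensor factor, and it is left A-linearity of g that
  turns into the Casimir property.\<close>

lemma left_QF_casimir:
  assumes "left_QF A B h"
  obtains n :: nat and G \<phi> z where "\<And>i. i < n \<Longrightarrow> bilin (\<phi> i)" "\<And>i. i < n \<Longrightarrow> casimir G (z i) (\<lambda>y. y)"
    "\<And>a. a \<in> carrier A \<Longrightarrow> (\<Oplus>\<^bsub>A\<^esub>i\<in>{..<n}. \<Oplus>\<^bsub>A\<^esub>y\<in>G. z i y \<otimes>\<^bsub>A\<^esub> h (\<phi> i (y \<otimes>\<^bsub>A\<^esub> a))) = a"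
proof -
  let ?m = "(\<otimes>\<^bsub>A\<^esub>)"
  interpret T: tensor_product A B A "A_KB ?m" "A_BA A h"
    by (rule tensor_product_A_KB[OF bimodule_A_KB_mult])
  define D where "D = left_dual_AB A B h"
  have fgp: "fg_projective B (A_BA A h)"
    and div: "bimod_divides A B (A_KB ?m) D"
    using assms by (auto simp: left_QF_def A_AB_eq_A_KB D_def)
  have D: "bimodule A B D" using div by (simp add: bimod_divides_def)
  interpret D: bimodule A B D by fact
  have carrier_D: "f \<in> carrier D \<longleftrightarrow> f \<in> carrier A \<rightarrow>\<^sub>E carrier B \<and> additive_map A B f \<and>
      (\<forall>b\<in>carrier B. \<forall>a\<in>carrier A. f (h b \<otimes>\<^bsub>A\<^esub> a) = b \<otimes>\<^bsub>B\<^esub> f a)" for f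
    by (auto simp: D_def left_dual_AB_def lin_hom_iff additive_map_def reg_bimod_def)
  have D_ops: "f \<oplus>\<^bsub>D\<^esub> g = (\<lambda>x\<in>carrier A. f x \<oplus>\<^bsub>B\<^esub> g x)"
    "a \<odot>\<^bsub>D\<^esub> f = (\<lambda>x\<in>carrier A. f (x \<otimes>\<^bsub>A\<^esub> a))"
    "rsmult D f b = (\<lambda>x\<in>carrier A. f x \<otimes>\<^bsub>B\<^esub> b)" for f g b a
    by (simp_all add: D_def left_dual_AB_def reg_bimod_def restrict_def)
  obtain G \<psi> where G: "finite G" "G \<subseteq> carrier (A_BA A h)"
    and \<psi>0: "\<And>y. y \<in> G \<Longrightarrow> \<psi> y \<in> lin_hom B (A_BA A h) (reg_bimod B)"
    and basis0: "\<And>x. x \<in> carrier (A_BA A h) \<Longrightarrow>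
      (\<Oplus>\<^bsub>A_BA A h\<^esub>y\<in>G. \<psi> y x \<odot>\<^bsub>A_BA A h\<^esub> y) = x"
    using fg_projective_dual_basis[OF fgp] by blast
  have Gc: "y \<in> carrier A" if "y \<in> G" for y using G that by auto
  have \<psi>: "\<psi> y \<in> carrier D" if "y \<in> G" for y
    using \<psi>0[OF that] unfolding carrier_D
    by (auto simp: lin_hom_iff reg_bimod_def additive_map_def)
  have \<psi>_closed: "\<psi> y x \<in> carrier B" if "y \<in> G" "x \<in> carrier A" for y x
    using \<psi>[OF that(1)] that by (auto simp: carrier_D)
  have sum_A_BA: "finsum (A_BA A h) F I = finsum A F I" if "F \<in> I \<rightarrow> carrier A" for F I
    unfolding A_BA_def using that by (intro finsum_ring_bimod A.is_abelian_group)
  have sum_A_KB: "finsum (A_KB ?m) F I = finsum A F I" if "F \<in> I \<rightarrow> carrier A" for F I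
    unfolding A_KB_def using that by (intro finsum_ring_bimod A.is_abelian_group)
  have basis_closed: "(\<lambda>y. h (\<psi> y x) \<otimes>\<^bsub>A\<^esub> y) \<in> G \<rightarrow> carrier A" if x: "x \<in> carrier A" for x
    using Gc \<psi>_closed x by auto
  have basis': "(\<Oplus>\<^bsub>A_BA A h\<^esub>y\<in>G. h (\<psi> y x) \<otimes>\<^bsub>A\<^esub> y) = x" if x: "x \<in> carrier A" for x
    using basis0[of x] x by simp
  have basis: "(\<Oplus>\<^bsub>A\<^esub>y\<in>G. h (\<psi> y x) \<otimes>\<^bsub>A\<^esub> y) = x" if x: "x \<in> carrier A" for x
    using basis'[OF x] sum_A_BA[OF basis_closed[OF x]] by simp
  obtain n :: nat and f g where f: "\<And>i. i < n \<Longrightarrow> f i \<in> bimod_hom A B (A_KB ?m) D"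
    and g: "\<And>i. i < n \<Longrightarrow> g i \<in> bimod_hom A B D (A_KB ?m)"
    and fg: "\<And>x. x \<in> carrier (A_KB ?m) \<Longrightarrow> (\<Oplus>\<^bsub>A_KB ?m\<^esub>i\<in>{..<n}. g i (f i x)) = x"
    by (rule bimod_dividesE[OF div]) blast
  note fD = bimod_homD[OF f, simplified] and gD = bimod_homD[OF g, simplified]
  have g_expand: "g i \<chi> = (\<Oplus>\<^bsub>A\<^esub>y\<in>G. g i (\<psi> y) \<otimes>\<^bsub>A\<^esub> h (\<chi> y))" if i: "i < n" and \<chi>: "\<chi> \<in> carrier D" for i \<chi>
  proof -
    have \<chi>': "additive_map A B \<chi>" "\<And>a b. a \<in> carrier A \<Longrightarrow> b \<in> carrier B \<Longrightarrow> \<chi> (h b \<otimes>\<^bsub>A\<^esub> a) = b \<otimes>\<^bsub>B\<^esub> \<chi> a"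
      "\<And>a. a \<in> carrier A \<Longrightarrow> \<chi> a \<in> carrier B"
      using \<chi> by (auto simp: carrier_D)
    have in_D: "(\<lambda>y. rsmult D (\<psi> y) (\<chi> y)) \<in> G \<rightarrow> carrier D"
      using \<psi> \<chi>' Gc by auto
    have "(\<Oplus>\<^bsub>D\<^esub>y\<in>G. rsmult D (\<psi> y) (\<chi> y)) = \<chi>"
    proof (rule extensionalityI[of _ "carrier A"])
      have "(\<Oplus>\<^bsub>D\<^esub>y\<in>G. rsmult D (\<psi> y) (\<chi> y)) \<in> carrier D"
        using in_D by (rule D.left.M.finsum_closed)
      then show "(\<Oplus>\<^bsub>D\<^esub>y\<in>G. rsmult D (\<psi> y) (\<chi> y)) \<in> extensional (carrier A)"
        by (auto simp: carrier_D PiE_iff)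
      show "\<chi> \<in> extensional (carrier A)" using \<chi> by (auto simp: carrier_D PiE_iff)
      fix x assume x: "x \<in> carrier A"
      have "(\<Oplus>\<^bsub>D\<^esub>y\<in>G. rsmult D (\<psi> y) (\<chi> y)) x = (\<Oplus>\<^bsub>B\<^esub>y\<in>G. rsmult D (\<psi> y) (\<chi> y) x)"
        using x in_D by (intro additive_map_finsum[where f = "\<lambda>f. f x"] D.abelian_group_axioms B.is_abelian_group)
          (auto simp: additive_map_def carrier_D D_ops)
      also have "\<dots> = (\<Oplus>\<^bsub>B\<^esub>y\<in>G. \<chi> (h (\<psi> y x) \<otimes>\<^bsub>A\<^esub> y))"
        using x Gc \<psi>_closed \<chi>' by (intro B.finsum_cong') (auto simp: D_ops)
      also have "\<dots> = \<chi> (\<Oplus>\<^bsub>A\<^esub>y\<in>G. h (\<psi> y x) \<otimes>\<^bsub>A\<^esub> y)"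
        using basis_closed[OF x]
        by (subst additive_map_finsum[OF A.is_abelian_group B.is_abelian_group \<chi>'(1)]) auto
      finally show "(\<Oplus>\<^bsub>D\<^esub>y\<in>G. rsmult D (\<psi> y) (\<chi> y)) x = \<chi> x"
        by (simp add: basis[OF x])
    qed
    then have "g i \<chi> = g i (\<Oplus>\<^bsub>D\<^esub>y\<in>G. rsmult D (\<psi> y) (\<chi> y))" by simp
    also have "\<dots> = (\<Oplus>\<^bsub>A_KB ?m\<^esub>y\<in>G. g i (rsmult D (\<psi> y) (\<chi> y)))"
      using in_D by (rule additive_map_finsum[OF D.abelian_group_axioms T.M.abelian_group_axioms bimod_hom_additive[OF g[OF i]]])
    also have "\<dots> = (\<Oplus>\<^bsub>A\<^esub>y\<in>G. g i (rsmult D (\<psi> y) (\<chi> y)))"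
      using in_D gD(1)[OF i] by (intro sum_A_KB) auto
    also have "\<dots> = (\<Oplus>\<^bsub>A\<^esub>y\<in>G. g i (\<psi> y) \<otimes>\<^bsub>A\<^esub> h (\<chi> y))"
      using gD(1,4)[OF i] \<psi> \<chi>' Gc by (intro A.finsum_cong') auto
    finally show ?thesis .
  qed
  define \<phi> where "\<phi> i = f i \<one>\<^bsub>A\<^esub>" for i
  define z where "z i y = g i (\<psi> y)" for i y
  have \<phi>_D: "\<phi> i \<in> carrier D" if "i < n" for i
    using fD(1)[OF that] by (simp add: \<phi>_def)
  have f_eq: "f i a = (\<lambda>x\<in>carrier A. \<phi> i (x \<otimes>\<^bsub>A\<^esub> a))" if "i < n" "a \<in> carrier A" for i a
    using fD(3)[OF that(1), of a "\<one>\<^bsub>A\<^esub>"] that by (simp add: \<phi>_def D_ops)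
  have z_closed: "z i y \<in> carrier A" if "i < n" "y \<in> G" for i y
    using gD(1) \<psi> that by (simp add: z_def)
  show thesis
  proof (rule that[of n \<phi> G z])
    fix i assume i: "i < n"
    \<comment> \<open>Membership in the left dual gives left linearity only; the right one follows
      from the two expressions for \<open>f i (h b)\<close>, via the right B-action and via the left
      A-action on \<open>f i\<close> of 1.\<close>
    have "\<phi> i (a \<otimes>\<^bsub>A\<^esub> h b) = \<phi> i a \<otimes>\<^bsub>B\<^esub> b" if "b \<in> carrier B" "a \<in> carrier A" for a b
    proof -
      have "f i (h b) = rsmult D (\<phi> i) b"
        using fD(4)[OF i that(1), of "\<one>\<^bsub>A\<^esub>"] that by (simp add: \<phi>_def)
      then have "(\<lambda>x\<in>carrier A. \<phi> i (x \<otimes>\<^bsub>A\<^esub> h b)) = (\<lambda>x\<in>carrier A. \<phi> i x \<otimes>\<^bsub>B\<^esub> b)"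
        using f_eq[OF i, of "h b"] that by (simp add: D_ops)
      from fun_cong[OF this, of a] show ?thesis using that by simp
    qed
    then show "bilin (\<phi> i)"
      using \<phi>_D[OF i] by (auto simp: bilin_def carrier_D)
    show "casimir G (z i) (\<lambda>y. y)"
      unfolding casimir_def
    proof (intro conjI ballI)
      fix a assume a: "a \<in> carrier A"
      let ?t = "tK ?m"
      have t: "?t x y \<in> carrier (TK ?m)" if "x \<in> carrier A" "y \<in> carrier A" for x y
        using that T.tens_closed[of x y] by simp
      have \<psi>ya: "\<psi> w (y \<otimes>\<^bsub>A\<^esub> a) \<in> carrier B" if "w \<in> G" "y \<in> G" for w y
        using \<psi>_closed that a Gc by simp
      \<comment> \<open>This time the second factor y a is expanded in the dual basis, and the
        coefficients move to the left factor.\<close>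
      have "?t (z i y) (y \<otimes>\<^bsub>A\<^esub> a) = (\<Oplus>\<^bsub>TK ?m\<^esub>w\<in>G. ?t (z i y \<otimes>\<^bsub>A\<^esub> h (\<psi> w (y \<otimes>\<^bsub>A\<^esub> a))) w)"
        if y: "y \<in> G" for y
      proof -
        have "?t (z i y) (y \<otimes>\<^bsub>A\<^esub> a) = ?t (z i y) (\<Oplus>\<^bsub>A_BA A h\<^esub>w\<in>G. h (\<psi> w (y \<otimes>\<^bsub>A\<^esub> a)) \<otimes>\<^bsub>A\<^esub> w)"
          using y a Gc by (simp add: basis')
        also have "\<dots> = (\<Oplus>\<^bsub>TK ?m\<^esub>w\<in>G. ?t (z i y) (h (\<psi> w (y \<otimes>\<^bsub>A\<^esub> a)) \<otimes>\<^bsub>A\<^esub> w))"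
          using y a Gc \<psi>ya z_closed[OF i] by (intro T.tens_finsum_right) auto
        also have "\<dots> = (\<Oplus>\<^bsub>TK ?m\<^esub>w\<in>G. ?t (z i y \<otimes>\<^bsub>A\<^esub> h (\<psi> w (y \<otimes>\<^bsub>A\<^esub> a))) w)"
          using y a Gc \<psi>ya z_closed[OF i] T.tens_balanced t by (intro T.TP.finsum_cong') auto
        finally show ?thesis .
      qed
      then have "(\<Oplus>\<^bsub>TK ?m\<^esub>y\<in>G. ?t (z i y) (y \<otimes>\<^bsub>A\<^esub> a)) =
          (\<Oplus>\<^bsub>TK ?m\<^esub>y\<in>G. \<Oplus>\<^bsub>TK ?m\<^esub>w\<in>G. ?t (z i y \<otimes>\<^bsub>A\<^esub> h (\<psi> w (y \<otimes>\<^bsub>A\<^esub> a))) w)"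
        using a Gc \<psi>ya z_closed[OF i] t by (intro T.TP.finsum_cong') auto
      also have "\<dots> = (\<Oplus>\<^bsub>TK ?m\<^esub>w\<in>G. \<Oplus>\<^bsub>TK ?m\<^esub>y\<in>G. ?t (z i y \<otimes>\<^bsub>A\<^esub> h (\<psi> w (y \<otimes>\<^bsub>A\<^esub> a))) w)"
        using a Gc \<psi>ya z_closed[OF i] t G by (intro T.TP.finsum_swap) auto
      also have "\<dots> = (\<Oplus>\<^bsub>TK ?m\<^esub>w\<in>G. ?t (a \<otimes>\<^bsub>A\<^esub> z i w) w)"
      proof (intro T.TP.finsum_cong')
        fix w assume w: "w \<in> G"
        have "(\<Oplus>\<^bsub>TK ?m\<^esub>y\<in>G. ?t (z i y \<otimes>\<^bsub>A\<^esub> h (\<psi> w (y \<otimes>\<^bsub>A\<^esub> a))) w) =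
            ?t (\<Oplus>\<^bsub>A_KB ?m\<^esub>y\<in>G. z i y \<otimes>\<^bsub>A\<^esub> h (\<psi> w (y \<otimes>\<^bsub>A\<^esub> a))) w"
          using w a Gc \<psi>ya z_closed[OF i] by (intro T.tens_finsum_left[symmetric]) auto
        also have "(\<Oplus>\<^bsub>A_KB ?m\<^esub>y\<in>G. z i y \<otimes>\<^bsub>A\<^esub> h (\<psi> w (y \<otimes>\<^bsub>A\<^esub> a))) =
            (\<Oplus>\<^bsub>A\<^esub>y\<in>G. z i y \<otimes>\<^bsub>A\<^esub> h (\<psi> w (y \<otimes>\<^bsub>A\<^esub> a)))"
          using w a Gc \<psi>ya z_closed[OF i] by (intro sum_A_KB) auto
        \<comment> \<open>\<psi>_w(y a) is the value at y of a acting on \<psi>_w, which brings the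
          sum into the shape of \<open>g_expand\<close>.\<close>
        also have "\<dots> = (\<Oplus>\<^bsub>A\<^esub>y\<in>G. g i (\<psi> y) \<otimes>\<^bsub>A\<^esub> h ((a \<odot>\<^bsub>D\<^esub> \<psi> w) y))"
          using w a Gc \<psi>ya z_closed[OF i] by (intro A.finsum_cong') (auto simp: D_ops z_def)
        also have "\<dots> = g i (a \<odot>\<^bsub>D\<^esub> \<psi> w)"
          using w a \<psi> by (intro g_expand[OF i, symmetric]) auto
        also have "\<dots> = a \<otimes>\<^bsub>A\<^esub> z i w"
          using gD(3)[OF i a] \<psi>[OF w] by (simp add: z_def)
        finally show "(\<Oplus>\<^bsub>TK ?m\<^esub>y\<in>G. ?t (z i y \<otimes>\<^bsub>A\<^esub> h (\<psi> w (y \<otimes>\<^bsub>A\<^esub> a))) w) = ?t (a \<otimes>\<^bsub>A\<^esub> z i w) w" .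
      qed (use a Gc z_closed[OF i] t in auto)
      finally show "(\<Oplus>\<^bsub>TK ?m\<^esub>y\<in>G. ?t (a \<otimes>\<^bsub>A\<^esub> z i y) y) = (\<Oplus>\<^bsub>TK ?m\<^esub>y\<in>G. ?t (z i y) (y \<otimes>\<^bsub>A\<^esub> a))" ..
    qed (use G Gc z_closed[OF i] in auto)
  next
    fix a assume a: "a \<in> carrier A"
    have "(\<Oplus>\<^bsub>A\<^esub>y\<in>G. z i y \<otimes>\<^bsub>A\<^esub> h (\<phi> i (y \<otimes>\<^bsub>A\<^esub> a))) = g i (f i a)" if i: "i < n" for i
    proof -
      have "(\<Oplus>\<^bsub>A\<^esub>y\<in>G. z i y \<otimes>\<^bsub>A\<^esub> h (\<phi> i (y \<otimes>\<^bsub>A\<^esub> a))) = (\<Oplus>\<^bsub>A\<^esub>y\<in>G. g i (\<psi> y) \<otimes>\<^bsub>A\<^esub> h (f i a y))"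
        using \<phi>_D[OF i] a Gc z_closed[OF i]
        by (intro A.finsum_cong') (auto simp: f_eq[OF i a] z_def carrier_D PiE_iff)
      also have "\<dots> = g i (f i a)"
        using fD(1)[OF i a] by (rule g_expand[OF i, symmetric])
      finally show ?thesis .
    qed
    then have "(\<Oplus>\<^bsub>A\<^esub>i\<in>{..<n}. \<Oplus>\<^bsub>A\<^esub>y\<in>G. z i y \<otimes>\<^bsub>A\<^esub> h (\<phi> i (y \<otimes>\<^bsub>A\<^esub> a))) = (\<Oplus>\<^bsub>A\<^esub>i\<in>{..<n}. g i (f i a))"
      using gD(1) fD(1) a by (intro A.finsum_cong') auto
    also have "\<dots> = (\<Oplus>\<^bsub>A_KB ?m\<^esub>i\<in>{..<n}. g i (f i a))"
      unfolding A_KB_def using gD(1) fD(1) a by (intro finsum_ring_bimod[symmetric] A.is_abelian_group) auto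
    finally show "(\<Oplus>\<^bsub>A\<^esub>i\<in>{..<n}. \<Oplus>\<^bsub>A\<^esub>y\<in>G. z i y \<otimes>\<^bsub>A\<^esub> h (\<phi> i (y \<otimes>\<^bsub>A\<^esub> a))) = a"
      using fg[of a] a by simp
  qed
qed

end

section \<open>Similarity of the endomorphism and tensor bimodules\<close>

context ring_ext
begin

text \<open>K acts on the values F(u_k), so left linearity is immediate. The right action of y
  replaces F(u_k) by F(y u_k), and the Casimir property has to carry y over to v_k y.\<close>

lemma coord_RE_hom:
  assumes K: "bimodule K B (A_KB l)" and c: "casimir I u v"
  shows "restrict (\<lambda>F. \<Oplus>\<^bsub>TK l\<^esub>k\<in>I. tK l (F (u k)) (v k)) (carrier (RE l)) \<in> bimod_hom K A (RE l) (TK l)"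
proof -
  interpret T: tensor_product K B A "A_KB l" "A_BA A h"
    by (rule tensor_product_A_KB[OF K])
  interpret TP: bimodule K A "TK l" by (rule T.bimodule_TP)
  note uv = casimirD[OF c]
  note t = T.tens_closed[simplified]
  show ?thesis
  proof (rule bimod_homI[OF _ _ _ _ bimodule_RE[OF K]])
    show "(\<Oplus>\<^bsub>TK l\<^esub>k\<in>I. tK l (F (u k)) (v k)) \<in> carrier (TK l)" if "F \<in> carrier (RE l)" for F
      using uv t carrier_RED[OF that] by (intro T.TP.finsum_closed) auto
    show "(\<Oplus>\<^bsub>TK l\<^esub>k\<in>I. tK l ((F \<oplus>\<^bsub>RE l\<^esub> G) (u k)) (v k)) =
        (\<Oplus>\<^bsub>TK l\<^esub>k\<in>I. tK l (F (u k)) (v k)) \<oplus>\<^bsub>TK l\<^esub> (\<Oplus>\<^bsub>TK l\<^esub>k\<in>I. tK l (G (u k)) (v k))"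
      if "F \<in> carrier (RE l)" "G \<in> carrier (RE l)" for F G
    proof -
      have "(\<Oplus>\<^bsub>TK l\<^esub>k\<in>I. tK l ((F \<oplus>\<^bsub>RE l\<^esub> G) (u k)) (v k)) =
        (\<Oplus>\<^bsub>TK l\<^esub>k\<in>I. tK l (F (u k)) (v k) \<oplus>\<^bsub>TK l\<^esub> tK l (G (u k)) (v k))"
        using uv t carrier_RED[OF that(1)] carrier_RED[OF that(2)] T.tens_add_left
        by (intro T.TP.finsum_cong') (auto simp: RE_simps)
      also have "\<dots> = (\<Oplus>\<^bsub>TK l\<^esub>k\<in>I. tK l (F (u k)) (v k)) \<oplus>\<^bsub>TK l\<^esub> (\<Oplus>\<^bsub>TK l\<^esub>k\<in>I. tK l (G (u k)) (v k))"
        using uv t carrier_RED[OF that(1)] carrier_RED[OF that(2)] by (intro T.TP.finsum_addf) auto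
      finally show ?thesis .
    qed
    show "(\<Oplus>\<^bsub>TK l\<^esub>k\<in>I. tK l ((r \<odot>\<^bsub>RE l\<^esub> F) (u k)) (v k)) = r \<odot>\<^bsub>TK l\<^esub> (\<Oplus>\<^bsub>TK l\<^esub>k\<in>I. tK l (F (u k)) (v k))"
      if "r \<in> carrier K" "F \<in> carrier (RE l)" for r F
    proof -
      have l: "l r x \<in> carrier A" if "x \<in> carrier A" for x
        using T.M.smult_closed'[OF \<open>r \<in> carrier K\<close>, of x] that by simp
      have "(\<Oplus>\<^bsub>TK l\<^esub>k\<in>I. tK l ((r \<odot>\<^bsub>RE l\<^esub> F) (u k)) (v k)) = (\<Oplus>\<^bsub>TK l\<^esub>k\<in>I. r \<odot>\<^bsub>TK l\<^esub> tK l (F (u k)) (v k))"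
        using uv t l carrier_RED[OF that(2)] T.smult_tens[OF that(1)] that(1)
        by (intro T.TP.finsum_cong') (auto simp: RE_simps)
      also have "\<dots> = r \<odot>\<^bsub>TK l\<^esub> (\<Oplus>\<^bsub>TK l\<^esub>k\<in>I. tK l (F (u k)) (v k))"
        using uv t carrier_RED[OF that(2)]
        by (subst additive_map_finsum[OF T.TP_abelian_group T.TP_abelian_group T.additive_smult_TP[OF that(1)]]) auto
      finally show ?thesis .
    qed
    show "(\<Oplus>\<^bsub>TK l\<^esub>k\<in>I. tK l ((rsmult (RE l) F y) (u k)) (v k)) = rsmult (TK l) (\<Oplus>\<^bsub>TK l\<^esub>k\<in>I. tK l (F (u k)) (v k)) y"
      if y: "y \<in> carrier A" and F: "F \<in> carrier (RE l)" for y F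
    proof -
      note FD = carrier_RED[OF F]
      \<comment> \<open>The Casimir equation holds between sums of tensors, not term by term, so F
        is applied to it as one additive map \<Phi>, namely F \<otimes> id; right B-linearity of F
        makes this well defined.\<close>
      have "balanced B (A_KB l) (A_BA A h) (TK l) (\<lambda>x w. tK l (F x) w)"
        using FD t T.tens_add_left T.tens_add_right T.tens_balanced
        by (auto simp: balanced_def additive_map_def)
      then obtain \<Phi> where \<Phi>: "additive_map (TK l) (TK l) \<Phi>"
        "\<And>x w. x \<in> carrier A \<Longrightarrow> w \<in> carrier A \<Longrightarrow> \<Phi> (tK l x w) = tK l (F x) w"
        using T.tens_universal[OF T.TP_abelian_group] by (metis A_KB_simps(1) A_BA_simps(1))
      have "(\<Oplus>\<^bsub>TK l\<^esub>k\<in>I. tK l ((rsmult (RE l) F y) (u k)) (v k)) = (\<Oplus>\<^bsub>TK l\<^esub>k\<in>I. \<Phi> (tK l (y \<otimes>\<^bsub>A\<^esub> u k) (v k)))"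
        using uv t y FD \<Phi>(2) by (intro T.TP.finsum_cong') (auto simp: RE_simps)
      also have "\<dots> = \<Phi> (\<Oplus>\<^bsub>TK l\<^esub>k\<in>I. tK l (y \<otimes>\<^bsub>A\<^esub> u k) (v k))"
        using uv t y by (subst additive_map_finsum[OF T.TP_abelian_group T.TP_abelian_group \<Phi>(1)]) auto
      also have "\<dots> = \<Phi> (\<Oplus>\<^bsub>TK l\<^esub>k\<in>I. tK l (u k) (v k \<otimes>\<^bsub>A\<^esub> y))"
        by (simp add: casimir_commute[OF K c y])
      also have "\<dots> = (\<Oplus>\<^bsub>TK l\<^esub>k\<in>I. \<Phi> (tK l (u k) (v k \<otimes>\<^bsub>A\<^esub> y)))"
        using uv t y by (subst additive_map_finsum[OF T.TP_abelian_group T.TP_abelian_group \<Phi>(1)]) auto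
      also have "\<dots> = (\<Oplus>\<^bsub>TK l\<^esub>k\<in>I. rsmult (TK l) (tK l (F (u k)) (v k)) y)"
        using uv t y FD \<Phi>(2) T.rsmult_tens[OF y] by (intro T.TP.finsum_cong') auto
      also have "\<dots> = rsmult (TK l) (\<Oplus>\<^bsub>TK l\<^esub>k\<in>I. tK l (F (u k)) (v k)) y"
        using uv t FD
        by (subst additive_map_finsum[OF T.TP_abelian_group T.TP_abelian_group T.additive_rsmult_TP[OF y]]) auto
      finally show ?thesis .
    qed
  qed
qed

text \<open>The right action multiplies values and is respected at once. The left action turns
  F(v_k) into F(v_k x), and the Casimir property trades x for a factor in front of u_k.\<close>

lemma coord_LE_hom:
  assumes c: "casimir I u v"
  shows "restrict (\<lambda>F. \<Oplus>\<^bsub>TK (\<otimes>\<^bsub>A\<^esub>)\<^esub>k\<in>I. tK (\<otimes>\<^bsub>A\<^esub>) (u k) (F (v k))) (carrier LE) \<in> bimod_hom A A LE (TK (\<otimes>\<^bsub>A\<^esub>))"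
proof -
  let ?m = "(\<otimes>\<^bsub>A\<^esub>)"
  note K = bimodule_A_KB_mult
  interpret T: tensor_product A B A "A_KB ?m" "A_BA A h"
    by (rule tensor_product_A_KB[OF K])
  interpret TP: bimodule A A "TK ?m" by (rule T.bimodule_TP)
  note uv = casimirD[OF c]
  note t = T.tens_closed[simplified]
  show ?thesis
  proof (rule bimod_homI[OF _ _ _ _ bimodule_LE])
    show "(\<Oplus>\<^bsub>TK ?m\<^esub>k\<in>I. tK ?m (u k) (F (v k))) \<in> carrier (TK ?m)" if "F \<in> carrier LE" for F
      using uv t carrier_LED[OF that] by (intro T.TP.finsum_closed) auto
    show "(\<Oplus>\<^bsub>TK ?m\<^esub>k\<in>I. tK ?m (u k) ((F \<oplus>\<^bsub>LE\<^esub> G) (v k))) =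
        (\<Oplus>\<^bsub>TK ?m\<^esub>k\<in>I. tK ?m (u k) (F (v k))) \<oplus>\<^bsub>TK ?m\<^esub> (\<Oplus>\<^bsub>TK ?m\<^esub>k\<in>I. tK ?m (u k) (G (v k)))"
      if "F \<in> carrier LE" "G \<in> carrier LE" for F G
    proof -
      have "(\<Oplus>\<^bsub>TK ?m\<^esub>k\<in>I. tK ?m (u k) ((F \<oplus>\<^bsub>LE\<^esub> G) (v k))) =
        (\<Oplus>\<^bsub>TK ?m\<^esub>k\<in>I. tK ?m (u k) (F (v k)) \<oplus>\<^bsub>TK ?m\<^esub> tK ?m (u k) (G (v k)))"
        using uv t carrier_LED[OF that(1)] carrier_LED[OF that(2)] T.tens_add_right
        by (intro T.TP.finsum_cong') (auto simp: LE_simps)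
      also have "\<dots> = (\<Oplus>\<^bsub>TK ?m\<^esub>k\<in>I. tK ?m (u k) (F (v k))) \<oplus>\<^bsub>TK ?m\<^esub> (\<Oplus>\<^bsub>TK ?m\<^esub>k\<in>I. tK ?m (u k) (G (v k)))"
        using uv t carrier_LED[OF that(1)] carrier_LED[OF that(2)] by (intro T.TP.finsum_addf) auto
      finally show ?thesis .
    qed
    show "(\<Oplus>\<^bsub>TK ?m\<^esub>k\<in>I. tK ?m (u k) ((rsmult LE F y) (v k))) = rsmult (TK ?m) (\<Oplus>\<^bsub>TK ?m\<^esub>k\<in>I. tK ?m (u k) (F (v k))) y"
      if "y \<in> carrier A" "F \<in> carrier LE" for y F
    proof -
      have "(\<Oplus>\<^bsub>TK ?m\<^esub>k\<in>I. tK ?m (u k) ((rsmult LE F y) (v k))) = (\<Oplus>\<^bsub>TK ?m\<^esub>k\<in>I. rsmult (TK ?m) (tK ?m (u k) (F (v k))) y)"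
        using uv t carrier_LED[OF that(2)] T.rsmult_tens[OF that(1)] that(1)
        by (intro T.TP.finsum_cong') (auto simp: LE_simps)
      also have "\<dots> = rsmult (TK ?m) (\<Oplus>\<^bsub>TK ?m\<^esub>k\<in>I. tK ?m (u k) (F (v k))) y"
        using uv t carrier_LED[OF that(2)]
        by (subst additive_map_finsum[OF T.TP_abelian_group T.TP_abelian_group T.additive_rsmult_TP[OF that(1)]]) auto
      finally show ?thesis .
    qed
    show "(\<Oplus>\<^bsub>TK ?m\<^esub>k\<in>I. tK ?m (u k) ((x \<odot>\<^bsub>LE\<^esub> F) (v k))) = x \<odot>\<^bsub>TK ?m\<^esub> (\<Oplus>\<^bsub>TK ?m\<^esub>k\<in>I. tK ?m (u k) (F (v k)))"
      if x: "x \<in> carrier A" and F: "F \<in> carrier LE" for x F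
    proof -
      note FD = carrier_LED[OF F]
      \<comment> \<open>Here \<Phi> is id \<otimes> F, well defined because F is left
        B-linear.\<close>
      have "balanced B (A_KB ?m) (A_BA A h) (TK ?m) (\<lambda>x w. tK ?m x (F w))"
        using FD t T.tens_add_left T.tens_add_right T.tens_balanced
        by (auto simp: balanced_def additive_map_def)
      then obtain \<Phi> where \<Phi>: "additive_map (TK ?m) (TK ?m) \<Phi>"
        "\<And>x w. x \<in> carrier A \<Longrightarrow> w \<in> carrier A \<Longrightarrow> \<Phi> (tK ?m x w) = tK ?m x (F w)"
        using T.tens_universal[OF T.TP_abelian_group] by (metis A_KB_simps(1) A_BA_simps(1))
      have "(\<Oplus>\<^bsub>TK ?m\<^esub>k\<in>I. tK ?m (u k) ((x \<odot>\<^bsub>LE\<^esub> F) (v k))) = (\<Oplus>\<^bsub>TK ?m\<^esub>k\<in>I. \<Phi> (tK ?m (u k) (v k \<otimes>\<^bsub>A\<^esub> x)))"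
        using uv t x FD \<Phi>(2) by (intro T.TP.finsum_cong') (auto simp: LE_simps)
      also have "\<dots> = \<Phi> (\<Oplus>\<^bsub>TK ?m\<^esub>k\<in>I. tK ?m (u k) (v k \<otimes>\<^bsub>A\<^esub> x))"
        using uv t x by (subst additive_map_finsum[OF T.TP_abelian_group T.TP_abelian_group \<Phi>(1)]) auto
      also have "\<dots> = \<Phi> (\<Oplus>\<^bsub>TK ?m\<^esub>k\<in>I. tK ?m (x \<otimes>\<^bsub>A\<^esub> u k) (v k))"
        by (simp add: casimir_commute[OF K c x])
      also have "\<dots> = (\<Oplus>\<^bsub>TK ?m\<^esub>k\<in>I. \<Phi> (tK ?m (x \<otimes>\<^bsub>A\<^esub> u k) (v k)))"
        using uv t x by (subst additive_map_finsum[OF T.TP_abelian_group T.TP_abelian_group \<Phi>(1)]) auto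
      also have "\<dots> = (\<Oplus>\<^bsub>TK ?m\<^esub>k\<in>I. x \<odot>\<^bsub>TK ?m\<^esub> tK ?m (u k) (F (v k)))"
        using uv t x FD \<Phi>(2) T.smult_tens[OF x] by (intro T.TP.finsum_cong') auto
      also have "\<dots> = x \<odot>\<^bsub>TK ?m\<^esub> (\<Oplus>\<^bsub>TK ?m\<^esub>k\<in>I. tK ?m (u k) (F (v k)))"
        using uv t FD
        by (subst additive_map_finsum[OF T.TP_abelian_group T.TP_abelian_group T.additive_smult_TP[OF x]]) auto
      finally show ?thesis .
    qed
  qed
qed

text \<open>The two linearities of \<phi> have separate tasks in x \<phi>(w a): the left one makes
  the expression balanced in x and w, the right one makes it right B-linear in a. K-linearity uses
  that the actions of K and B on A commute.\<close>

lemma tensor_RE_hom: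
  assumes K: "bimodule K B (A_KB l)" and \<phi>: "bilin \<phi>"
  obtains \<beta> where "\<beta> \<in> bimod_hom K A (TK l) (RE l)"
    "\<And>x w. x \<in> carrier A \<Longrightarrow> w \<in> carrier A \<Longrightarrow> \<beta> (tK l x w) = (\<lambda>a\<in>carrier A. x \<otimes>\<^bsub>A\<^esub> h (\<phi> (w \<otimes>\<^bsub>A\<^esub> a)))"
proof -
  interpret T: tensor_product K B A "A_KB l" "A_BA A h"
    by (rule tensor_product_A_KB[OF K])
  note \<phi>D = bilinD[OF \<phi>]
  define b where "b x w = (\<lambda>a\<in>carrier A. x \<otimes>\<^bsub>A\<^esub> h (\<phi> (w \<otimes>\<^bsub>A\<^esub> a)))" for x w
  have b_closed: "b x w \<in> carrier (RE l)" if "x \<in> carrier A" "w \<in> carrier A" for x w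
  proof -
    have "\<phi> (w \<otimes>\<^bsub>A\<^esub> (a \<otimes>\<^bsub>A\<^esub> h s)) = \<phi> (w \<otimes>\<^bsub>A\<^esub> a) \<otimes>\<^bsub>B\<^esub> s" if "a \<in> carrier A" "s \<in> carrier B" for a s
      using \<phi>D(4)[of s "w \<otimes>\<^bsub>A\<^esub> a"] \<open>w \<in> carrier A\<close> that by (simp add: A.m_assoc)
    then show ?thesis
      using that by (auto simp: b_def carrier_RE additive_map_def \<phi>D A.r_distr A.m_assoc)
  qed
  have "balanced B (A_KB l) (A_BA A h) (RE l) b"
    using b_closed unfolding balanced_def additive_map_def
    by (auto simp: RE_simps b_def \<phi>D A.r_distr A.l_distr A.m_assoc intro!: restrict_ext)
  moreover have "b (l r x) w = r \<odot>\<^bsub>RE l\<^esub> b x w"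
    if "r \<in> carrier K" "x \<in> carrier A" "w \<in> carrier A" for r x w
    using that T.M.smult_rsmult[of r _ x] by (auto simp: RE_simps b_def \<phi>D intro!: restrict_ext)
  moreover have "b x (w \<otimes>\<^bsub>A\<^esub> y) = rsmult (RE l) (b x w) y"
    if "y \<in> carrier A" "x \<in> carrier A" "w \<in> carrier A" for y x w
    using that by (auto simp: RE_simps b_def A.m_assoc intro!: restrict_ext)
  ultimately have "\<exists>\<beta>\<in>bimod_hom K A (TK l) (RE l). \<forall>x\<in>carrier A. \<forall>w\<in>carrier A. \<beta> (tK l x w) = b x w"
    by (rule T.tens_bimod_hom[OF bimodule_RE[OF K], unfolded A_KB_simps A_BA_simps])
      (assumption+, rule bexI[rotated], assumption, simp)
  then show thesis using that unfolding b_def by blast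
qed

text \<open>In \<phi>(a x) w the tasks are exchanged: right linearity of \<phi> gives balancedness
  in x and w, left linearity gives left B-linearity in a.\<close>

lemma tensor_LE_hom:
  assumes \<phi>: "bilin \<phi>"
  obtains \<beta> where "\<beta> \<in> bimod_hom A A (TK (\<otimes>\<^bsub>A\<^esub>)) LE"
    "\<And>x w. x \<in> carrier A \<Longrightarrow> w \<in> carrier A \<Longrightarrow> \<beta> (tK (\<otimes>\<^bsub>A\<^esub>) x w) = (\<lambda>a\<in>carrier A. h (\<phi> (a \<otimes>\<^bsub>A\<^esub> x)) \<otimes>\<^bsub>A\<^esub> w)"
proof -
  let ?m = "(\<otimes>\<^bsub>A\<^esub>)"
  interpret T: tensor_product A B A "A_KB ?m" "A_BA A h"
    by (rule tensor_product_A_KB[OF bimodule_A_KB_mult])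
  note \<phi>D = bilinD[OF \<phi>]
  define b where "b x w = (\<lambda>a\<in>carrier A. h (\<phi> (a \<otimes>\<^bsub>A\<^esub> x)) \<otimes>\<^bsub>A\<^esub> w)" for x w
  have \<phi>r: "\<phi> (a \<otimes>\<^bsub>A\<^esub> (x \<otimes>\<^bsub>A\<^esub> h s)) = \<phi> (a \<otimes>\<^bsub>A\<^esub> x) \<otimes>\<^bsub>B\<^esub> s"
    if "a \<in> carrier A" "s \<in> carrier B" "x \<in> carrier A" for a s x
    using \<phi>D(4)[of s "a \<otimes>\<^bsub>A\<^esub> x"] that by (simp add: A.m_assoc)
  have b_closed: "b x w \<in> carrier LE" if "x \<in> carrier A" "w \<in> carrier A" for x w
    using that by (auto simp: b_def carrier_LE additive_map_def \<phi>D A.l_distr A.m_assoc)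
  have "balanced B (A_KB ?m) (A_BA A h) LE b"
    using b_closed unfolding balanced_def additive_map_def
    by (auto simp: LE_simps b_def \<phi>D \<phi>r A.r_distr A.l_distr A.m_assoc intro!: restrict_ext)
  moreover have "b (r \<otimes>\<^bsub>A\<^esub> x) w = r \<odot>\<^bsub>LE\<^esub> b x w"
    if "r \<in> carrier A" "x \<in> carrier A" "w \<in> carrier A" for r x w
    using that by (auto simp: LE_simps b_def A.m_assoc intro!: restrict_ext)
  moreover have "b x (w \<otimes>\<^bsub>A\<^esub> y) = rsmult LE (b x w) y"
    if "y \<in> carrier A" "x \<in> carrier A" "w \<in> carrier A" for y x w
    using that by (auto simp: LE_simps b_def \<phi>D A.m_assoc intro!: restrict_ext)
  ultimately have "\<exists>\<beta>\<in>bimod_hom A A (TK ?m) LE. \<forall>x\<in>carrier A. \<forall>w\<in>carrier A. \<beta> (tK ?m x w) = b x w"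
    by (rule T.tens_bimod_hom[OF bimodule_LE, unfolded A_KB_simps A_BA_simps])
      (assumption+, rule bexI[rotated], assumption, simp)
  then show thesis using that unfolding b_def by blast
qed

text \<open>The composite sends F to the map a -> \<Sum> F(z_i(y)) \<phi>_i(y a). Since F is right
  B-linear and additive, this is F(\<Sum> z_i(y) \<phi>_i(y a)), and the left QF formula reduces the
  argument to a after summation over i.\<close>

lemma RE_divides_tensor:
  assumes K: "bimodule K B (A_KB l)" and "left_QF A B h"
  shows "bimod_divides K A (RE l) (TK l)"
proof -
  interpret T: tensor_product K B A "A_KB l" "A_BA A h"
    by (rule tensor_product_A_KB[OF K])
  obtain n :: nat and G \<phi> z where \<phi>: "\<And>i. i < n \<Longrightarrow> bilin (\<phi> i)"
    and c: "\<And>i. i < n \<Longrightarrow> casimir G (z i) (\<lambda>y. y)"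
    and sum: "\<And>a. a \<in> carrier A \<Longrightarrow> (\<Oplus>\<^bsub>A\<^esub>i\<in>{..<n}. \<Oplus>\<^bsub>A\<^esub>y\<in>G. z i y \<otimes>\<^bsub>A\<^esub> h (\<phi> i (y \<otimes>\<^bsub>A\<^esub> a))) = a"
    by (rule left_QF_casimir[OF assms(2)]) blast
  have "\<exists>\<beta>. \<beta> \<in> bimod_hom K A (TK l) (RE l) \<and> (\<forall>x\<in>carrier A. \<forall>w\<in>carrier A.
      \<beta> (tK l x w) = (\<lambda>a\<in>carrier A. x \<otimes>\<^bsub>A\<^esub> h (\<phi> i (w \<otimes>\<^bsub>A\<^esub> a))))" if "i < n" for i
    by (rule tensor_RE_hom[OF K \<phi>[OF that]]) blast
  then obtain \<beta> where \<beta>: "\<And>i. i < n \<Longrightarrow> \<beta> i \<in> bimod_hom K A (TK l) (RE l)"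
    and \<beta>_tens: "\<And>i x w. i < n \<Longrightarrow> x \<in> carrier A \<Longrightarrow> w \<in> carrier A \<Longrightarrow>
      \<beta> i (tK l x w) = (\<lambda>a\<in>carrier A. x \<otimes>\<^bsub>A\<^esub> h (\<phi> i (w \<otimes>\<^bsub>A\<^esub> a)))"
    by metis
  define \<alpha> where "\<alpha> i = restrict (\<lambda>F. \<Oplus>\<^bsub>TK l\<^esub>y\<in>G. tK l (F (z i y)) y) (carrier (RE l))" for i
  have \<alpha>: "\<alpha> i \<in> bimod_hom K A (RE l) (TK l)" if "i < n" for i
    unfolding \<alpha>_def by (rule coord_RE_hom[OF K c[OF that]])
  note t = T.tens_closed[simplified] and cD = casimirD[OF c] and \<phi>D = bilinD[OF \<phi>]
  show ?thesis
  proof (rule bimod_dividesI[OF bimodule_RE[OF K] T.bimodule_TP finite_lessThan])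
    fix F assume F: "F \<in> carrier (RE l)"
    note FD = carrier_RED[OF F]
    have \<beta>\<alpha>: "\<beta> i (\<alpha> i F) \<in> carrier (RE l)" if "i < n" for i
      using bimod_homD(1)[OF \<beta>[OF that]] bimod_homD(1)[OF \<alpha>[OF that] F] by blast
    have \<beta>\<alpha>_eq: "\<beta> i (\<alpha> i F) a = F (\<Oplus>\<^bsub>A\<^esub>y\<in>G. z i y \<otimes>\<^bsub>A\<^esub> h (\<phi> i (y \<otimes>\<^bsub>A\<^esub> a)))"
      if i: "i < n" and a: "a \<in> carrier A" for i a
    proof -
      have b_closed: "\<beta> i (tK l (F (z i y)) y) \<in> carrier (RE l)" if "y \<in> G" for y
        using bimod_homD(1)[OF \<beta>[OF i]] t FD cD(2,3)[OF i] that by simp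
      have "\<beta> i (\<alpha> i F) = (\<Oplus>\<^bsub>RE l\<^esub>y\<in>G. \<beta> i (tK l (F (z i y)) y))"
        using F FD cD(2,3)[OF i] t unfolding \<alpha>_def restrict_apply'[OF F]
        by (intro additive_map_finsum[OF T.TP_abelian_group abelian_group_RE bimod_hom_additive[OF \<beta>[OF i]]]) auto
      then have "\<beta> i (\<alpha> i F) a = (\<Oplus>\<^bsub>A\<^esub>y\<in>G. \<beta> i (tK l (F (z i y)) y) a)"
        by (simp add: finsum_RE_apply[OF a] b_closed Pi_iff)
      also have "\<dots> = (\<Oplus>\<^bsub>A\<^esub>y\<in>G. F (z i y \<otimes>\<^bsub>A\<^esub> h (\<phi> i (y \<otimes>\<^bsub>A\<^esub> a))))"
        using FD cD(2,3)[OF i] \<phi>D(1)[OF i] a by (intro A.finsum_cong') (auto simp: \<beta>_tens[OF i])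
      also have "\<dots> = F (\<Oplus>\<^bsub>A\<^esub>y\<in>G. z i y \<otimes>\<^bsub>A\<^esub> h (\<phi> i (y \<otimes>\<^bsub>A\<^esub> a)))"
        using cD(2,3)[OF i] \<phi>D(1)[OF i] a
        by (subst additive_map_finsum[OF A.is_abelian_group A.is_abelian_group FD(2)]) auto
      finally show ?thesis .
    qed
    show "(\<Oplus>\<^bsub>RE l\<^esub>i\<in>{..<n}. \<beta> i (\<alpha> i F)) = F"
    proof (rule extensionalityI[of _ "carrier A"])
      interpret R: abelian_group "RE l" by (rule abelian_group_RE)
      have "(\<Oplus>\<^bsub>RE l\<^esub>i\<in>{..<n}. \<beta> i (\<alpha> i F)) \<in> carrier (RE l)"
        using \<beta>\<alpha> by (intro R.finsum_closed) auto
      then show "(\<Oplus>\<^bsub>RE l\<^esub>i\<in>{..<n}. \<beta> i (\<alpha> i F)) \<in> extensional (carrier A)"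
        by (auto simp: carrier_RE PiE_iff)
      show "F \<in> extensional (carrier A)" using F by (auto simp: carrier_RE PiE_iff)
      fix a assume a: "a \<in> carrier A"
      have inner: "(\<Oplus>\<^bsub>A\<^esub>y\<in>G. z i y \<otimes>\<^bsub>A\<^esub> h (\<phi> i (y \<otimes>\<^bsub>A\<^esub> a))) \<in> carrier A" if "i < n" for i
        using cD(2,3)[OF that] \<phi>D(1)[OF that] a by (intro A.finsum_closed) auto
      have "(\<Oplus>\<^bsub>RE l\<^esub>i\<in>{..<n}. \<beta> i (\<alpha> i F)) a = (\<Oplus>\<^bsub>A\<^esub>i\<in>{..<n}. \<beta> i (\<alpha> i F) a)"
        using \<beta>\<alpha> by (intro finsum_RE_apply a) auto
      also have "\<dots> = (\<Oplus>\<^bsub>A\<^esub>i\<in>{..<n}. F (\<Oplus>\<^bsub>A\<^esub>y\<in>G. z i y \<otimes>\<^bsub>A\<^esub> h (\<phi> i (y \<otimes>\<^bsub>A\<^esub> a))))"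
        using inner FD(1) \<beta>\<alpha>_eq a by (intro A.finsum_cong') auto
      also have "\<dots> = F (\<Oplus>\<^bsub>A\<^esub>i\<in>{..<n}. \<Oplus>\<^bsub>A\<^esub>y\<in>G. z i y \<otimes>\<^bsub>A\<^esub> h (\<phi> i (y \<otimes>\<^bsub>A\<^esub> a)))"
        using inner by (subst additive_map_finsum[OF A.is_abelian_group A.is_abelian_group FD(2)]) auto
      finally show "(\<Oplus>\<^bsub>RE l\<^esub>i\<in>{..<n}. \<beta> i (\<alpha> i F)) a = F a"
        by (simp add: sum[OF a])
    qed
  qed (use \<alpha> \<beta> in auto)
qed

text \<open>The composite sends x \<otimes> w to \<Sum> x \<phi>_i(w y) \<otimes> z_i(y). Moving the
  coefficient to the right factor gives x \<otimes> \<Sum> \<phi>_i(w y) z_i(y), which the right QF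
  formula turns into x \<otimes> w.\<close>

lemma tensor_divides_RE:
  assumes K: "bimodule K B (A_KB l)" and "right_QF A B h"
  shows "bimod_divides K A (TK l) (RE l)"
proof -
  interpret T: tensor_product K B A "A_KB l" "A_BA A h"
    by (rule tensor_product_A_KB[OF K])
  obtain n :: nat and G \<phi> z where \<phi>: "\<And>i. i < n \<Longrightarrow> bilin (\<phi> i)"
    and c: "\<And>i. i < n \<Longrightarrow> casimir G (\<lambda>y. y) (z i)"
    and sum: "\<And>a. a \<in> carrier A \<Longrightarrow> (\<Oplus>\<^bsub>A\<^esub>i\<in>{..<n}. \<Oplus>\<^bsub>A\<^esub>y\<in>G. h (\<phi> i (a \<otimes>\<^bsub>A\<^esub> y)) \<otimes>\<^bsub>A\<^esub> z i y) = a"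
    by (rule right_QF_casimir[OF assms(2)]) blast
  have "\<exists>\<beta>. \<beta> \<in> bimod_hom K A (TK l) (RE l) \<and> (\<forall>x\<in>carrier A. \<forall>w\<in>carrier A.
      \<beta> (tK l x w) = (\<lambda>a\<in>carrier A. x \<otimes>\<^bsub>A\<^esub> h (\<phi> i (w \<otimes>\<^bsub>A\<^esub> a))))" if "i < n" for i
    by (rule tensor_RE_hom[OF K \<phi>[OF that]]) blast
  then obtain \<beta> where \<beta>: "\<And>i. i < n \<Longrightarrow> \<beta> i \<in> bimod_hom K A (TK l) (RE l)"
    and \<beta>_tens: "\<And>i x w. i < n \<Longrightarrow> x \<in> carrier A \<Longrightarrow> w \<in> carrier A \<Longrightarrow>
      \<beta> i (tK l x w) = (\<lambda>a\<in>carrier A. x \<otimes>\<^bsub>A\<^esub> h (\<phi> i (w \<otimes>\<^bsub>A\<^esub> a)))"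
    by metis
  define \<alpha> where "\<alpha> i = restrict (\<lambda>F. \<Oplus>\<^bsub>TK l\<^esub>y\<in>G. tK l (F y) (z i y)) (carrier (RE l))" for i
  have \<alpha>: "\<alpha> i \<in> bimod_hom K A (RE l) (TK l)" if "i < n" for i
    unfolding \<alpha>_def by (rule coord_RE_hom[OF K c[OF that]])
  note t = T.tens_closed[simplified] and cD = casimirD[OF c] and \<phi>D = bilinD[OF \<phi>]
  have \<alpha>\<beta>: "additive_map (TK l) (TK l) (\<lambda>C. \<alpha> i (\<beta> i C))" if "i < n" for i
    using bimod_hom_additive[OF \<beta>[OF that]] bimod_hom_additive[OF \<alpha>[OF that]]
    by (auto simp: additive_map_def)
  show ?thesis
  proof (rule bimod_dividesI[OF T.bimodule_TP bimodule_RE[OF K] finite_lessThan])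
    fix C assume "C \<in> carrier (TK l)"
    then show "(\<Oplus>\<^bsub>TK l\<^esub>i\<in>{..<n}. \<alpha> i (\<beta> i C)) = C"
    \<comment> \<open>Both sides are additive in \<open>C\<close>, so pure tensors suffice.\<close>
    proof (rule T.additive_eq_on_tens[OF T.TP_abelian_group, rotated 2])
      fix x w assume "x \<in> carrier (A_KB l)" "w \<in> carrier (A_BA A h)"
      then have x: "x \<in> carrier A" and w: "w \<in> carrier A" by simp_all
      have summand: "h (\<phi> i (w \<otimes>\<^bsub>A\<^esub> y)) \<otimes>\<^bsub>A\<^esub> z i y \<in> carrier A" if "i < n" "y \<in> G" for i y
        using cD[OF that(1)] \<phi>D(1)[OF that(1)] that w by auto
      have sum_A_BA: "finsum (A_BA A h) F I = finsum A F I" if "F \<in> I \<rightarrow> carrier A" for F I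
        unfolding A_BA_def using that by (intro finsum_ring_bimod A.is_abelian_group)
      have inner: "(\<Oplus>\<^bsub>A\<^esub>y\<in>G. h (\<phi> i (w \<otimes>\<^bsub>A\<^esub> y)) \<otimes>\<^bsub>A\<^esub> z i y) \<in> carrier A" if "i < n" for i
        using summand[OF that] by (intro A.finsum_closed) auto
      have "\<alpha> i (\<beta> i (tK l x w)) = tK l x (\<Oplus>\<^bsub>A\<^esub>y\<in>G. h (\<phi> i (w \<otimes>\<^bsub>A\<^esub> y)) \<otimes>\<^bsub>A\<^esub> z i y)" if i: "i < n" for i
      proof -
        have "\<alpha> i (\<beta> i (tK l x w)) = (\<Oplus>\<^bsub>TK l\<^esub>y\<in>G. tK l (\<beta> i (tK l x w) y) (z i y))"
          using bimod_homD(1)[OF \<beta>[OF i] t[OF x w]] by (simp add: \<alpha>_def)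
        also have "\<dots> = (\<Oplus>\<^bsub>TK l\<^esub>y\<in>G. tK l x (h (\<phi> i (w \<otimes>\<^bsub>A\<^esub> y)) \<otimes>\<^bsub>A\<^esub> z i y))"
          using cD[OF i] \<phi>D(1)[OF i] x w T.tens_balanced t
          by (intro T.TP.finsum_cong') (auto simp: \<beta>_tens[OF i])
        also have "\<dots> = tK l x (\<Oplus>\<^bsub>A_BA A h\<^esub>y\<in>G. h (\<phi> i (w \<otimes>\<^bsub>A\<^esub> y)) \<otimes>\<^bsub>A\<^esub> z i y)"
          using x summand[OF i] by (intro T.tens_finsum_right[symmetric]) auto
        also have "(\<Oplus>\<^bsub>A_BA A h\<^esub>y\<in>G. h (\<phi> i (w \<otimes>\<^bsub>A\<^esub> y)) \<otimes>\<^bsub>A\<^esub> z i y) =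
            (\<Oplus>\<^bsub>A\<^esub>y\<in>G. h (\<phi> i (w \<otimes>\<^bsub>A\<^esub> y)) \<otimes>\<^bsub>A\<^esub> z i y)"
          using summand[OF i] by (intro sum_A_BA) auto
        finally show ?thesis .
      qed
      then have "(\<Oplus>\<^bsub>TK l\<^esub>i\<in>{..<n}. \<alpha> i (\<beta> i (tK l x w))) =
          (\<Oplus>\<^bsub>TK l\<^esub>i\<in>{..<n}. tK l x (\<Oplus>\<^bsub>A\<^esub>y\<in>G. h (\<phi> i (w \<otimes>\<^bsub>A\<^esub> y)) \<otimes>\<^bsub>A\<^esub> z i y))"
        using t x inner by (intro T.TP.finsum_cong') auto
      also have "\<dots> = tK l x (\<Oplus>\<^bsub>A_BA A h\<^esub>i\<in>{..<n}. \<Oplus>\<^bsub>A\<^esub>y\<in>G. h (\<phi> i (w \<otimes>\<^bsub>A\<^esub> y)) \<otimes>\<^bsub>A\<^esub> z i y)"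
        using x inner by (intro T.tens_finsum_right[symmetric]) auto
      also have "\<dots> = tK l x w"
        using inner by (subst sum_A_BA) (auto simp: sum[OF w])
      finally show "(\<Oplus>\<^bsub>TK l\<^esub>i\<in>{..<n}. \<alpha> i (\<beta> i (tK l x w))) = tK l x w" .
    next
      show "additive_map (TK l) (TK l) (\<lambda>C. \<Oplus>\<^bsub>TK l\<^esub>i\<in>{..<n}. \<alpha> i (\<beta> i C))"
        using \<alpha>\<beta> by (intro additive_pointwise_finsum T.TP_abelian_group) auto
    qed (simp add: additive_map_def)
  qed (use \<alpha> \<beta> in auto)
qed

text \<open>The composite is F -> (a -> \<Sum> \<phi>_i(a y) F(z_i(y))). Left B-linearity of F pulls
  the coefficients inside on the left of z_i(y), which is the shape of the right QF formula.\<close>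

lemma LE_divides_tensor:
  assumes "right_QF A B h"
  shows "bimod_divides A A LE (TK (\<otimes>\<^bsub>A\<^esub>))"
proof -
  let ?m = "(\<otimes>\<^bsub>A\<^esub>)"
  interpret T: tensor_product A B A "A_KB ?m" "A_BA A h"
    by (rule tensor_product_A_KB[OF bimodule_A_KB_mult])
  interpret LE: bimodule A A LE by (rule bimodule_LE)
  obtain n :: nat and G \<phi> z where \<phi>: "\<And>i. i < n \<Longrightarrow> bilin (\<phi> i)"
    and c: "\<And>i. i < n \<Longrightarrow> casimir G (\<lambda>y. y) (z i)"
    and sum: "\<And>a. a \<in> carrier A \<Longrightarrow> (\<Oplus>\<^bsub>A\<^esub>i\<in>{..<n}. \<Oplus>\<^bsub>A\<^esub>y\<in>G. h (\<phi> i (a \<otimes>\<^bsub>A\<^esub> y)) \<otimes>\<^bsub>A\<^esub> z i y) = a"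
    by (rule right_QF_casimir[OF assms]) blast
  have "\<exists>\<beta>. \<beta> \<in> bimod_hom A A (TK ?m) LE \<and> (\<forall>x\<in>carrier A. \<forall>w\<in>carrier A.
      \<beta> (tK ?m x w) = (\<lambda>a\<in>carrier A. h (\<phi> i (a \<otimes>\<^bsub>A\<^esub> x)) \<otimes>\<^bsub>A\<^esub> w))" if "i < n" for i
    by (rule tensor_LE_hom[OF \<phi>[OF that]]) blast
  then obtain \<beta> where \<beta>: "\<And>i. i < n \<Longrightarrow> \<beta> i \<in> bimod_hom A A (TK ?m) LE"
    and \<beta>_tens: "\<And>i x w. i < n \<Longrightarrow> x \<in> carrier A \<Longrightarrow> w \<in> carrier A \<Longrightarrow>
      \<beta> i (tK ?m x w) = (\<lambda>a\<in>carrier A. h (\<phi> i (a \<otimes>\<^bsub>A\<^esub> x)) \<otimes>\<^bsub>A\<^esub> w)"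
    by metis
  define \<alpha> where "\<alpha> i = restrict (\<lambda>F. \<Oplus>\<^bsub>TK ?m\<^esub>y\<in>G. tK ?m y (F (z i y))) (carrier LE)" for i
  have \<alpha>: "\<alpha> i \<in> bimod_hom A A LE (TK ?m)" if "i < n" for i
    unfolding \<alpha>_def by (rule coord_LE_hom[OF c[OF that]])
  note t = T.tens_closed[simplified] and cD = casimirD[OF c] and \<phi>D = bilinD[OF \<phi>]
  show ?thesis
  proof (rule bimod_dividesI[OF bimodule_LE T.bimodule_TP finite_lessThan])
    fix F assume F: "F \<in> carrier LE"
    note FD = carrier_LED[OF F]
    have \<beta>\<alpha>: "\<beta> i (\<alpha> i F) \<in> carrier LE" if "i < n" for i
      using bimod_homD(1)[OF \<beta>[OF that]] bimod_homD(1)[OF \<alpha>[OF that] F] by blast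
    have \<beta>\<alpha>_eq: "\<beta> i (\<alpha> i F) a = F (\<Oplus>\<^bsub>A\<^esub>y\<in>G. h (\<phi> i (a \<otimes>\<^bsub>A\<^esub> y)) \<otimes>\<^bsub>A\<^esub> z i y)"
      if i: "i < n" and a: "a \<in> carrier A" for i a
    proof -
      have b_closed: "\<beta> i (tK ?m y (F (z i y))) \<in> carrier LE" if "y \<in> G" for y
        using bimod_homD(1)[OF \<beta>[OF i]] t FD cD(2,3)[OF i] that by simp
      have "\<beta> i (\<alpha> i F) = (\<Oplus>\<^bsub>LE\<^esub>y\<in>G. \<beta> i (tK ?m y (F (z i y))))"
        using F FD cD(2,3)[OF i] t unfolding \<alpha>_def restrict_apply'[OF F]
        by (intro additive_map_finsum[OF T.TP_abelian_group LE.abelian_group_axioms bimod_hom_additive[OF \<beta>[OF i]]]) auto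
      then have "\<beta> i (\<alpha> i F) a = (\<Oplus>\<^bsub>A\<^esub>y\<in>G. \<beta> i (tK ?m y (F (z i y))) a)"
        by (simp add: finsum_LE_apply[OF a] b_closed Pi_iff)
      also have "\<dots> = (\<Oplus>\<^bsub>A\<^esub>y\<in>G. F (h (\<phi> i (a \<otimes>\<^bsub>A\<^esub> y)) \<otimes>\<^bsub>A\<^esub> z i y))"
        using FD cD(2,3)[OF i] \<phi>D(1)[OF i] a by (intro A.finsum_cong') (auto simp: \<beta>_tens[OF i])
      also have "\<dots> = F (\<Oplus>\<^bsub>A\<^esub>y\<in>G. h (\<phi> i (a \<otimes>\<^bsub>A\<^esub> y)) \<otimes>\<^bsub>A\<^esub> z i y)"
        using cD(2,3)[OF i] \<phi>D(1)[OF i] a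
        by (subst additive_map_finsum[OF A.is_abelian_group A.is_abelian_group FD(2)]) auto
      finally show ?thesis .
    qed
    show "(\<Oplus>\<^bsub>LE\<^esub>i\<in>{..<n}. \<beta> i (\<alpha> i F)) = F"
    proof (rule extensionalityI[of _ "carrier A"])
      have "(\<Oplus>\<^bsub>LE\<^esub>i\<in>{..<n}. \<beta> i (\<alpha> i F)) \<in> carrier LE"
        using \<beta>\<alpha> by (intro LE.left.M.finsum_closed) auto
      then show "(\<Oplus>\<^bsub>LE\<^esub>i\<in>{..<n}. \<beta> i (\<alpha> i F)) \<in> extensional (carrier A)"
        by (auto simp: carrier_LE PiE_iff)
      show "F \<in> extensional (carrier A)" using F by (auto simp: carrier_LE PiE_iff)
      fix a assume a: "a \<in> carrier A"
      have inner: "(\<Oplus>\<^bsub>A\<^esub>y\<in>G. h (\<phi> i (a \<otimes>\<^bsub>A\<^esub> y)) \<otimes>\<^bsub>A\<^esub> z i y) \<in> carrier A" if "i < n" for i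
        using cD(2,3)[OF that] \<phi>D(1)[OF that] a by (intro A.finsum_closed) auto
      have "(\<Oplus>\<^bsub>LE\<^esub>i\<in>{..<n}. \<beta> i (\<alpha> i F)) a = (\<Oplus>\<^bsub>A\<^esub>i\<in>{..<n}. \<beta> i (\<alpha> i F) a)"
        using \<beta>\<alpha> by (intro finsum_LE_apply a) auto
      also have "\<dots> = (\<Oplus>\<^bsub>A\<^esub>i\<in>{..<n}. F (\<Oplus>\<^bsub>A\<^esub>y\<in>G. h (\<phi> i (a \<otimes>\<^bsub>A\<^esub> y)) \<otimes>\<^bsub>A\<^esub> z i y))"
        using inner FD(1) \<beta>\<alpha>_eq a by (intro A.finsum_cong') auto
      also have "\<dots> = F (\<Oplus>\<^bsub>A\<^esub>i\<in>{..<n}. \<Oplus>\<^bsub>A\<^esub>y\<in>G. h (\<phi> i (a \<otimes>\<^bsub>A\<^esub> y)) \<otimes>\<^bsub>A\<^esub> z i y)"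
        using inner by (subst additive_map_finsum[OF A.is_abelian_group A.is_abelian_group FD(2)]) auto
      finally show "(\<Oplus>\<^bsub>LE\<^esub>i\<in>{..<n}. \<beta> i (\<alpha> i F)) a = F a"
        by (simp add: sum[OF a])
    qed
  qed (use \<alpha> \<beta> in auto)
qed

text \<open>The composite sends x \<otimes> w to \<Sum> z_i(y) \<otimes> \<phi>_i(y x) w. The
  coefficient moves to the left factor, where the left QF formula restores x.\<close>

lemma tensor_divides_LE:
  assumes "left_QF A B h"
  shows "bimod_divides A A (TK (\<otimes>\<^bsub>A\<^esub>)) LE"
proof -
  let ?m = "(\<otimes>\<^bsub>A\<^esub>)"
  interpret T: tensor_product A B A "A_KB ?m" "A_BA A h"
    by (rule tensor_product_A_KB[OF bimodule_A_KB_mult])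
  obtain n :: nat and G \<phi> z where \<phi>: "\<And>i. i < n \<Longrightarrow> bilin (\<phi> i)"
    and c: "\<And>i. i < n \<Longrightarrow> casimir G (z i) (\<lambda>y. y)"
    and sum: "\<And>a. a \<in> carrier A \<Longrightarrow> (\<Oplus>\<^bsub>A\<^esub>i\<in>{..<n}. \<Oplus>\<^bsub>A\<^esub>y\<in>G. z i y \<otimes>\<^bsub>A\<^esub> h (\<phi> i (y \<otimes>\<^bsub>A\<^esub> a))) = a"
    by (rule left_QF_casimir[OF assms]) blast
  have "\<exists>\<beta>. \<beta> \<in> bimod_hom A A (TK ?m) LE \<and> (\<forall>x\<in>carrier A. \<forall>w\<in>carrier A.
      \<beta> (tK ?m x w) = (\<lambda>a\<in>carrier A. h (\<phi> i (a \<otimes>\<^bsub>A\<^esub> x)) \<otimes>\<^bsub>A\<^esub> w))" if "i < n" for i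
    by (rule tensor_LE_hom[OF \<phi>[OF that]]) blast
  then obtain \<beta> where \<beta>: "\<And>i. i < n \<Longrightarrow> \<beta> i \<in> bimod_hom A A (TK ?m) LE"
    and \<beta>_tens: "\<And>i x w. i < n \<Longrightarrow> x \<in> carrier A \<Longrightarrow> w \<in> carrier A \<Longrightarrow>
      \<beta> i (tK ?m x w) = (\<lambda>a\<in>carrier A. h (\<phi> i (a \<otimes>\<^bsub>A\<^esub> x)) \<otimes>\<^bsub>A\<^esub> w)"
    by metis
  define \<alpha> where "\<alpha> i = restrict (\<lambda>F. \<Oplus>\<^bsub>TK ?m\<^esub>y\<in>G. tK ?m (z i y) (F y)) (carrier LE)" for i
  have \<alpha>: "\<alpha> i \<in> bimod_hom A A LE (TK ?m)" if "i < n" for i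
    unfolding \<alpha>_def by (rule coord_LE_hom[OF c[OF that]])
  note t = T.tens_closed[simplified] and cD = casimirD[OF c] and \<phi>D = bilinD[OF \<phi>]
  have \<alpha>\<beta>: "additive_map (TK ?m) (TK ?m) (\<lambda>C. \<alpha> i (\<beta> i C))" if "i < n" for i
    using bimod_hom_additive[OF \<beta>[OF that]] bimod_hom_additive[OF \<alpha>[OF that]]
    by (auto simp: additive_map_def)
  show ?thesis
  proof (rule bimod_dividesI[OF T.bimodule_TP bimodule_LE finite_lessThan])
    fix C assume "C \<in> carrier (TK ?m)"
    then show "(\<Oplus>\<^bsub>TK ?m\<^esub>i\<in>{..<n}. \<alpha> i (\<beta> i C)) = C"
    proof (rule T.additive_eq_on_tens[OF T.TP_abelian_group, rotated 2])
      fix x w assume "x \<in> carrier (A_KB ?m)" "w \<in> carrier (A_BA A h)"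
      then have x: "x \<in> carrier A" and w: "w \<in> carrier A" by simp_all
      have summand: "z i y \<otimes>\<^bsub>A\<^esub> h (\<phi> i (y \<otimes>\<^bsub>A\<^esub> x)) \<in> carrier A" if "i < n" "y \<in> G" for i y
        using cD[OF that(1)] \<phi>D(1)[OF that(1)] that x by auto
      have sum_A_KB: "finsum (A_KB ?m) F I = finsum A F I" if "F \<in> I \<rightarrow> carrier A" for F I
        unfolding A_KB_def using that by (intro finsum_ring_bimod A.is_abelian_group)
      have inner: "(\<Oplus>\<^bsub>A\<^esub>y\<in>G. z i y \<otimes>\<^bsub>A\<^esub> h (\<phi> i (y \<otimes>\<^bsub>A\<^esub> x))) \<in> carrier A" if "i < n" for i
        using summand[OF that] by (intro A.finsum_closed) auto
      have "\<alpha> i (\<beta> i (tK ?m x w)) = tK ?m (\<Oplus>\<^bsub>A\<^esub>y\<in>G. z i y \<otimes>\<^bsub>A\<^esub> h (\<phi> i (y \<otimes>\<^bsub>A\<^esub> x))) w" if i: "i < n" for i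
      proof -
        have "\<alpha> i (\<beta> i (tK ?m x w)) = (\<Oplus>\<^bsub>TK ?m\<^esub>y\<in>G. tK ?m (z i y) (\<beta> i (tK ?m x w) y))"
          using bimod_homD(1)[OF \<beta>[OF i] t[OF x w]] by (simp add: \<alpha>_def)
        also have "\<dots> = (\<Oplus>\<^bsub>TK ?m\<^esub>y\<in>G. tK ?m (z i y \<otimes>\<^bsub>A\<^esub> h (\<phi> i (y \<otimes>\<^bsub>A\<^esub> x))) w)"
          using cD[OF i] \<phi>D(1)[OF i] x w T.tens_balanced t
          by (intro T.TP.finsum_cong') (auto simp: \<beta>_tens[OF i])
        also have "\<dots> = tK ?m (\<Oplus>\<^bsub>A_KB ?m\<^esub>y\<in>G. z i y \<otimes>\<^bsub>A\<^esub> h (\<phi> i (y \<otimes>\<^bsub>A\<^esub> x))) w"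
          using w summand[OF i] by (intro T.tens_finsum_left[symmetric]) auto
        also have "(\<Oplus>\<^bsub>A_KB ?m\<^esub>y\<in>G. z i y \<otimes>\<^bsub>A\<^esub> h (\<phi> i (y \<otimes>\<^bsub>A\<^esub> x))) =
            (\<Oplus>\<^bsub>A\<^esub>y\<in>G. z i y \<otimes>\<^bsub>A\<^esub> h (\<phi> i (y \<otimes>\<^bsub>A\<^esub> x)))"
          using summand[OF i] by (intro sum_A_KB) auto
        finally show ?thesis .
      qed
      then have "(\<Oplus>\<^bsub>TK ?m\<^esub>i\<in>{..<n}. \<alpha> i (\<beta> i (tK ?m x w))) =
          (\<Oplus>\<^bsub>TK ?m\<^esub>i\<in>{..<n}. tK ?m (\<Oplus>\<^bsub>A\<^esub>y\<in>G. z i y \<otimes>\<^bsub>A\<^esub> h (\<phi> i (y \<otimes>\<^bsub>A\<^esub> x))) w)"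
        using t w inner by (intro T.TP.finsum_cong') auto
      also have "\<dots> = tK ?m (\<Oplus>\<^bsub>A_KB ?m\<^esub>i\<in>{..<n}. \<Oplus>\<^bsub>A\<^esub>y\<in>G. z i y \<otimes>\<^bsub>A\<^esub> h (\<phi> i (y \<otimes>\<^bsub>A\<^esub> x))) w"
        using w inner by (intro T.tens_finsum_left[symmetric]) auto
      also have "\<dots> = tK ?m x w"
        using inner by (subst sum_A_KB) (auto simp: sum[OF x])
      finally show "(\<Oplus>\<^bsub>TK ?m\<^esub>i\<in>{..<n}. \<alpha> i (\<beta> i (tK ?m x w))) = tK ?m x w" .
    next
      show "additive_map (TK ?m) (TK ?m) (\<lambda>C. \<Oplus>\<^bsub>TK ?m\<^esub>i\<in>{..<n}. \<alpha> i (\<beta> i C))"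
        using \<alpha>\<beta> by (intro additive_pointwise_finsum T.TP_abelian_group) auto
    qed (simp add: additive_map_def)
  qed (use \<alpha> \<beta> in auto)
qed

end

theorem lemma3p5:
  fixes A :: "('a, 'm) ring_scheme" and B :: "('b, 'n) ring_scheme" and h :: "'b \<Rightarrow> 'a"
  assumes "ring_hom_ring B A h"
    and "QF_extension A B h"
  shows "bimod_similar A A (left_End_AA A B h) (tensor_AA A B h)
    \<and> bimod_similar A A (tensor_AA A B h) (right_End_AA A B h)
    \<and> bimod_similar A A (left_End_AA A B h) (right_End_AA A B h)
    \<and> bimod_similar (right_End_ring A B h) A (tensor_EA A B h) (right_End_EA A B h)"
proof -
  interpret ring_ext A B h
    using assms(1) by (simp add: ring_ext_def ring_hom_ring_def)
  have QF: "left_QF A B h" "right_QF A B h"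
    using assms(2) by (auto simp: QF_extension_def)
  have TA: "tensor_AA A B h = TK (\<otimes>\<^bsub>A\<^esub>)"
    by (simp add: tensor_AA_def A_AB_eq_A_KB)
  have TE: "tensor_EA A B h = TK (\<lambda>f a. f a)"
    by (simp add: tensor_EA_def A_EB_eq)
  have "bimod_divides A A LE (TK (\<otimes>\<^bsub>A\<^esub>))" "bimod_divides A A (TK (\<otimes>\<^bsub>A\<^esub>)) LE"
    using LE_divides_tensor tensor_divides_LE QF by blast+
  moreover have "bimod_divides A A (RE (\<otimes>\<^bsub>A\<^esub>)) (TK (\<otimes>\<^bsub>A\<^esub>))" "bimod_divides A A (TK (\<otimes>\<^bsub>A\<^esub>)) (RE (\<otimes>\<^bsub>A\<^esub>))"
    using RE_divides_tensor tensor_divides_RE bimodule_A_KB_mult QF by blast+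
  \<comment> \<open>The same pair of lemmas with K = E acting on A by evaluation.\<close>
  moreover have "bimod_divides (right_End_ring A B h) A (RE (\<lambda>f a. f a)) (TK (\<lambda>f a. f a))"
    "bimod_divides (right_End_ring A B h) A (TK (\<lambda>f a. f a)) (RE (\<lambda>f a. f a))"
    using RE_divides_tensor tensor_divides_RE bimodule_A_EB QF by blast+
  \<comment> \<open>The two endomorphism bimodules are compared through the tensor product, by
    transitivity in both directions.\<close>
  ultimately show ?thesis
    unfolding TA TE right_End_AA_eq right_End_EA_eq bimod_similar_def
    by (blast intro: bimod_divides_trans)
qed

end
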